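(* Let $Z,U$ be Banach spaces, $a>0$, $0<\eta<1$, $m\ge 1$ an integer, and $0=p_0<t_1<p_1<t_2<\dots<t_m<p_m<t_{m+1}=p_{m+1}=a$. Let $A:D(A)\subseteq Z\to Z$ be densely defined and generate a $C_0$-semigroup $T(t)$ on $Z$ with $M=\sup_{t\in[0,a]}\|T(t)\|<\infty$. Let $q$ be a real number, let $B:L^q([0,a];U)\to L^q([0,a];Z)$ be a linear map, let $z_0\in Z$, let $h:[0,a]\times Z\to Z$ be a function such that, for each $r=0,\dots,m$ and each $z\in C_{1-\eta}([p_r,t_{r+1}];Z)$, the function $t\mapsto h(t,z(t))$ belongs to $L^q([p_r,t_{r+1}];Z)$, and let $\psi_r:[t_r,p_r]\times Z\to Z$ for $r=1,\dots,m$. Assume: (1) $q\in\left(\frac1\eta,\frac1{1-\eta}\right)$. (2) There is a constant $\kappa>0$ such that $\|h(t,z)-h(t,y)\|_Z\le\kappa\|z-y\|_Z$ for all $z,y\in Z$ (and all $t\in[0,a]$). (3) There are a function $\varsigma\in L^q([0,a];\mathbb{R}^+)$ and a constant $d>0$ such that $\|h(t,z)\|_Z\le\varsigma(t)+d\,(t-p_r)^{1-\eta}\|z\|_Z$ for a.e. $t\in(p_r,p_{r+1}]$, $r=0,1,\dots,m$, and all $z\in Z$. (4) For $r=1,\dots,m$, $\psi_r$ is continuous and there is a constant $b_r\in(0,1]$ such that $\|\psi_r(t,z)-\psi_r(t,y)\|_Z\le b_r\|z-y\|_Z$ for all $t\in[t_r,p_r]$ and $z,y\in Z$. (5) $\nu<1$,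 where $$\nu=\max_{r=1,\dots,m}\Bigg\{\frac{Mb_r}{\Gamma(\eta)(t_r-p_{r-1})^{1-\eta}}+\frac{M\kappa\,\Gamma(\eta)}{\Gamma(2\eta)}(t_{r+1}-p_r)^{\eta}+\frac{M}{\Gamma(1+\eta)\Gamma(1-\eta)}\Bigg(\sum_{k=0}^{r-1}\Big(\frac{t_{k+1}-p_k}{p_r-t_{k+1}}\Big)^{\eta}+\sum_{k=0}^{r-2}\frac{b_{k+1}(t_{r+1}-p_r)}{(t_{k+1}-p_k)^{1-\eta}(p_r-p_{k+1})^{\eta}}\Bigg)+\frac{Mb_r(t_{r+1}-p_r)^{1-\eta}}{(t_r-p_{r-1})^{1-\eta}}\Bigg\}$$ (an empty sum is $0$). Then for each control $u\in L^q([0,a];U)$ the system $$\begin{aligned}&{}_0D_t^{\eta}z(t)=Az(t)+Bu(t)+h(t,z(t)),&& t\in\textstyle\bigcup_{r=0}^m(p_r,t_{r+1}],\\ &z(t)=\psi_r(t,z(t_r^-)),&& t\in(t_r,p_r],\ r=1,\dots,m,\\ &{}_{p_r}I_t^{1-\eta}z(t)|_{t=p_r}=\psi_r(p_r,z(t_r^-)),&& r=1,\dots,m,\\ &{}_0I_t^{1-\eta}z(t)|_{t=0}=z_0\end{aligned}$$ admits a unique mild solution in $PC_{1-\eta}([0,a];Z)$.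
   Context: **Fractional operators.** ${}_{t_0}I_t^{\alpha}z(t)=\frac1{\Gamma(\alpha)}\int_{t_0}^t(t-s)^{\alpha-1}z(s)\,ds$ for $\alpha>0$, and for $0<\eta<1$ the Riemann-Liouville derivative is ${}_{t_0}D_t^{\eta}z(t)=\frac1{\Gamma(1-\eta)}\frac{d}{dt}\int_{t_0}^t(t-s)^{-\eta}z(s)\,ds$. $\Gamma$ is the gamma function. $z(t_r^-)$ denotes the left-hand limit of $z$ at $t_r$, and $Bu(s)$ means $(Bu)(s)$. **Spaces.** $C_{1-\eta}([p_r,t_{r+1}];Z)$ is the space of functions $z$ with $(t-p_r)^{1-\eta}z(t)\in C([p_r,t_{r+1}];Z)$. $PC_{1-\eta}([0,a];Z)$ is the space of $Z$-valued functions $z$ (considered on $(0,a]$) such that: $z$ is continuous on $\big(\bigcup_{r=0}^m(p_r,t_{r+1})\big)\cup\big(\bigcup_{r=1}^m(t_r,p_r)\big)$; for $r=1,\dots,m$ the left limits of $z$ at $p_r$ and at $t_r$ exist (in $Z$) with $z(p_r)=z(p_r^-)$ and $z(t_r)=z(t_r^-)$; and $(t-p_r)^{1-\eta}\|z(t)\|$ is bounded on $(p_r,p_{r+1}]$ for $r=0,\dots,m$. Its norm is $\|z\|_{[0,a]}=\max_{r=0,\dots,m}\ \sup_{t\in(p_r,p_{r+1}]}(t-p_r)^{1-\eta}\|z(t)\|$. **The operators $T_\eta(t)$.** For $t\ge0$, $$T_\eta(t)=\eta\int_0^\infty\theta\,\xi_\eta(\theta)\,T(t^\eta\theta)\,d\theta,\qquad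 \xi_\eta(\theta)=\frac1\eta\,\theta^{-1-\frac1\eta}\,\varpi_\eta\big(\theta^{-\frac1\eta}\big),$$ $$\varpi_\eta(\theta)=\frac1\pi\sum_{n=1}^\infty(-1)^{n-1}\theta^{-n\eta-1}\frac{\Gamma(n\eta+1)}{n!}\sin(n\pi\eta),\quad\theta\in(0,\infty).$$ Here $\xi_\eta$ is a probability density on $(0,\infty)$. It is a recalled fact that each $T_\eta(t)$ is a bounded linear operator with $\|T_\eta(t)z\|\le\frac{M}{\Gamma(\eta)}\|z\|$, where $M$ bounds $\|T(\cdot)\|$, and that $T_\eta$ is strongly continuous. **Mild solution.** A function $z\in PC_{1-\eta}([0,a];Z)$ is a mild solution of the system (for the control $u$) if $$z(t)=(t-p_r)^{\eta-1}T_\eta(t-p_r)\psi_r(p_r,z(t_r^-))+\int_{p_r}^t(t-s)^{\eta-1}T_\eta(t-s)\big[Bu(s)+h(s,z(s))+\phi_r(s,z(s))\big]ds$$ for $t\in(p_r,t_{r+1}]$, $r=0,1,\dots,m$, and $$z(t)=\psi_r(t,z(t_r^-))\quad\text{for }t\in(t_r,p_r],\ r=1,\dots,m.$$ For $r=0$ the term $\psi_0(p_0,z(t_0^-))$ is understood as $z_0$ (convention $\psi_0=z_0$) and $\phi_0=0$. For $r=1,\dots,m$, $$\phi_r(t,z(t))=\frac{\eta}{\Gamma(1-\eta)}\sum_{k=0}^{r-1}\left(\int_{p_k}^{t_{k+1}}\frac{z(s)}{(t-s)^{1+\eta}}\,ds+\int_{t_{k+1}}^{p_{k+1}}\frac{\psi_{k+1}(s,z(t_{k+1}^-))}{(t-s)^{1+\eta}}\,ds\right)$$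 (so $\phi_r$ depends on the values of $z$ on earlier intervals). *)

theory Defs
  imports "HOL-Analysis.Analysis"
begin

section \<open>Bochner integration and Lebesgue spaces in arbitrary Banach spaces\<close>

text \<open>
  The library's \<^const>\<open>has_bochner_integral\<close> is restricted to second countable (i.e. separable)
  spaces, since there Borel measurability is the same as strong measurability.  The following is
  the same definition for arbitrary normed spaces, with strong measurability (being an almost
  everywhere limit of simple functions) in place of Borel measurability.
\<close>

definition strongly_measurable :: "'a measure \<Rightarrow> ('a \<Rightarrow> 'b::real_normed_vector) \<Rightarrow> bool" where
  "strongly_measurable M f \<longleftrightarrow>
     (\<exists>s. (\<forall>i::nat. simple_function M (s i)) \<and> (AE x in M. (\<lambda>i. s i x) \<longlonglongrightarrow> f x))"

definition has_banach_integral ::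
    "'a measure \<Rightarrow> ('a \<Rightarrow> 'b::real_normed_vector) \<Rightarrow> 'b \<Rightarrow> bool" where
  "has_banach_integral M f I \<longleftrightarrow> strongly_measurable M f \<and>
     (\<exists>s. (\<forall>i::nat. Bochner_Integration.simple_bochner_integrable M (s i)) \<and>
          (\<lambda>i. \<integral>\<^sup>+x. ennreal (norm (f x - s i x)) \<partial>M) \<longlonglongrightarrow> 0 \<and>
          (\<lambda>i. Bochner_Integration.simple_bochner_integral M (s i)) \<longlonglongrightarrow> I)"

definition banach_integrable :: "'a measure \<Rightarrow> ('a \<Rightarrow> 'b::real_normed_vector) \<Rightarrow> bool" where
  "banach_integrable M f \<longleftrightarrow> (\<exists>I. has_banach_integral M f I)"

definition banach_integral :: "'a measure \<Rightarrow> ('a \<Rightarrow> 'b::real_normed_vector) \<Rightarrow> 'b" where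
  "banach_integral M f = (THE I. has_banach_integral M f I)"

lemma nn_integral_norm_diff_strongly_measurable:
  fixes f :: "'a \<Rightarrow> 'b::real_normed_vector"
  assumes "strongly_measurable M f"
  obtains g :: "('a \<Rightarrow> 'b) \<Rightarrow> 'a \<Rightarrow> ennreal" where
    "\<And>s. simple_function M s \<Longrightarrow> g s \<in> borel_measurable M"
    "\<And>s. AE x in M. ennreal (norm (f x - s x)) = g s x"
proof -
  from assms obtain \<sigma> where \<sigma>: "\<And>i::nat. simple_function M (\<sigma> i)"
    and lim: "AE x in M. (\<lambda>i. \<sigma> i x) \<longlonglongrightarrow> f x"
    unfolding strongly_measurable_def by auto
  define g where "g s x = liminf (\<lambda>i. ennreal (norm (\<sigma> i x - s x)))" for s x
  show ?thesis
  proof (rule that)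
    fix s :: "'a \<Rightarrow> 'b" assume s: "simple_function M s"
    have "(\<lambda>x. ennreal (norm (\<sigma> i x - s x))) \<in> borel_measurable M" for i
      by (rule borel_measurable_simple_function)
         (rule simple_function_compose2[OF \<sigma> s, where h = "\<lambda>x y. ennreal (norm (x - y))"])
    then show "g s \<in> borel_measurable M"
      unfolding g_def by measurable
  next
    fix s :: "'a \<Rightarrow> 'b"
    show "AE x in M. ennreal (norm (f x - s x)) = g s x"
      using lim
    proof eventually_elim
      case (elim x)
      then have "(\<lambda>i. ennreal (norm (\<sigma> i x - s x))) \<longlonglongrightarrow> ennreal (norm (f x - s x))"
        by (intro tendsto_intros)
      then show ?case
        unfolding g_def by (intro lim_imp_Liminf[symmetric] trivial_limit_sequentially)
    qed
  qed
qed

lemma has_banach_integral_unique: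
  fixes f :: "'a \<Rightarrow> 'b::real_normed_vector"
  assumes "has_banach_integral M f I" "has_banach_integral M f J"
  shows "I = J"
proof -
  from assms(1) obtain s where f: "strongly_measurable M f"
    and s: "\<And>i::nat. Bochner_Integration.simple_bochner_integrable M (s i)"
    and s0: "(\<lambda>i. \<integral>\<^sup>+x. ennreal (norm (f x - s i x)) \<partial>M) \<longlonglongrightarrow> 0"
    and sI: "(\<lambda>i. Bochner_Integration.simple_bochner_integral M (s i)) \<longlonglongrightarrow> I"
    unfolding has_banach_integral_def by auto
  from assms(2) obtain t where t: "\<And>i::nat. Bochner_Integration.simple_bochner_integrable M (t i)"
    and t0: "(\<lambda>i. \<integral>\<^sup>+x. ennreal (norm (f x - t i x)) \<partial>M) \<longlonglongrightarrow> 0"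
    and tJ: "(\<lambda>i. Bochner_Integration.simple_bochner_integral M (t i)) \<longlonglongrightarrow> J"
    unfolding has_banach_integral_def by auto
  obtain g :: "('a \<Rightarrow> 'b) \<Rightarrow> 'a \<Rightarrow> ennreal"
    where g: "\<And>s. simple_function M s \<Longrightarrow> g s \<in> borel_measurable M"
      and fg: "\<And>s. AE x in M. ennreal (norm (f x - s x)) = g s x"
    using nn_integral_norm_diff_strongly_measurable[OF f] by blast
  have bound: "ennreal (norm (Bochner_Integration.simple_bochner_integral M (s i) - Bochner_Integration.simple_bochner_integral M (t i)))
      \<le> (\<integral>\<^sup>+x. ennreal (norm (f x - s i x)) \<partial>M) + (\<integral>\<^sup>+x. ennreal (norm (f x - t i x)) \<partial>M)" for i
  proof -
    have simple: "simple_function M (s i)" "simple_function M (t i)"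
      using s[of i] t[of i] by (auto elim: simple_bochner_integrable.cases)
    have "ennreal (norm (Bochner_Integration.simple_bochner_integral M (s i) - Bochner_Integration.simple_bochner_integral M (t i)))
        = norm (Bochner_Integration.simple_bochner_integral M (\<lambda>x. s i x - t i x))"
      using s t by (subst simple_bochner_integral_diff) auto
    also have "\<dots> \<le> Bochner_Integration.simple_bochner_integral M (\<lambda>x. norm (s i x - t i x))"
      using simple_bochner_integrable_compose2[of "(-)" M "s i" "t i"] s t
      by (auto intro!: simple_bochner_integral_norm_bound)
    also have "\<dots> = (\<integral>\<^sup>+x. norm (s i x - t i x) \<partial>M)"
      using simple_bochner_integrable_compose2[of "\<lambda>x y. norm (x - y)" M "s i" "t i"] s t
      by (auto intro!: simple_bochner_integral_eq_nn_integral)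
    also have "\<dots> \<le> (\<integral>\<^sup>+x. g (s i) x + g (t i) x \<partial>M)"
    proof (rule nn_integral_mono_AE)
      show "AE x in M. ennreal (norm (s i x - t i x)) \<le> g (s i) x + g (t i) x"
        using fg[of "s i"] fg[of "t i"]
      proof eventually_elim
        case (elim x)
        have "norm (s i x - t i x) \<le> norm (f x - s i x) + norm (f x - t i x)"
          by (metis dual_order.refl norm_diff_triangle_le norm_minus_commute)
        then have "ennreal (norm (s i x - t i x))
            \<le> ennreal (norm (f x - s i x)) + ennreal (norm (f x - t i x))"
          by (metis ennreal_leI ennreal_plus norm_ge_zero)
        with elim show ?case by simp
      qed
    qed
    also have "\<dots> = (\<integral>\<^sup>+x. g (s i) x \<partial>M) + (\<integral>\<^sup>+x. g (t i) x \<partial>M)"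
      by (rule nn_integral_add) (auto intro: g simple)
    also have "\<dots> = (\<integral>\<^sup>+x. ennreal (norm (f x - s i x)) \<partial>M)
                  + (\<integral>\<^sup>+x. ennreal (norm (f x - t i x)) \<partial>M)"
      using nn_integral_cong_AE[OF fg[of "s i"]] nn_integral_cong_AE[OF fg[of "t i"]] by simp
    finally show ?thesis .
  qed
  have "(\<lambda>i. ennreal (norm (Bochner_Integration.simple_bochner_integral M (s i) - Bochner_Integration.simple_bochner_integral M (t i))))
      \<longlonglongrightarrow> 0"
  proof (rule tendsto_sandwich[OF _ _ tendsto_const[of "0 :: ennreal"]])
    show "(\<lambda>i. (\<integral>\<^sup>+x. ennreal (norm (f x - s i x)) \<partial>M)
              + (\<integral>\<^sup>+x. ennreal (norm (f x - t i x)) \<partial>M)) \<longlonglongrightarrow> 0"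
      using tendsto_add[OF s0 t0] by simp
  qed (simp_all add: bound always_eventually del: ennreal_le_iff)
  then have "(\<lambda>i. norm (Bochner_Integration.simple_bochner_integral M (s i) - Bochner_Integration.simple_bochner_integral M (t i))) \<longlonglongrightarrow> 0"
    by (simp flip: ennreal_0)
  moreover have "(\<lambda>i. norm (Bochner_Integration.simple_bochner_integral M (s i) - Bochner_Integration.simple_bochner_integral M (t i)))
      \<longlonglongrightarrow> norm (I - J)"
    using sI tJ by (intro tendsto_intros)
  ultimately have "norm (I - J) = 0"
    using LIMSEQ_unique by blast
  then show ?thesis by simp
qed

lemma banach_integral_eqI: "has_banach_integral M f I \<Longrightarrow> banach_integral M f = I"
  unfolding banach_integral_def by (rule the_equality) (auto intro: has_banach_integral_unique)

lemma has_bochner_integral_imp_has_banach_integral: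
  fixes f :: "'a \<Rightarrow> 'b::{real_normed_vector, second_countable_topology}"
  assumes "has_bochner_integral M f I"
  shows "has_banach_integral M f I"
  using assms
proof (cases rule: has_bochner_integral.cases)
  case (1 s)
  obtain F where "\<And>i. simple_function M (F i)" "\<And>x. x \<in> space M \<Longrightarrow> (\<lambda>i. F i x) \<longlonglongrightarrow> f x"
    using borel_measurable_implies_sequence_metric[OF 1(1), of undefined] by metis
  then have "strongly_measurable M f"
    unfolding strongly_measurable_def by (intro exI[of _ F]) auto
  then show ?thesis
    unfolding has_banach_integral_def using 1 by auto
qed

lemma integrable_imp_banach_integral_eq:
  fixes f :: "'a \<Rightarrow> 'b::{banach, second_countable_topology}"
  assumes "integrable M f"
  shows "banach_integrable M f" "banach_integral M f = integral\<^sup>L M f"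
  using has_bochner_integral_imp_has_banach_integral[OF has_bochner_integral_integrable[OF assms]]
  by (auto simp: banach_integrable_def intro: banach_integral_eqI)

text \<open>Elements of \<open>L\<^sup>q\<close> are represented by functions; equality in \<open>L\<^sup>q\<close> is equality almost
  everywhere.\<close>

definition Lq_space :: "real \<Rightarrow> real set \<Rightarrow> (real \<Rightarrow> 'b::real_normed_vector) set" where
  "Lq_space q S = {f. strongly_measurable (lebesgue_on S) f \<and>
     (\<integral>\<^sup>+x. ennreal (norm (f x) powr q) \<partial>lebesgue_on S) < \<infinity>}"

definition Lq_eq :: "real set \<Rightarrow> (real \<Rightarrow> 'b) \<Rightarrow> (real \<Rightarrow> 'b) \<Rightarrow> bool" where
  "Lq_eq S f g \<longleftrightarrow> (AE x in lebesgue_on S. f x = g x)"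

text \<open>A linear map between the quotients modulo \<^const>\<open>Lq_eq\<close>, given on representatives; the second
  conjunct is well-definedness. Continuity is not required.\<close>

definition linear_map_Lq :: "real \<Rightarrow> real set \<Rightarrow>
    ((real \<Rightarrow> 'u::real_normed_vector) \<Rightarrow> (real \<Rightarrow> 'z::real_normed_vector)) \<Rightarrow> bool" where
  "linear_map_Lq q S B \<longleftrightarrow>
     (\<forall>u\<in>Lq_space q S. B u \<in> Lq_space q S) \<and>
     (\<forall>u\<in>Lq_space q S. \<forall>v\<in>Lq_space q S. Lq_eq S u v \<longrightarrow> Lq_eq S (B u) (B v)) \<and>
     (\<forall>u\<in>Lq_space q S. \<forall>v\<in>Lq_space q S. Lq_eq S (B (\<lambda>x. u x + v x)) (\<lambda>x. B u x + B v x)) \<and>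
     (\<forall>c::real. \<forall>u\<in>Lq_space q S. Lq_eq S (B (\<lambda>x. c *\<^sub>R u x)) (\<lambda>x. c *\<^sub>R B u x))"


section \<open>Semigroups\<close>

text \<open>Only the values at nonnegative times are relevant.\<close>

definition C0_semigroup :: "(real \<Rightarrow> 'z::real_normed_vector \<Rightarrow>\<^sub>L 'z) \<Rightarrow> bool" where
  "C0_semigroup T \<longleftrightarrow> T 0 = id_blinfun \<and>
     (\<forall>s\<ge>0. \<forall>t\<ge>0. T (s + t) = T s o\<^sub>L T t) \<and>
     (\<forall>x. ((\<lambda>t. blinfun_apply (T t) x) \<longlongrightarrow> x) (at_right 0))"

text \<open>\<open>A\<close> with domain \<open>D\<close> is the infinitesimal generator of \<open>T\<close>; the values of \<open>A\<close> outside \<open>D\<close>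
  are irrelevant.\<close>

definition generator_of :: "'z set \<Rightarrow> ('z \<Rightarrow> 'z) \<Rightarrow> (real \<Rightarrow> 'z::real_normed_vector \<Rightarrow>\<^sub>L 'z) \<Rightarrow> bool" where
  "generator_of D A T \<longleftrightarrow>
     (\<forall>x y. (x \<in> D \<and> A x = y) \<longleftrightarrow>
        ((\<lambda>h. (1 / h) *\<^sub>R (blinfun_apply (T h) x - x)) \<longlongrightarrow> y) (at_right 0))"

text \<open>The sums over \<open>n \<ge> 1\<close> are indexed here by \<open>n - 1\<close>.\<close>

definition stable_density :: "real \<Rightarrow> real \<Rightarrow> real" where
  "stable_density \<eta> \<theta> = 1 / pi *
     (\<Sum>n. (- 1) ^ n * \<theta> powr (- real (Suc n) * \<eta> - 1) *
           (Gamma (real (Suc n) * \<eta> + 1) / fact (Suc n)) * sin (real (Suc n) * pi * \<eta>))"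

definition xi_density :: "real \<Rightarrow> real \<Rightarrow> real" where
  "xi_density \<eta> \<theta> = 1 / \<eta> * \<theta> powr (- 1 - 1 / \<eta>) * stable_density \<eta> (\<theta> powr (- 1 / \<eta>))"

definition T_eta :: "real \<Rightarrow> (real \<Rightarrow> 'z::banach \<Rightarrow>\<^sub>L 'z) \<Rightarrow> real \<Rightarrow> 'z \<Rightarrow> 'z" where
  "T_eta \<eta> T t x = \<eta> *\<^sub>R banach_integral (lebesgue_on {0<..})
     (\<lambda>\<theta>. (\<theta> * xi_density \<eta> \<theta>) *\<^sub>R blinfun_apply (T (t powr \<eta> * \<theta>)) x)"


section \<open>Weighted function spaces\<close>

text \<open>Functions on \<open>(c, d]\<close> whose weighted version extends continuously to \<open>[c, d]\<close>; the value at the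
  left end point \<open>c\<close>, where the weight vanishes, plays no role.\<close>

definition C_weighted :: "real \<Rightarrow> real \<Rightarrow> real \<Rightarrow> (real \<Rightarrow> 'z::real_normed_vector) set" where
  "C_weighted \<eta> c d = {z. \<exists>g. continuous_on {c..d} g \<and>
     (\<forall>t\<in>{c<..d}. g t = (t - c) powr (1 - \<eta>) *\<^sub>R z t)}"

definition left_lim :: "(real \<Rightarrow> 'z::t2_space) \<Rightarrow> real \<Rightarrow> 'z" where
  "left_lim z x = Lim (at_left x) z"

text \<open>The break points are \<open>0 = p 0 < \<tau> 1 < p 1 < \<dots> < \<tau> m < p m < \<tau> (m + 1) = p (m + 1) = a\<close>; the value
  \<open>\<tau> 0\<close> is never used.\<close>

definition partition_points :: "real \<Rightarrow> nat \<Rightarrow> (nat \<Rightarrow> real) \<Rightarrow> (nat \<Rightarrow> real) \<Rightarrow> bool" where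
  "partition_points a m p \<tau> \<longleftrightarrow> p 0 = 0 \<and> (\<forall>r\<le>m. p r < \<tau> (r + 1)) \<and>
     (\<forall>r\<in>{1..m}. \<tau> r < p r) \<and> \<tau> (m + 1) = a \<and> p (m + 1) = a"

definition PC_weighted ::
    "real \<Rightarrow> nat \<Rightarrow> (nat \<Rightarrow> real) \<Rightarrow> (nat \<Rightarrow> real) \<Rightarrow> (real \<Rightarrow> 'z::real_normed_vector) set" where
  "PC_weighted \<eta> m p \<tau> = {z.
     continuous_on ((\<Union>r\<in>{0..m}. {p r<..<\<tau> (r + 1)}) \<union> (\<Union>r\<in>{1..m}. {\<tau> r<..<p r})) z \<and>
     (\<forall>r\<in>{1..m}. (z \<longlongrightarrow> z (p r)) (at_left (p r)) \<and> (z \<longlongrightarrow> z (\<tau> r)) (at_left (\<tau> r))) \<and>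
     (\<forall>r\<in>{0..m}. \<exists>C. \<forall>t\<in>{p r<..p (r + 1)}. (t - p r) powr (1 - \<eta>) * norm (z t) \<le> C)}"


section \<open>Mild solutions\<close>

text \<open>For \<open>r = 0\<close> the sum is empty, which is the convention \<open>\<phi>\<^sub>0 = 0\<close>.\<close>

definition phi :: "real \<Rightarrow> (nat \<Rightarrow> real) \<Rightarrow> (nat \<Rightarrow> real) \<Rightarrow> (nat \<Rightarrow> real \<Rightarrow> 'z::banach \<Rightarrow> 'z) \<Rightarrow>
    (real \<Rightarrow> 'z) \<Rightarrow> nat \<Rightarrow> real \<Rightarrow> 'z" where
  "phi \<eta> p \<tau> \<psi> z r t = (\<eta> / Gamma (1 - \<eta>)) *\<^sub>R
     (\<Sum>k<r.
        banach_integral (lebesgue_on {p k..\<tau> (k + 1)})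
          (\<lambda>s. (1 / (t - s) powr (1 + \<eta>)) *\<^sub>R z s) +
        banach_integral (lebesgue_on {\<tau> (k + 1)..p (k + 1)})
          (\<lambda>s. (1 / (t - s) powr (1 + \<eta>)) *\<^sub>R \<psi> (k + 1) s (left_lim z (\<tau> (k + 1)))))"

definition initial_value :: "(nat \<Rightarrow> real) \<Rightarrow> (nat \<Rightarrow> real) \<Rightarrow> (nat \<Rightarrow> real \<Rightarrow> 'z::banach \<Rightarrow> 'z) \<Rightarrow> 'z \<Rightarrow>
    (real \<Rightarrow> 'z) \<Rightarrow> nat \<Rightarrow> 'z" where
  "initial_value p \<tau> \<psi> z0 z r = (if r = 0 then z0 else \<psi> r (p r) (left_lim z (\<tau> r)))"

definition mild_solution ::
    "real \<Rightarrow> nat \<Rightarrow> (nat \<Rightarrow> real) \<Rightarrow> (nat \<Rightarrow> real) \<Rightarrow> (real \<Rightarrow> 'z::banach \<Rightarrow>\<^sub>L 'z) \<Rightarrow>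
     ((real \<Rightarrow> 'u) \<Rightarrow> real \<Rightarrow> 'z) \<Rightarrow> (real \<Rightarrow> 'z \<Rightarrow> 'z) \<Rightarrow> (nat \<Rightarrow> real \<Rightarrow> 'z \<Rightarrow> 'z) \<Rightarrow> 'z \<Rightarrow>
     (real \<Rightarrow> 'u) \<Rightarrow> (real \<Rightarrow> 'z) \<Rightarrow> bool" where
  "mild_solution \<eta> m p \<tau> T B h \<psi> z0 u z \<longleftrightarrow>
     z \<in> PC_weighted \<eta> m p \<tau> \<and>
     (\<forall>r\<in>{0..m}. \<forall>t\<in>{p r<..\<tau> (r + 1)}.
        let F = (\<lambda>s. (t - s) powr (\<eta> - 1) *\<^sub>R
                     T_eta \<eta> T (t - s) (B u s + h s (z s) + phi \<eta> p \<tau> \<psi> z r s))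
        in banach_integrable (lebesgue_on {p r..t}) F \<and>
           z t = (t - p r) powr (\<eta> - 1) *\<^sub>R T_eta \<eta> T (t - p r) (initial_value p \<tau> \<psi> z0 z r)
                 + banach_integral (lebesgue_on {p r..t}) F) \<and>
     (\<forall>r\<in>{1..m}. \<forall>t\<in>{\<tau> r<..p r}. z t = \<psi> r t (left_lim z (\<tau> r)))"

text \<open>The sum \<open>\<Sum>k = 0, \<dots>, r - 2\<close> ranges over \<open>k < r - 1\<close>.\<close>

definition contraction_const ::
    "real \<Rightarrow> real \<Rightarrow> real \<Rightarrow> nat \<Rightarrow> (nat \<Rightarrow> real) \<Rightarrow> (nat \<Rightarrow> real) \<Rightarrow> (nat \<Rightarrow> real) \<Rightarrow> real" where
  "contraction_const \<eta> M \<kappa> m p \<tau> b = Max ((\<lambda>r.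
       M * b r / (Gamma \<eta> * (\<tau> r - p (r - 1)) powr (1 - \<eta>))
     + M * \<kappa> * Gamma \<eta> / Gamma (2 * \<eta>) * (\<tau> (r + 1) - p r) powr \<eta>
     + M / (Gamma (1 + \<eta>) * Gamma (1 - \<eta>)) *
         ((\<Sum>k<r. ((\<tau> (k + 1) - p k) / (p r - \<tau> (k + 1))) powr \<eta>)
        + (\<Sum>k<r - 1. b (k + 1) * (\<tau> (r + 1) - p r) /
             ((\<tau> (k + 1) - p k) powr (1 - \<eta>) * (p r - p (k + 1)) powr \<eta>)))
     + M * b r * (\<tau> (r + 1) - p r) powr (1 - \<eta>) / (\<tau> r - p (r - 1)) powr (1 - \<eta>)) ` {1..m})"

end

theory Submission
  imports Defs "HOL-Complex_Analysis.Complex_Analysis" "HOL-Real_Asymp.Real_Asymp"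
begin

text \<open>
  The memory term on the \<open>r\<close>-th interval depends only on earlier values of \<open>z\<close>, so the equation is
  solved successively on the intervals \<open>(p r, \<tau> (r + 1)]\<close>, where it is a Volterra equation with a weakly
  singular kernel and a known forcing: a function in \<open>L\<^sup>q\<close> plus one bounded by a multiple of
  \<open>(t - p r) powr (- \<eta>)\<close>.  In the norm weighted by \<open>exp (- l (t - p r)) (t - p r) powr (1 - \<eta>)\<close> the
  Volterra operator is a contraction as soon as \<open>l\<close> is large, whatever the size of its constants.

  The operators \<open>T_eta\<close> are bounded on \<open>[0, a]\<close> although the semigroup may grow exponentially, because
  \<open>xi_density\<close> decays faster than every exponential.  This follows by writing \<open>\<theta> * xi_density \<eta> \<theta>\<close> as a
  Hankel type integral of \<open>exp (s - \<theta> s\<^sup>\<eta>)\<close> and moving the contour far to the right.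
\<close>

section \<open>The Bochner integral in Banach spaces\<close>

text \<open>The singularity of the forcing at \<open>p r\<close> stems from the jump interval that
  ends there: integrating (t - s)^(-1 - eta) over it leaves a term of order (t - p r)^(-eta),
  whereas the pieces on which z itself may blow up end at some \<open>\<tau> (k + 1)\<close>
  strictly before \<open>p r\<close>. Convolving (t - s)^(eta - 1) with (s - p r)^(-eta) gives the
  constant Beta (1 - eta) eta, and q > 1 / eta makes the kernel integrable to the conjugate
  exponent. The integral term therefore stays bounded and disappears at \<open>p r\<close> under the
  weight (t - p r)^(1 - eta), so the solution lies in \<open>C_weighted\<close>, the class on which
  h is assumed to produce L^q functions. Uniqueness, however, is claimed among functions that are
  merely bounded in the weighted sense; there suprema are compared and no function space is
  involved. Since Z may be nonseparable, Borel measurability alone is too weak; strong measurability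
  is handled through Borel functions whose range lies in the closure of a countable set.\<close>

lemma separable_range_simple_approx:
  fixes f :: "'a \<Rightarrow> 'b::real_normed_vector"
  assumes f: "f \<in> borel_measurable M" and C: "countable C" "f ` space M \<subseteq> closure C"
  obtains s where "\<And>i. simple_function M (s i)"
    "\<And>x. x \<in> space M \<Longrightarrow> (\<lambda>i. s i x) \<longlonglongrightarrow> f x"
    "\<And>i x. norm (f x - s i x) \<le> norm (f x)"
proof -
  \<comment> \<open>Adding 0 makes the set nonempty, so that the enumeration hits exactly its
    points.\<close>
  define c where "c = from_nat_into (insert 0 C)"
  have c: "range c = insert 0 C"
    unfolding c_def using C by (intro range_from_nat_into) auto
  \<comment> \<open>Greedy choice: \<open>s n\<close> holds the nearest point so far among 0 and the
    first n points of the enumeration. The distance to f never increases, and the start at 0 bounds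
    it by the norm of f.\<close>
  define s :: "nat \<Rightarrow> 'a \<Rightarrow> 'b" where
    "s = rec_nat (\<lambda>x. 0) (\<lambda>n sn x. if dist (f x) (c n) < dist (f x) (sn x) then c n else sn x)"
  have s0: "s 0 x = 0" for x by (simp add: s_def)
  have sS: "s (Suc n) x = (if dist (f x) (c n) < dist (f x) (s n x) then c n else s n x)" for n x
    by (simp add: s_def)
  have simple: "simple_function M (s n)" for n
  proof (induction n)
    case 0
    then show ?case by (simp add: s_def)
  next
    case (Suc n)
    have [measurable]: "s n \<in> borel_measurable M"
      using Suc by (rule borel_measurable_simple_function)
    have [measurable]: "(\<lambda>x. dist (f x) (c n)) \<in> borel_measurable M"
      by (rule measurable_compose[OF f])
         (intro borel_measurable_continuous_onI continuous_intros)
    \<comment> \<open>In a nonseparable space the distance of two Borel functions need not be Borel.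
      It is assembled from the finitely many values of \<open>s n\<close>, so that each summand has
      a fixed second argument.\<close>
    have "(\<lambda>x. dist (f x) (s n x)) \<in> borel_measurable M"
    proof -
      have fin: "finite (s n ` space M)" using Suc by (rule simple_functionD)
      have "(\<lambda>x. \<Sum>y\<in>s n ` space M. indicator (s n -` {y} \<inter> space M) x * dist (f x) y) \<in> borel_measurable M"
      proof (intro borel_measurable_sum borel_measurable_times)
        fix y
        have "s n -` {y} \<inter> space M \<in> sets M" using Suc by (rule simple_functionD)
        then show "(indicator (s n -` {y} \<inter> space M) :: _ \<Rightarrow> real) \<in> borel_measurable M" by simp
        show "(\<lambda>x. dist (f x) y) \<in> borel_measurable M"
          by (rule measurable_compose[OF f])
             (intro borel_measurable_continuous_onI continuous_intros)
      qed
      also have "?this \<longleftrightarrow> ?thesis"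
      proof (rule measurable_cong)
        fix x assume x: "x \<in> space M"
        have "(\<Sum>y\<in>s n ` space M. indicator (s n -` {y} \<inter> space M) x * dist (f x) y)
            = (\<Sum>y\<in>s n ` space M. if s n x = y then dist (f x) y else 0)"
          using x by (intro sum.cong) (auto simp: indicator_def)
        also have "\<dots> = dist (f x) (s n x)"
          using x fin by (subst sum.delta') auto
        finally show "(\<Sum>y\<in>s n ` space M. indicator (s n -` {y} \<inter> space M) x * dist (f x) y)
            = dist (f x) (s n x)" .
      qed
      finally show ?thesis .
    qed
    then show ?case
      unfolding sS by (intro simple_function_If Suc simple_function_const) measurable
  qed
  have step: "dist (f x) (s (Suc n) x) \<le> dist (f x) (s n x)" for n x
    by (simp add: sS)
  then have anti: "dist (f x) (s m x) \<le> dist (f x) (s n x)" if "n \<le> m" for n m x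
    using that by (rule lift_Suc_antimono_le)
  have le_c: "dist (f x) (s (Suc n) x) \<le> dist (f x) (c n)" for n x
    by (simp add: sS)
  show ?thesis
  proof
    fix x assume "x \<in> space M"
    then have cl: "f x \<in> closure C" using C by auto
    show "(\<lambda>i. s i x) \<longlonglongrightarrow> f x"
    proof (rule metric_LIMSEQ_I)
      fix e :: real assume "e > 0"
      with cl obtain y where "y \<in> C" "dist y (f x) < e"
        unfolding closure_approachable by blast
      then obtain n where n: "dist (f x) (c n) < e"
        using c by (metis dist_commute insertI2 rangeE)
      then show "\<exists>no. \<forall>m\<ge>no. dist (s m x) (f x) < e"
        using anti[of "Suc n" _ x] le_c[of x n] by (metis dist_commute le_less_trans)
    qed
  next
    show "norm (f x - s i x) \<le> norm (f x)" for x i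
      using anti[of 0 i x] by (simp add: s0 dist_norm)
  qed (rule simple)
qed

lemma strongly_measurable_separable_range:
  fixes f :: "'a \<Rightarrow> 'b::real_normed_vector"
  assumes "f \<in> borel_measurable M" "countable C" "f ` space M \<subseteq> closure C"
  shows "strongly_measurable M f"
proof -
  obtain s where "\<And>i. simple_function M (s i)" "\<And>x. x \<in> space M \<Longrightarrow> (\<lambda>i. s i x) \<longlonglongrightarrow> f x"
    by (rule separable_range_simple_approx[OF assms]) blast
  then show ?thesis
    unfolding strongly_measurable_def by (auto intro!: exI[of _ s])
qed

lemma strongly_measurable_cong_AE:
  assumes "strongly_measurable M f" "AE x in M. f x = g x"
  shows "strongly_measurable M g"
proof -
  from assms obtain s where "\<And>i::nat. simple_function M (s i)" "AE x in M. (\<lambda>i. s i x) \<longlonglongrightarrow> f x"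
    unfolding strongly_measurable_def by auto
  moreover from this(2) assms(2) have "AE x in M. (\<lambda>i. s i x) \<longlonglongrightarrow> g x"
    by eventually_elim auto
  ultimately show ?thesis
    unfolding strongly_measurable_def by auto
qed

text \<open>Converse of \<open>strongly_measurable_separable_range\<close> up to a null set;
  together they form Pettis' characterisation. The values of the approximating simple functions
  supply the countable set.\<close>

lemma strongly_measurable_borel_separable:
  fixes f :: "'a \<Rightarrow> 'b::real_normed_vector"
  assumes "strongly_measurable M f"
  obtains g C where "g \<in> borel_measurable M" "countable C" "g ` space M \<subseteq> closure C"
    "AE x in M. f x = g x"
proof -
  from assms obtain s where s: "\<And>i::nat. simple_function M (s i)"
    and lim: "AE x in M. (\<lambda>i. s i x) \<longlonglongrightarrow> f x"
    unfolding strongly_measurable_def by auto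
  from lim obtain N where N: "N \<in> null_sets M" "\<And>x. x \<in> space M \<Longrightarrow> x \<notin> N \<Longrightarrow> (\<lambda>i. s i x) \<longlonglongrightarrow> f x"
    by (elim AE_E3) blast
  \<comment> \<open>Replacing all functions by 0 on \<open>N\<close> turns almost everywhere
    convergence into convergence at every point.\<close>
  define g where "g x = (if x \<in> N then 0 else f x)" for x
  define t where "t i x = (if x \<in> N then 0 else s i x)" for i x
  have t: "simple_function M (t i)" for i
    unfolding t_def using N(1)
    by (intro simple_function_If simple_function_const s) auto
  have tg: "(\<lambda>i. t i x) \<longlonglongrightarrow> g x" if "x \<in> space M" for x
    using N(2)[OF that] by (auto simp: t_def g_def)
  define C where "C = (\<Union>i. t i ` space M)"
  show ?thesis
  proof
    show "g \<in> borel_measurable M"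
      by (rule borel_measurable_LIMSEQ_metric[OF borel_measurable_simple_function[OF t] tg])
    show "countable C"
      unfolding C_def by (intro countable_UN countableI_type countable_finite[OF simple_functionD(1)[OF t]])
    show "g ` space M \<subseteq> closure C"
    proof safe
      fix x assume x: "x \<in> space M"
      then have "t i x \<in> C" for i
        unfolding C_def by blast
      with tg[OF x] show "g x \<in> closure C"
        unfolding closure_sequential by (intro exI[of _ "\<lambda>i. t i x"]) simp
    qed
    show "AE x in M. f x = g x"
      using N(1) by (intro AE_I'[OF N(1)]) (auto simp: g_def)
  qed
qed

text \<open>A diagonal choice of simple functions is avoided: Borel measurability survives pointwise
  limits, and the range of the limit stays in the closure of a countable union of countable
  sets.\<close>

lemma strongly_measurable_LIMSEQ:
  fixes f :: "nat \<Rightarrow> 'a \<Rightarrow> 'b::real_normed_vector"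
  assumes "\<And>i. strongly_measurable M (f i)" and lim: "AE x in M. (\<lambda>i. f i x) \<longlonglongrightarrow> l x"
  shows "strongly_measurable M l"
proof -
  have "\<forall>i. \<exists>g C. g \<in> borel_measurable M \<and> countable C \<and> g ` space M \<subseteq> closure C \<and>
          (AE x in M. f i x = g x)"
    by (rule allI, rule strongly_measurable_borel_separable[OF assms(1)]) blast
  then obtain g C where g: "\<And>i. g i \<in> borel_measurable M" "\<And>i. countable (C i)"
    "\<And>i. g i ` space M \<subseteq> closure (C i)" "\<And>i. AE x in M. f i x = g i x"
    by metis
  have "AE x in M. \<forall>i. f i x = g i x"
    using g(4) by (simp add: AE_all_countable)
  with lim have "AE x in M. (\<lambda>i. g i x) \<longlonglongrightarrow> l x"
    by eventually_elim simp
  then obtain N where N: "N \<in> null_sets M" "\<And>x. x \<in> space M \<Longrightarrow> x \<notin> N \<Longrightarrow> (\<lambda>i. g i x) \<longlonglongrightarrow> l x"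
    by (elim AE_E3) blast
  define l' where "l' x = (if x \<in> N then 0 else l x)" for x
  define g' where "g' i x = (if x \<in> N then 0 else g i x)" for i x
  have lim': "(\<lambda>i. g' i x) \<longlonglongrightarrow> l' x" if "x \<in> space M" for x
    using N(2)[OF that] by (auto simp: g'_def l'_def)
  have "strongly_measurable M l'"
  proof (rule strongly_measurable_separable_range)
    show "l' \<in> borel_measurable M"
    proof (rule borel_measurable_LIMSEQ_metric[OF _ lim'])
      show "g' i \<in> borel_measurable M" for i
        unfolding g'_def using g(1)[of i] N(1) by (intro measurable_If) auto
    qed
    \<comment> \<open>The point 0 is the value on the exceptional set \<open>N\<close>.\<close>
    show "countable (insert 0 (\<Union>i. C i))"
      using g(2) by auto
    have "g' i x \<in> closure (insert 0 (\<Union>i. C i))" if "x \<in> space M" for i x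
    proof (cases "x \<in> N")
      case True
      then show ?thesis using closure_subset by (force simp: g'_def)
    next
      case False
      have "g i x \<in> closure (C i)" using g(3) that by auto
      also have "\<dots> \<subseteq> closure (insert 0 (\<Union>i. C i))"
        by (intro closure_mono) auto
      finally show ?thesis using False by (simp add: g'_def)
    qed
    then show "l' ` space M \<subseteq> closure (insert 0 (\<Union>i. C i))"
      using closed_sequentially[OF closed_closure _ lim'] by auto
  qed
  moreover have "AE x in M. l' x = l x"
    by (intro AE_I'[OF N(1)]) (auto simp: l'_def)
  ultimately show ?thesis
    by (rule strongly_measurable_cong_AE)
qed

lemma strongly_measurable_compose2:
  assumes "strongly_measurable M f" "strongly_measurable M g"
    and p: "\<And>X Y x y. X \<longlonglongrightarrow> x \<Longrightarrow> Y \<longlonglongrightarrow> y \<Longrightarrow> (\<lambda>i::nat. p (X i) (Y i)) \<longlonglongrightarrow> p x y"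
  shows "strongly_measurable M (\<lambda>x. p (f x) (g x))"
proof -
  from assms obtain s t where s: "\<And>i::nat. simple_function M (s i)" "\<And>i::nat. simple_function M (t i)"
    and lim: "AE x in M. (\<lambda>i. s i x) \<longlonglongrightarrow> f x" "AE x in M. (\<lambda>i. t i x) \<longlonglongrightarrow> g x"
    unfolding strongly_measurable_def by auto
  from lim have "AE x in M. (\<lambda>i. p (s i x) (t i x)) \<longlonglongrightarrow> p (f x) (g x)"
    by eventually_elim (rule p)
  moreover have "simple_function M (\<lambda>x. p (s i x) (t i x))" for i
    using s by (rule simple_function_compose2)
  ultimately show ?thesis
    unfolding strongly_measurable_def by (intro exI[of _ "\<lambda>i x. p (s i x) (t i x)"]) auto
qed

lemma strongly_measurable_borel:
  fixes f :: "'a \<Rightarrow> 'b::{real_normed_vector, second_countable_topology}"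
  assumes "f \<in> borel_measurable M"
  shows "strongly_measurable M f"
proof -
  obtain F where "\<And>i. simple_function M (F i)" "\<And>x. x \<in> space M \<Longrightarrow> (\<lambda>i. F i x) \<longlonglongrightarrow> f x"
    using borel_measurable_implies_sequence_metric[OF assms, of 0] by blast
  then show ?thesis
    unfolding strongly_measurable_def by (auto intro!: exI[of _ F])
qed

lemma strongly_measurable_const: "strongly_measurable M (\<lambda>x. c)"
  unfolding strongly_measurable_def by (intro exI[of _ "\<lambda>i x. c"]) auto

lemma strongly_measurable_add:
  "strongly_measurable M f \<Longrightarrow> strongly_measurable M g \<Longrightarrow> strongly_measurable M (\<lambda>x. f x + g x)"
  by (rule strongly_measurable_compose2) (auto intro: tendsto_intros)

lemma strongly_measurable_diff:
  "strongly_measurable M f \<Longrightarrow> strongly_measurable M g \<Longrightarrow> strongly_measurable M (\<lambda>x. f x - g x)"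
  by (rule strongly_measurable_compose2) (auto intro: tendsto_intros)

lemma strongly_measurable_scaleR:
  fixes r :: "'a \<Rightarrow> real"
  shows "r \<in> borel_measurable M \<Longrightarrow> strongly_measurable M f \<Longrightarrow> strongly_measurable M (\<lambda>x. r x *\<^sub>R f x)"
  by (rule strongly_measurable_compose2[OF strongly_measurable_borel]) (auto intro: tendsto_intros)

text \<open>The measure need not be complete, so the norm is replaced by an almost everywhere equal
  Borel function, to which theorems on real integrals apply.\<close>

lemma strongly_measurable_norm:
  assumes "strongly_measurable M f"
  obtains g :: "'a \<Rightarrow> real" where "g \<in> borel_measurable M" "AE x in M. norm (f x) = g x" "\<And>x. g x \<ge> 0"
proof -
  obtain g where g: "g \<in> borel_measurable M" "AE x in M. f x = g x"
    by (rule strongly_measurable_borel_separable[OF assms]) blast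
  then have "(\<lambda>x. norm (g x)) \<in> borel_measurable M"
    by (intro measurable_compose[OF g(1)] borel_measurable_continuous_onI continuous_intros)
  moreover have "AE x in M. norm (f x) = norm (g x)" using g(2) by eventually_elim auto
  ultimately show ?thesis using that by fastforce
qed

lemma strongly_measurable_restrict_space:
  fixes f :: "'a \<Rightarrow> 'b::real_normed_vector"
  assumes S: "S \<inter> space M \<in> sets M"
  shows "strongly_measurable (restrict_space M S) f \<longleftrightarrow> strongly_measurable M (\<lambda>x. indicator S x *\<^sub>R f x)"
proof
  assume "strongly_measurable (restrict_space M S) f"
  then obtain s where s: "\<And>i::nat. simple_function (restrict_space M S) (s i)"
    "AE x in restrict_space M S. (\<lambda>i. s i x) \<longlonglongrightarrow> f x"
    unfolding strongly_measurable_def by auto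
  then have "AE x in M. x \<in> S \<longrightarrow> (\<lambda>i. s i x) \<longlonglongrightarrow> f x"
    using S by (simp add: AE_restrict_space_iff)
  then have "AE x in M. (\<lambda>i. indicator S x *\<^sub>R s i x) \<longlonglongrightarrow> indicator S x *\<^sub>R f x"
    by eventually_elim (auto simp: indicator_def)
  moreover have "simple_function M (\<lambda>x. indicator S x *\<^sub>R s i x)" for i
    using s(1)[of i] simple_function_restrict_space[OF S] by blast
  ultimately show "strongly_measurable M (\<lambda>x. indicator S x *\<^sub>R f x)"
    unfolding strongly_measurable_def by (intro exI[of _ "\<lambda>i x. indicator S x *\<^sub>R s i x"]) auto
next
  assume "strongly_measurable M (\<lambda>x. indicator S x *\<^sub>R f x)"
  then obtain s where s: "\<And>i::nat. simple_function M (s i)"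
    "AE x in M. (\<lambda>i. s i x) \<longlonglongrightarrow> indicator S x *\<^sub>R f x"
    unfolding strongly_measurable_def by auto
  have "simple_function M (\<lambda>x. indicator S x *\<^sub>R s i x)" for i
  proof -
    have "simple_function M (\<lambda>x. if x \<in> S then s i x else 0)"
    proof (intro simple_function_If s simple_function_const)
      have "{x \<in> space M. x \<in> S} = S \<inter> space M" by auto
      then show "{x \<in> space M. x \<in> S} \<in> sets M" using S by simp
    qed
    then show ?thesis
      by (rule back_subst[of "simple_function M"]) (auto simp: indicator_def)
  qed
  then have "simple_function (restrict_space M S) (s i)" for i
    using simple_function_restrict_space[OF S] by blast
  moreover have "AE x in restrict_space M S. (\<lambda>i. s i x) \<longlonglongrightarrow> f x"
    unfolding AE_restrict_space_iff[OF S] using s(2) by eventually_elim auto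
  ultimately show "strongly_measurable (restrict_space M S) f"
    unfolding strongly_measurable_def by auto
qed

text \<open>A set of reals is separable, hence so is its continuous image.\<close>

lemma strongly_measurable_continuous_on:
  fixes f :: "real \<Rightarrow> 'b::real_normed_vector"
  assumes "continuous_on S f" "S \<in> sets lebesgue"
  shows "strongly_measurable (lebesgue_on S) f"
proof -
  obtain D where D: "countable D" "D \<subseteq> S" "S \<subseteq> closure D"
    by (rule separable)
  show ?thesis
  proof (rule strongly_measurable_separable_range)
    show "f \<in> borel_measurable (lebesgue_on S)"
      using assms by (rule continuous_imp_measurable_on_sets_lebesgue)
    show "countable (f ` D)" using D by auto
    show "f ` space (lebesgue_on S) \<subseteq> closure (f ` D)"
    proof safe
      fix x assume "x \<in> space (lebesgue_on S)"
      then have x: "x \<in> S" by simp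
      then have "x \<in> closure D" using D(3) by auto
      then obtain X where X: "\<And>n. X n \<in> D" "X \<longlonglongrightarrow> x"
        unfolding closure_sequential by auto
      then have "(\<lambda>n. f (X n)) \<longlonglongrightarrow> f x"
        using assms(1) x D(2) unfolding continuous_on_sequentially comp_def by blast
      then show "f x \<in> closure (f ` D)"
        unfolding closure_sequential using X by (intro exI[of _ "\<lambda>n. f (X n)"]) auto
    qed
  qed
qed

lemma strongly_measurable_Ioc:
  fixes f :: "real \<Rightarrow> 'b::real_normed_vector"
  assumes "continuous_on {c<..d} f"
  shows "strongly_measurable (lebesgue_on {c..d}) f"
proof -
  have "strongly_measurable (lebesgue_on {c<..d}) f"
    by (rule strongly_measurable_continuous_on[OF assms]) auto
  then have "strongly_measurable lebesgue (\<lambda>s. indicator {c<..d} s *\<^sub>R f s)"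
    by (subst (asm) strongly_measurable_restrict_space) auto
  moreover have "AE s in lebesgue. indicator {c<..d} s *\<^sub>R f s = indicator {c..d} s *\<^sub>R f s"
    using AE_completion[OF AE_lborel_singleton[of c]]
    by eventually_elim (auto simp: indicator_def)
  ultimately have "strongly_measurable lebesgue (\<lambda>s. indicator {c..d} s *\<^sub>R f s)"
    by (rule strongly_measurable_cong_AE)
  then show ?thesis
    by (subst strongly_measurable_restrict_space) auto
qed

lemma strongly_measurable_sum:
  fixes f :: "'i \<Rightarrow> 'a \<Rightarrow> 'b::real_normed_vector"
  assumes "finite I" "\<And>i. i \<in> I \<Longrightarrow> strongly_measurable M (f i)"
  shows "strongly_measurable M (\<lambda>x. \<Sum>i\<in>I. f i x)"
  using assms by (induction I rule: finite_induct) (auto intro: strongly_measurable_const strongly_measurable_add)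

text \<open>Meant for \<open>Q s = S (max 0 (t - s))\<close>, which depends on s only strongly
  continuously. For simple f the claim concerns a finite sum of functions \<open>Q s y\<close> cut
  off to level sets of f; boundedness of each \<open>Q s\<close> carries it over to limits.\<close>

lemma strongly_measurable_operator:
  fixes f :: "'a \<Rightarrow> 'b::real_normed_vector" and Q :: "'a \<Rightarrow> 'b \<Rightarrow> 'c::real_normed_vector"
  assumes f: "strongly_measurable M f"
    and lin: "\<And>s. s \<in> space M \<Longrightarrow> linear (Q s)"
    and bd: "\<And>s x. s \<in> space M \<Longrightarrow> norm (Q s x) \<le> K * norm x"
    and Q: "\<And>y. strongly_measurable M (\<lambda>s. Q s y)"
  shows "strongly_measurable M (\<lambda>s. Q s (f s))"
proof -
  from f obtain s where s: "\<And>i::nat. simple_function M (s i)"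
    and lim: "AE x in M. (\<lambda>i. s i x) \<longlonglongrightarrow> f x"
    unfolding strongly_measurable_def by auto
  have "strongly_measurable M (\<lambda>x. Q x (s i x))" for i
  proof -
    have fin: "finite (s i ` space M)" using s by (rule simple_functionD)
    have "strongly_measurable M (\<lambda>x. \<Sum>y\<in>s i ` space M. indicator (s i -` {y} \<inter> space M) x *\<^sub>R Q x y)"
      using fin
    proof (rule strongly_measurable_sum)
      fix y
      have "s i -` {y} \<inter> space M \<in> sets M" using s by (rule simple_functionD)
      then show "strongly_measurable M (\<lambda>x. indicator (s i -` {y} \<inter> space M) x *\<^sub>R Q x y)"
        using Q by (intro strongly_measurable_scaleR) auto
    qed
    moreover have "(\<Sum>y\<in>s i ` space M. indicator (s i -` {y} \<inter> space M) x *\<^sub>R Q x y) = Q x (s i x)"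
      if "x \<in> space M" for x
    proof -
      have "(\<Sum>y\<in>s i ` space M. indicator (s i -` {y} \<inter> space M) x *\<^sub>R Q x y)
          = (\<Sum>y\<in>s i ` space M. if s i x = y then Q x y else 0)"
        using that by (intro sum.cong) (auto simp: indicator_def)
      then show ?thesis using that fin by (simp add: sum.delta')
    qed
    ultimately show ?thesis
      by (elim strongly_measurable_cong_AE) (rule AE_I2)
  qed
  moreover have "AE x in M. (\<lambda>i. Q x (s i x)) \<longlonglongrightarrow> Q x (f x)"
    using lim AE_space
  proof eventually_elim
    case (elim x)
    then have "bounded_linear (Q x)"
      using lin[of x] bd[of x] by (intro bounded_linear.intro bounded_linear_axioms.intro exI[of _ K]) (auto simp: mult.commute)
    then show ?case using elim(1) by (rule bounded_linear.tendsto)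
  qed
  ultimately show ?thesis by (rule strongly_measurable_LIMSEQ)
qed

section \<open>Existence, linearity and norm estimates of the integral\<close>

abbreviation simple_integrable :: "'a measure \<Rightarrow> ('a \<Rightarrow> 'b::real_vector) \<Rightarrow> bool" where
  "simple_integrable \<equiv> Bochner_Integration.simple_bochner_integrable"

abbreviation simple_integral :: "'a measure \<Rightarrow> ('a \<Rightarrow> 'b::real_vector) \<Rightarrow> 'b" where
  "simple_integral \<equiv> Bochner_Integration.simple_bochner_integral"

abbreviation L1_dist :: "'a measure \<Rightarrow> ('a \<Rightarrow> 'b::real_normed_vector) \<Rightarrow> ('a \<Rightarrow> 'b) \<Rightarrow> ennreal" where
  "L1_dist M f g \<equiv> \<integral>\<^sup>+x. ennreal (norm (f x - g x)) \<partial>M"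

lemma has_banach_integral_cong_AE:
  fixes f :: "'a \<Rightarrow> 'b::real_normed_vector"
  assumes "has_banach_integral M f I" and eq: "AE x in M. f x = g x"
  shows "has_banach_integral M g I"
proof -
  have "L1_dist M f s = L1_dist M g s" for s
    by (rule nn_integral_cong_AE) (use eq in \<open>eventually_elim, simp\<close>)
  then show ?thesis
    using assms strongly_measurable_cong_AE[of M f g] unfolding has_banach_integral_def by simp
qed

lemma banach_integral_cong_AE:
  fixes f :: "'a \<Rightarrow> 'b::real_normed_vector"
  assumes "AE x in M. f x = g x"
  shows "banach_integral M f = banach_integral M g" "banach_integrable M f = banach_integrable M g"
proof -
  have "AE x in M. g x = f x" using assms by eventually_elim simp
  then have "has_banach_integral M f = has_banach_integral M g"
    using has_banach_integral_cong_AE assms by blast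
  then show "banach_integral M f = banach_integral M g" "banach_integrable M f = banach_integrable M g"
    unfolding banach_integral_def banach_integrable_def by simp_all
qed

lemma has_banach_integral_banach_integral:
  "banach_integrable M f \<Longrightarrow> has_banach_integral M f (banach_integral M f)"
  unfolding banach_integrable_def using banach_integral_eqI by blast

lemma has_banach_integral_restrict_space:
  fixes f :: "'a \<Rightarrow> 'b::real_normed_vector"
  assumes S: "S \<inter> space M \<in> sets M"
    and f: "has_banach_integral (restrict_space M S) f I"
  shows "has_banach_integral M (\<lambda>x. indicator S x *\<^sub>R f x) I"
proof -
  from f obtain s where s: "\<And>i::nat. simple_integrable (restrict_space M S) (s i)"
    "(\<lambda>i. \<integral>\<^sup>+x. ennreal (norm (f x - s i x)) \<partial>restrict_space M S) \<longlonglongrightarrow> 0"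
    "(\<lambda>i. simple_integral (restrict_space M S) (s i)) \<longlonglongrightarrow> I"
    unfolding has_banach_integral_def by auto
  have eq: "(\<integral>\<^sup>+x. ennreal (norm (f x - s i x)) \<partial>restrict_space M S)
     = (\<integral>\<^sup>+x. ennreal (norm (indicator S x *\<^sub>R f x - indicator S x *\<^sub>R s i x)) \<partial>M)" for i
    unfolding nn_integral_restrict_space[OF S]
    by (intro nn_integral_cong) (auto simp: indicator_def)
  show ?thesis
    unfolding has_banach_integral_def
  proof (intro conjI exI[of _ "\<lambda>i x. indicator S x *\<^sub>R s i x"] allI)
    show "strongly_measurable M (\<lambda>x. indicator S x *\<^sub>R f x)"
      using f strongly_measurable_restrict_space[OF S] unfolding has_banach_integral_def by blast
    show "simple_integrable M (\<lambda>x. indicator S x *\<^sub>R s i x)" for i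
      using s(1)[of i] simple_bochner_integrable_restrict_space[OF S] by blast
  qed (use s in \<open>simp_all add: eq simple_bochner_integral_restrict_space[OF S]\<close>)
qed

text \<open>The best approximation by the first \<open>n\<close> points of a dense sequence starting with \<open>0\<close> is
  at most as far from \<open>f\<close> as \<open>0\<close> is, so dominated convergence applies to its distance from \<open>f\<close>.\<close>

lemma has_banach_integral_exists:
  fixes f :: "'a \<Rightarrow> 'b::banach"
  assumes f: "strongly_measurable M f" and fin: "(\<integral>\<^sup>+x. ennreal (norm (f x)) \<partial>M) < \<infinity>"
  shows "\<exists>I. has_banach_integral M f I"
proof -
  obtain g C where g: "g \<in> borel_measurable M" "countable C" "g ` space M \<subseteq> closure C"
    "AE x in M. f x = g x"
    by (rule strongly_measurable_borel_separable[OF f])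
  obtain s where s: "\<And>i::nat. simple_function M (s i)"
    "\<And>x. x \<in> space M \<Longrightarrow> (\<lambda>i. s i x) \<longlonglongrightarrow> g x" "\<And>i x. norm (g x - s i x) \<le> norm (g x)"
    by (rule separable_range_simple_approx[OF g(1-3)]) blast
  have sg: "strongly_measurable M g" using g by (intro strongly_measurable_separable_range)
  have [measurable]: "(\<lambda>x. norm (g x)) \<in> borel_measurable M"
    by (intro measurable_compose[OF g(1)] borel_measurable_continuous_onI continuous_intros)
  have fing: "(\<integral>\<^sup>+x. ennreal (norm (g x)) \<partial>M) < \<infinity>"
    using fin g(4) by (subst nn_integral_cong_AE[where v = "\<lambda>x. ennreal (norm (f x))"]) auto
  have [measurable]: "(\<lambda>x. norm (s i x)) \<in> borel_measurable M" for i
    by (rule borel_measurable_simple_function[OF simple_function_compose1[OF s(1)]])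
  have int: "simple_integrable M (s i)" for i
  proof (rule simple_bochner_integrableI_bounded[OF s(1)])
    have "(\<integral>\<^sup>+x. ennreal (norm (s i x)) \<partial>M) \<le> (\<integral>\<^sup>+x. ennreal (norm (g x)) + ennreal (norm (g x)) \<partial>M)"
    proof (intro nn_integral_mono)
      fix x
      have "norm (s i x) \<le> norm (g x) + norm (g x)"
        using s(3)[of x i] norm_triangle_ineq3[of "g x" "s i x"] by linarith
      then show "ennreal (norm (s i x)) \<le> ennreal (norm (g x)) + ennreal (norm (g x))"
        by (simp flip: ennreal_plus)
    qed
    also have "\<dots> = (\<integral>\<^sup>+x. ennreal (norm (g x)) \<partial>M) + (\<integral>\<^sup>+x. ennreal (norm (g x)) \<partial>M)"
      by (rule nn_integral_add) auto
    also have "\<dots> < \<infinity>" using fing by simp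
    finally show "(\<integral>\<^sup>+x. ennreal (norm (s i x)) \<partial>M) < \<infinity>" .
  qed
  have "(\<lambda>x. norm (g x - s i x)) \<in> borel_measurable M" for i
  proof (rule borel_measurable_LIMSEQ_metric)
    show "(\<lambda>x. norm (s j x - s i x)) \<in> borel_measurable M" for j
      by (rule borel_measurable_simple_function)
         (rule simple_function_compose2[OF s(1) s(1), where h = "\<lambda>x y. norm (x - y)"])
    show "(\<lambda>j. norm (s j x - s i x)) \<longlonglongrightarrow> norm (g x - s i x)" if "x \<in> space M" for x
      using s(2)[OF that] by (intro tendsto_intros)
  qed
  then have meas: "(\<lambda>x. ennreal (norm (g x - s i x))) \<in> borel_measurable M" for i
    by measurable
  have lim: "(\<lambda>i. L1_dist M g (s i)) \<longlonglongrightarrow> (\<integral>\<^sup>+x. 0 \<partial>M)"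
  proof (rule nn_integral_dominated_convergence[where w = "\<lambda>x. ennreal (norm (g x))"])
    show "AE x in M. ennreal (norm (g x - s j x)) \<le> ennreal (norm (g x))" for j
      using s(3) by (simp add: ennreal_leI)
    show "AE x in M. (\<lambda>i. ennreal (norm (g x - s i x))) \<longlonglongrightarrow> 0"
    proof (rule AE_I2)
      fix x assume "x \<in> space M"
      then have "(\<lambda>i. ennreal (norm (g x - s i x))) \<longlonglongrightarrow> ennreal (norm (g x - g x))"
        using s(2) by (intro tendsto_intros)
      then show "(\<lambda>i. ennreal (norm (g x - s i x))) \<longlonglongrightarrow> 0" by simp
    qed
  qed (use fing meas in auto)
  have bound: "ennreal (norm (simple_integral M (s i) - simple_integral M (s j)))
      \<le> L1_dist M g (s i) + L1_dist M g (s j)" for i j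
  proof -
    have "ennreal (norm (simple_integral M (s i) - simple_integral M (s j)))
        = norm (simple_integral M (\<lambda>x. s i x - s j x))"
      using int by (subst simple_bochner_integral_diff) auto
    also have "\<dots> \<le> simple_integral M (\<lambda>x. norm (s i x - s j x))"
      using simple_bochner_integrable_compose2[of "(-)" M "s i" "s j"] int
      by (auto intro!: simple_bochner_integral_norm_bound)
    also have "\<dots> = (\<integral>\<^sup>+x. norm (s i x - s j x) \<partial>M)"
      using simple_bochner_integrable_compose2[of "\<lambda>x y. norm (x - y)" M "s i" "s j"] int
      by (auto intro!: simple_bochner_integral_eq_nn_integral)
    also have "\<dots> \<le> (\<integral>\<^sup>+x. ennreal (norm (g x - s i x)) + ennreal (norm (g x - s j x)) \<partial>M)"
    proof (rule nn_integral_mono)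
      fix x
      have "norm (s i x - s j x) \<le> norm (g x - s i x) + norm (g x - s j x)"
        by (metis dual_order.refl norm_diff_triangle_le norm_minus_commute)
      then show "ennreal (norm (s i x - s j x)) \<le> ennreal (norm (g x - s i x)) + ennreal (norm (g x - s j x))"
        by (simp flip: ennreal_plus)
    qed
    also have "\<dots> = L1_dist M g (s i) + L1_dist M g (s j)"
      by (rule nn_integral_add[OF meas meas])
    finally show ?thesis .
  qed
  have "Cauchy (\<lambda>i. simple_integral M (s i))"
  proof (rule metric_CauchyI)
    fix e :: real assume e: "e > 0"
    with lim have "\<forall>\<^sub>F i in sequentially. L1_dist M g (s i) < ennreal (e / 2)"
      by (intro order_tendstoD(2)[OF lim]) auto
    then obtain N where N: "\<And>i. i \<ge> N \<Longrightarrow> L1_dist M g (s i) < ennreal (e / 2)"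
      unfolding eventually_sequentially by auto
    show "\<exists>N. \<forall>i\<ge>N. \<forall>j\<ge>N. dist (simple_integral M (s i)) (simple_integral M (s j)) < e"
    proof (intro exI allI impI)
      fix i j assume "N \<le> i" "N \<le> j"
      then have "ennreal (norm (simple_integral M (s i) - simple_integral M (s j)))
          < ennreal (e / 2) + ennreal (e / 2)"
        using bound[of i j] add_strict_mono[OF N N, of i j] by (meson le_less_trans)
      also have "\<dots> = ennreal e" using e by (simp flip: ennreal_plus)
      finally show "dist (simple_integral M (s i)) (simple_integral M (s j)) < e"
        by (simp add: dist_norm ennreal_less_iff)
    qed
  qed
  then obtain I where "(\<lambda>i. simple_integral M (s i)) \<longlonglongrightarrow> I"
    using Cauchy_convergent convergent_def by blast
  with int lim sg have "has_banach_integral M g I"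
    unfolding has_banach_integral_def by (auto intro!: exI[of _ s])
  moreover have "AE x in M. g x = f x" using g(4) by eventually_elim simp
  ultimately show ?thesis using has_banach_integral_cong_AE by blast
qed

lemma banach_integrableI_bound:
  fixes f :: "'a \<Rightarrow> 'b::banach"
  assumes "strongly_measurable M f" "integrable M g" "AE x in M. norm (f x) \<le> g x"
  shows "banach_integrable M f"
proof -
  have "(\<integral>\<^sup>+x. ennreal (norm (f x)) \<partial>M) \<le> (\<integral>\<^sup>+x. ennreal (norm (g x)) \<partial>M)"
    by (rule nn_integral_mono_AE) (use assms(3) in \<open>eventually_elim, simp add: ennreal_leI abs_le_iff\<close>)
  also have "\<dots> < \<infinity>" using assms(2) by (simp add: integrable_iff_bounded)
  finally show ?thesis
    using assms(1) has_banach_integral_exists unfolding banach_integrable_def by blast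
qed

lemma has_banach_integral_norm_bound:
  fixes f :: "'a \<Rightarrow> 'b::real_normed_vector"
  assumes f: "has_banach_integral M f I" and g: "integrable M g" and le: "AE x in M. norm (f x) \<le> g x"
  shows "norm I \<le> integral\<^sup>L M g"
proof -
  from f obtain s where sf: "strongly_measurable M f"
    and s: "\<And>i::nat. simple_integrable M (s i)"
    and s0: "(\<lambda>i. L1_dist M f (s i)) \<longlonglongrightarrow> 0"
    and sI: "(\<lambda>i. simple_integral M (s i)) \<longlonglongrightarrow> I"
    unfolding has_banach_integral_def by auto
  have [measurable]: "g \<in> borel_measurable M" using g by auto
  \<comment> \<open>\<open>k s\<close> is a measurable version of the norm of f - s; it allows the
    integral of a sum to be split below.\<close>
  obtain k :: "('a \<Rightarrow> 'b) \<Rightarrow> 'a \<Rightarrow> ennreal"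
    where k: "\<And>s. simple_function M s \<Longrightarrow> k s \<in> borel_measurable M"
      and fk: "\<And>s. AE x in M. ennreal (norm (f x - s x)) = k s x"
    using nn_integral_norm_diff_strongly_measurable[OF sf] by blast
  have "ennreal (norm (simple_integral M (s i)))
      \<le> (\<integral>\<^sup>+x. ennreal (g x) \<partial>M) + L1_dist M f (s i)" for i
  proof -
    have ss: "simple_function M (s i)" using s[of i] by (auto elim: simple_bochner_integrable.cases)
    have "ennreal (norm (simple_integral M (s i))) \<le> simple_integral M (\<lambda>x. norm (s i x))"
      using s by (auto intro!: simple_bochner_integral_norm_bound)
    also have "\<dots> = (\<integral>\<^sup>+x. norm (s i x) \<partial>M)"
      using simple_bochner_integrable_compose2[of "\<lambda>x y. norm x" M "s i" "s i"] s
      by (auto intro!: simple_bochner_integral_eq_nn_integral)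
    also have "\<dots> \<le> (\<integral>\<^sup>+x. ennreal (g x) + k (s i) x \<partial>M)"
    proof (rule nn_integral_mono_AE)
      show "AE x in M. ennreal (norm (s i x)) \<le> ennreal (g x) + k (s i) x"
        using le fk[of "s i"]
      proof eventually_elim
        case (elim x)
        have "norm (s i x) \<le> g x + norm (f x - s i x)"
          using norm_triangle_ineq3[of "f x" "s i x"] elim by linarith
        moreover have "0 \<le> g x" using elim(1) norm_ge_zero order_trans by blast
        ultimately show ?case
          unfolding elim(2)[symmetric] by (simp flip: ennreal_plus)
      qed
    qed
    also have "\<dots> = (\<integral>\<^sup>+x. ennreal (g x) \<partial>M) + (\<integral>\<^sup>+x. k (s i) x \<partial>M)"
      by (rule nn_integral_add) (auto intro: k ss)
    also have "(\<integral>\<^sup>+x. k (s i) x \<partial>M) = L1_dist M f (s i)"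
      using nn_integral_cong_AE[OF fk[of "s i"]] by simp
    finally show ?thesis .
  qed
  moreover have "(\<lambda>i. ennreal (norm (simple_integral M (s i)))) \<longlonglongrightarrow> ennreal (norm I)"
    using sI by (intro tendsto_intros)
  moreover have "(\<lambda>i. (\<integral>\<^sup>+x. ennreal (g x) \<partial>M) + L1_dist M f (s i))
      \<longlonglongrightarrow> (\<integral>\<^sup>+x. ennreal (g x) \<partial>M) + 0"
    using s0 by (intro tendsto_add tendsto_const)
  ultimately have "ennreal (norm I) \<le> (\<integral>\<^sup>+x. ennreal (g x) \<partial>M) + 0"
    by (intro LIMSEQ_le) blast+
  moreover have g0: "AE x in M. 0 \<le> g x"
    using le by eventually_elim (meson norm_ge_zero order_trans)
  ultimately have "ennreal (norm I) \<le> ennreal (integral\<^sup>L M g)"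
    using nn_integral_eq_integral[OF g g0] by simp
  then show ?thesis
    using integral_nonneg_AE[OF g0] by (simp add: ennreal_le_iff)
qed

text \<open>One statement for all of linearity: c = 1 gives sums, c = -1 differences, and g = f with
  c - 1 in place of c gives scalar multiples.\<close>

lemma has_banach_integral_add_scaleR:
  fixes f g :: "'a \<Rightarrow> 'b::real_normed_vector"
  assumes f: "has_banach_integral M f I" and g: "has_banach_integral M g J"
  shows "has_banach_integral M (\<lambda>x. f x + c *\<^sub>R g x) (I + c *\<^sub>R J)"
proof -
  from f obtain s where sf: "strongly_measurable M f"
    and s: "\<And>i::nat. simple_integrable M (s i)"
    and s0: "(\<lambda>i. L1_dist M f (s i)) \<longlonglongrightarrow> 0"
    and sI: "(\<lambda>i. simple_integral M (s i)) \<longlonglongrightarrow> I"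
    unfolding has_banach_integral_def by auto
  from g obtain t where tg: "strongly_measurable M g"
    and t: "\<And>i::nat. simple_integrable M (t i)"
    and t0: "(\<lambda>i. L1_dist M g (t i)) \<longlonglongrightarrow> 0"
    and tJ: "(\<lambda>i. simple_integral M (t i)) \<longlonglongrightarrow> J"
    unfolding has_banach_integral_def by auto
  obtain k :: "('a \<Rightarrow> 'b) \<Rightarrow> 'a \<Rightarrow> ennreal"
    where k: "\<And>s. simple_function M s \<Longrightarrow> k s \<in> borel_measurable M"
      and fk: "\<And>s. AE x in M. ennreal (norm (f x - s x)) = k s x"
    using nn_integral_norm_diff_strongly_measurable[OF sf] by blast
  obtain l :: "('a \<Rightarrow> 'b) \<Rightarrow> 'a \<Rightarrow> ennreal"
    where l: "\<And>s. simple_function M s \<Longrightarrow> l s \<in> borel_measurable M"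
      and gl: "\<And>s. AE x in M. ennreal (norm (g x - s x)) = l s x"
    using nn_integral_norm_diff_strongly_measurable[OF tg] by blast
  have le: "L1_dist M (\<lambda>x. f x + c *\<^sub>R g x) (\<lambda>x. s i x + c *\<^sub>R t i x)
      \<le> L1_dist M f (s i) + ennreal \<bar>c\<bar> * L1_dist M g (t i)" for i
  proof -
    have ss: "simple_function M (s i)" "simple_function M (t i)"
      using s[of i] t[of i] by (auto elim: simple_bochner_integrable.cases)
    have "L1_dist M (\<lambda>x. f x + c *\<^sub>R g x) (\<lambda>x. s i x + c *\<^sub>R t i x)
        \<le> (\<integral>\<^sup>+x. k (s i) x + ennreal \<bar>c\<bar> * l (t i) x \<partial>M)"
    proof (rule nn_integral_mono_AE)
      show "AE x in M. ennreal (norm (f x + c *\<^sub>R g x - (s i x + c *\<^sub>R t i x)))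
          \<le> k (s i) x + ennreal \<bar>c\<bar> * l (t i) x"
        using fk[of "s i"] gl[of "t i"]
      proof eventually_elim
        case (elim x)
        have "norm (f x + c *\<^sub>R g x - (s i x + c *\<^sub>R t i x)) \<le> norm (f x - s i x) + norm (c *\<^sub>R g x - c *\<^sub>R t i x)"
          by (rule norm_diff_triangle_ineq)
        also have "norm (c *\<^sub>R g x - c *\<^sub>R t i x) = \<bar>c\<bar> * norm (g x - t i x)"
          by (simp flip: scaleR_diff_right)
        finally show ?case
          unfolding elim[symmetric] by (simp flip: ennreal_plus ennreal_mult)
      qed
    qed
    also have "\<dots> = (\<integral>\<^sup>+x. k (s i) x \<partial>M) + (\<integral>\<^sup>+x. ennreal \<bar>c\<bar> * l (t i) x \<partial>M)"
      using k[OF ss(1)] l[OF ss(2)] by (intro nn_integral_add) auto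
    also have "(\<integral>\<^sup>+x. ennreal \<bar>c\<bar> * l (t i) x \<partial>M) = ennreal \<bar>c\<bar> * (\<integral>\<^sup>+x. l (t i) x \<partial>M)"
      using l[OF ss(2)] by (rule nn_integral_cmult)
    finally show ?thesis
      using nn_integral_cong_AE[OF fk[of "s i"]] nn_integral_cong_AE[OF gl[of "t i"]] by simp
  qed
  have ct: "simple_integrable M (\<lambda>x. c *\<^sub>R t i x)" for i
    using simple_bochner_integrable_compose2[of "\<lambda>x y. c *\<^sub>R x", OF _ t t] by simp
  show ?thesis
    unfolding has_banach_integral_def
  proof (intro conjI exI[of _ "\<lambda>i x. s i x + c *\<^sub>R t i x"] allI)
    show "strongly_measurable M (\<lambda>x. f x + c *\<^sub>R g x)"
      by (intro strongly_measurable_add strongly_measurable_scaleR sf tg borel_measurable_const)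
    show "simple_integrable M (\<lambda>x. s i x + c *\<^sub>R t i x)" for i
      using simple_bochner_integrable_compose2[of "(+)", OF _ s ct] by simp
    have "(\<lambda>i. L1_dist M f (s i) + ennreal \<bar>c\<bar> * L1_dist M g (t i)) \<longlonglongrightarrow> 0 + ennreal \<bar>c\<bar> * 0"
      using t0 by (intro tendsto_add s0 ennreal_tendsto_cmult) auto
    then have lim: "(\<lambda>i. L1_dist M f (s i) + ennreal \<bar>c\<bar> * L1_dist M g (t i)) \<longlonglongrightarrow> 0" by simp
    show "(\<lambda>i. L1_dist M (\<lambda>x. f x + c *\<^sub>R g x) (\<lambda>x. s i x + c *\<^sub>R t i x)) \<longlonglongrightarrow> 0"
      by (rule tendsto_sandwich[OF _ _ tendsto_const lim]) (simp_all add: le)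
    show "(\<lambda>i. simple_integral M (\<lambda>x. s i x + c *\<^sub>R t i x)) \<longlonglongrightarrow> I + c *\<^sub>R J"
      unfolding simple_bochner_integral_add[OF s ct] simple_bochner_integral_linear[OF linear_scale_self t]
      using sI tJ by (intro tendsto_intros)
  qed
qed

lemma norm_banach_integral_diff_le:
  fixes f g :: "'a \<Rightarrow> 'b::real_normed_vector"
  assumes "banach_integrable M f" "banach_integrable M g" "integrable M k"
    and "AE x in M. norm (f x - g x) \<le> k x"
  shows "norm (banach_integral M f - banach_integral M g) \<le> integral\<^sup>L M k"
  using has_banach_integral_norm_bound[OF has_banach_integral_add_scaleR[OF
      has_banach_integral_banach_integral[OF assms(1)] has_banach_integral_banach_integral[OF assms(2)], of "- 1"] assms(3)]
    assms(4) by simp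

lemma norm_banach_integral_le:
  fixes f :: "'a \<Rightarrow> 'b::real_normed_vector"
  assumes "banach_integrable M f" "integrable M k" "AE x in M. norm (f x) \<le> k x"
  shows "norm (banach_integral M f) \<le> integral\<^sup>L M k"
  using assms has_banach_integral_norm_bound has_banach_integral_banach_integral by blast

lemma banach_integral_restrict:
  fixes f :: "'a \<Rightarrow> 'b::real_normed_vector"
  assumes S: "S \<inter> space M \<in> sets M" and f: "banach_integrable (restrict_space M S) f"
  shows "banach_integrable M (\<lambda>x. indicator S x *\<^sub>R f x)"
    "banach_integral (restrict_space M S) f = banach_integral M (\<lambda>x. indicator S x *\<^sub>R f x)"
  using has_banach_integral_restrict_space[OF S has_banach_integral_banach_integral[OF f]]
  by (auto simp: banach_integrable_def banach_integral_eqI)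

lemma banach_integrable_restrict:
  fixes f :: "'a \<Rightarrow> 'b::banach"
  assumes f: "strongly_measurable M f" and g: "integrable M g" "AE x in M. norm (f x) \<le> g x" and S: "S \<in> sets M"
  shows "banach_integrable (restrict_space M S) f"
proof -
  have S': "S \<inter> space M \<in> sets M" using S by auto
  have "strongly_measurable M (\<lambda>x. indicator S x *\<^sub>R f x)"
    using S f by (intro strongly_measurable_scaleR) auto
  then have "strongly_measurable (restrict_space M S) f"
    using strongly_measurable_restrict_space[OF S'] by blast
  moreover have "integrable (restrict_space M S) g"
    using integrable_mult_indicator[OF S g(1)] integrable_restrict_space[OF S'] by blast
  moreover have "AE x in restrict_space M S. norm (f x) \<le> g x"
    unfolding AE_restrict_space_iff[OF S'] using g(2) by eventually_elim simp
  ultimately show ?thesis by (rule banach_integrableI_bound)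
qed

lemma banach_integral_cong:
  fixes f :: "'a \<Rightarrow> 'b::real_normed_vector"
  assumes "\<And>x. x \<in> space M \<Longrightarrow> f x = g x"
  shows "banach_integral M f = banach_integral M g" "banach_integrable M f = banach_integrable M g"
proof -
  have "AE x in M. f x = g x" using assms by (rule AE_I2)
  from banach_integral_cong_AE[OF this]
  show "banach_integral M f = banach_integral M g" "banach_integrable M f = banach_integrable M g" .
qed

text \<open>The part of \<open>f i\<close> above \<open>w\<close> is controlled by the positive part of \<open>w' i - w\<close>, whose integral tends
  to \<open>0\<close> because its negative part is dominated by \<open>w\<close>.\<close>

lemma integral_tendsto_0_varying_bound:
  fixes f :: "nat \<Rightarrow> 'a \<Rightarrow> real"
  assumes f: "\<And>i. f i \<in> borel_measurable M" "\<And>i x. 0 \<le> f i x"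
    and w': "\<And>i. integrable M (w' i)" and w: "integrable M w"
    and bound: "\<And>i. AE x in M. f i x \<le> w' i x"
    and lim_f: "AE x in M. (\<lambda>i. f i x) \<longlonglongrightarrow> 0"
    and lim_w: "AE x in M. (\<lambda>i. w' i x) \<longlonglongrightarrow> w x"
    and lim_int: "(\<lambda>i. integral\<^sup>L M (w' i)) \<longlonglongrightarrow> integral\<^sup>L M w"
  shows "\<And>i. integrable M (f i)" "(\<lambda>i. integral\<^sup>L M (f i)) \<longlonglongrightarrow> 0"
proof -
  note [measurable] = f(1) borel_measurable_integrable[OF w] borel_measurable_integrable[OF w']
  show fi: "integrable M (f i)" for i
  proof (rule Bochner_Integration.integrable_bound[OF w'[of i] f(1)])
    show "AE x in M. norm (f i x) \<le> norm (w' i x)"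
      using bound[of i] by eventually_elim (use f(2) in \<open>auto intro: order_trans\<close>)
  qed
  have w_nonneg: "AE x in M. 0 \<le> w x"
  proof -
    have "AE x in M. \<forall>i. f i x \<le> w' i x" using bound by (simp add: AE_all_countable)
    with lim_w show ?thesis
    proof eventually_elim
      case (elim x)
      then show ?case
        by (intro LIMSEQ_le_const[OF elim(1)]) (use f(2)[of _ x] in \<open>auto intro: order_trans\<close>)
    qed
  qed
  \<comment> \<open>Pointwise, f i is at most g i + (w' i - w) + n i. Both g i and n i are dominated
    by w, the latter because 0 \<le> f i \<le> w' i, and the middle term is handled by convergence
    of the integrals.\<close>
  define g where "g i x = min (f i x) (w x)" for i x
  define n where "n i x = max 0 (w x - w' i x)" for i x
  have meas: "g i \<in> borel_measurable M" "n i \<in> borel_measurable M" for i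
    unfolding g_def n_def by measurable
  have g: "integrable M (g i)" "(\<lambda>i. integral\<^sup>L M (g i)) \<longlonglongrightarrow> integral\<^sup>L M (\<lambda>x. 0)" for i
  proof -
    have b: "AE x in M. norm (g i x) \<le> w x" for i
      using w_nonneg by eventually_elim (use f(2) in \<open>auto simp: g_def min_def\<close>)
    have l: "AE x in M. (\<lambda>i. g i x) \<longlonglongrightarrow> 0"
      using lim_f w_nonneg
    proof eventually_elim
      case (elim x)
      then have "(\<lambda>i. min (f i x) (w x)) \<longlonglongrightarrow> min 0 (w x)" by (intro tendsto_intros)
      with elim show ?case by (simp add: g_def min_absorb1)
    qed
    show "integrable M (g i)"
      by (rule integrable_dominated_convergence2[OF borel_measurable_const meas(1) w l b])
    show "(\<lambda>i. integral\<^sup>L M (g i)) \<longlonglongrightarrow> integral\<^sup>L M (\<lambda>x. 0)"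
      by (rule integral_dominated_convergence[OF borel_measurable_const meas(1) w l b])
  qed
  have n: "integrable M (n i)" "(\<lambda>i. integral\<^sup>L M (n i)) \<longlonglongrightarrow> integral\<^sup>L M (\<lambda>x. 0)" for i
  proof -
    have b: "AE x in M. norm (n i x) \<le> w x" for i
      using w_nonneg bound[of i] by eventually_elim (use f(2) in \<open>auto simp: n_def max_def intro: order_trans\<close>)
    have l: "AE x in M. (\<lambda>i. n i x) \<longlonglongrightarrow> 0"
      using lim_w
    proof eventually_elim
      case (elim x)
      then have "(\<lambda>i. max 0 (w x - w' i x)) \<longlonglongrightarrow> max 0 (w x - w x)" by (intro tendsto_intros)
      then show ?case by (simp add: n_def)
    qed
    show "integrable M (n i)"
      by (rule integrable_dominated_convergence2[OF borel_measurable_const meas(2) w l b])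
    show "(\<lambda>i. integral\<^sup>L M (n i)) \<longlonglongrightarrow> integral\<^sup>L M (\<lambda>x. 0)"
      by (rule integral_dominated_convergence[OF borel_measurable_const meas(2) w l b])
  qed
  have le: "integral\<^sup>L M (f i) \<le> integral\<^sup>L M (g i) + (integral\<^sup>L M (w' i) - integral\<^sup>L M w) + integral\<^sup>L M (n i)" for i
  proof -
    have "integral\<^sup>L M (f i) \<le> integral\<^sup>L M (\<lambda>x. g i x + (w' i x - w x) + n i x)"
      using fi w' w g n
    proof (intro integral_mono_AE)
      show "AE x in M. f i x \<le> g i x + (w' i x - w x) + n i x"
        using bound[of i] by eventually_elim (auto simp: g_def n_def min_def max_def)
    qed auto
    also have "\<dots> = integral\<^sup>L M (g i) + (integral\<^sup>L M (w' i) - integral\<^sup>L M w) + integral\<^sup>L M (n i)"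
      using w' w g n by simp
    finally show ?thesis .
  qed
  have "(\<lambda>i. integral\<^sup>L M (g i) + (integral\<^sup>L M (w' i) - integral\<^sup>L M w) + integral\<^sup>L M (n i))
      \<longlonglongrightarrow> integral\<^sup>L M (\<lambda>x. 0) + (integral\<^sup>L M w - integral\<^sup>L M w) + integral\<^sup>L M (\<lambda>x. 0)"
    using g n lim_int by (intro tendsto_add tendsto_diff tendsto_const)
  then have lim: "(\<lambda>i. integral\<^sup>L M (g i) + (integral\<^sup>L M (w' i) - integral\<^sup>L M w) + integral\<^sup>L M (n i)) \<longlonglongrightarrow> 0"
    by simp
  show "(\<lambda>i. integral\<^sup>L M (f i)) \<longlonglongrightarrow> 0"
    by (rule tendsto_sandwich[OF _ _ tendsto_const lim]) (simp_all add: le f(2) integral_nonneg_AE)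
qed

text \<open>Dominated convergence with a moving dominator. The convolution integrals need it: the
  singularity of the kernel sits at s = t and moves with t, so a common integrable dominator along a
  sequence of times need not exist.\<close>

lemma banach_integral_tendsto_varying_bound:
  fixes u :: "nat \<Rightarrow> 'a \<Rightarrow> 'b::banach"
  assumes u: "\<And>i. strongly_measurable M (u i)"
    and w': "\<And>i. integrable M (w' i)" and w: "integrable M w"
    and bound: "\<And>i. AE x in M. norm (u i x) \<le> w' i x"
    and lim_u: "AE x in M. (\<lambda>i. u i x) \<longlonglongrightarrow> f x"
    and lim_w: "AE x in M. (\<lambda>i. w' i x) \<longlonglongrightarrow> w x"
    and lim_int: "(\<lambda>i. integral\<^sup>L M (w' i)) \<longlonglongrightarrow> integral\<^sup>L M w"
  shows "(\<lambda>i. banach_integral M (u i)) \<longlonglongrightarrow> banach_integral M f"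
proof -
  have sf: "strongly_measurable M f" using u lim_u by (rule strongly_measurable_LIMSEQ)
  have "AE x in M. \<forall>i. norm (u i x) \<le> w' i x" using bound by (simp add: AE_all_countable)
  with lim_u lim_w have fw: "AE x in M. norm (f x) \<le> w x"
  proof eventually_elim
    case (elim x)
    then have "(\<lambda>i. norm (u i x)) \<longlonglongrightarrow> norm (f x)" by (intro tendsto_intros)
    then show ?case using elim(2) by (rule LIMSEQ_le) (use elim in auto)
  qed
  have fi: "banach_integrable M f" using sf w fw by (rule banach_integrableI_bound)
  have ui: "banach_integrable M (u i)" for i using u w' bound by (rule banach_integrableI_bound)
  have "\<forall>i. \<exists>g::'a \<Rightarrow> real. g \<in> borel_measurable M \<and> (AE x in M. norm (u i x - f x) = g x) \<and> (\<forall>x. g x \<ge> 0)"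
    by (rule allI, rule strongly_measurable_norm[OF strongly_measurable_diff[OF u sf]]) blast
  from choice[OF this] obtain g :: "nat \<Rightarrow> 'a \<Rightarrow> real" where g: "\<And>i. g i \<in> borel_measurable M"
    "\<And>i. AE x in M. norm (u i x - f x) = g i x" "\<And>i x. 0 \<le> g i x"
    by blast
  have gw: "AE x in M. g i x \<le> w' i x + w x" for i
    using g(2)[of i] bound[of i] fw
  proof eventually_elim
    case (elim x)
    then show ?case using norm_triangle_ineq4[of "u i x" "f x"] by simp
  qed
  have "AE x in M. \<forall>i. norm (u i x - f x) = g i x" using g(2) by (simp add: AE_all_countable)
  with lim_u have g0: "AE x in M. (\<lambda>i. g i x) \<longlonglongrightarrow> 0"
  proof eventually_elim
    case (elim x)
    then have "(\<lambda>i. norm (u i x - f x)) \<longlonglongrightarrow> norm (f x - f x)" by (intro tendsto_intros)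
    then show ?case using elim by simp
  qed
  have w2: "AE x in M. (\<lambda>i. w' i x + w x) \<longlonglongrightarrow> w x + w x"
    using lim_w by eventually_elim (intro tendsto_intros)
  have w2_int: "(\<lambda>i. \<integral>x. w' i x + w x \<partial>M) \<longlonglongrightarrow> (\<integral>x. w x + w x \<partial>M)"
    using w' w tendsto_add[OF lim_int tendsto_const[of "integral\<^sup>L M w"]] by simp
  note lim = integral_tendsto_0_varying_bound[OF g(1,3) Bochner_Integration.integrable_add[OF w' w]
      Bochner_Integration.integrable_add[OF w w] gw g0 w2 w2_int]
  have "norm (banach_integral M (u i) - banach_integral M f) \<le> integral\<^sup>L M (g i)" for i
    by (rule norm_banach_integral_diff_le[OF ui fi lim(1)]) (use g(2)[of i] in \<open>eventually_elim, simp\<close>)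
  then have "(\<lambda>i. banach_integral M (u i) - banach_integral M f) \<longlonglongrightarrow> 0"
    using lim(2) by (simp add: Lim_null_comparison[where g = "\<lambda>i. integral\<^sup>L M (g i)"])
  then show ?thesis
    by (simp add: LIM_zero_iff)
qed

lemma banach_integral_dominated_convergence:
  fixes u :: "nat \<Rightarrow> 'a \<Rightarrow> 'b::banach"
  assumes u: "\<And>i. strongly_measurable M (u i)" and w: "integrable M w"
    and bound: "\<And>i. AE x in M. norm (u i x) \<le> w x"
    and lim: "AE x in M. (\<lambda>i. u i x) \<longlonglongrightarrow> f x"
  shows "(\<lambda>i. banach_integral M (u i)) \<longlonglongrightarrow> banach_integral M f"
  by (rule banach_integral_tendsto_varying_bound[OF u w w bound lim]) simp_all

lemma Lq_space_subset:
  fixes f :: "real \<Rightarrow> 'b::real_normed_vector"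
  assumes f: "f \<in> Lq_space q A" and sets: "A \<in> sets lebesgue" "B \<in> sets lebesgue" and sub: "B \<subseteq> A"
  shows "f \<in> Lq_space q B"
proof -
  have sf: "strongly_measurable (lebesgue_on A) f"
    and fin: "(\<integral>\<^sup>+x. ennreal (norm (f x) powr q) \<partial>lebesgue_on A) < \<infinity>"
    using f unfolding Lq_space_def by auto
  have ind: "indicator B x *\<^sub>R indicator A x *\<^sub>R f x = indicator B x *\<^sub>R f x" for x
    using sub by (auto simp: indicator_def)
  have "strongly_measurable lebesgue (\<lambda>x. indicator A x *\<^sub>R f x)"
    using sf sets by (subst (asm) strongly_measurable_restrict_space) auto
  then have "strongly_measurable lebesgue (\<lambda>x. indicator B x *\<^sub>R indicator A x *\<^sub>R f x)"
    by (rule strongly_measurable_scaleR[rotated]) (intro borel_measurable_indicator sets)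
  then have "strongly_measurable (lebesgue_on B) f"
    unfolding ind using sets by (subst strongly_measurable_restrict_space) auto
  moreover have "(\<integral>\<^sup>+x. ennreal (norm (f x) powr q) \<partial>lebesgue_on B) \<le> (\<integral>\<^sup>+x. ennreal (norm (f x) powr q) \<partial>lebesgue_on A)"
    using sets sub by (subst (1 2) nn_integral_restrict_space) (auto intro!: nn_integral_mono simp: indicator_def)
  ultimately show ?thesis
    using fin unfolding Lq_space_def by auto
qed

section \<open>Decay of the density\<close>

text \<open>Sublinearity of x^eta, used to let exp (-x) absorb exp (theta x^eta): once for
  dominating partial sums and once on the segment closing the contour.\<close>

lemma powr_le_affine:
  fixes \<eta> \<theta> c :: real
  assumes "0 < \<eta>" "\<eta> < 1" "0 \<le> \<theta>" "0 < c"
  obtains C where "C \<ge> 0" "\<And>x. 0 \<le> x \<Longrightarrow> \<theta> * x powr \<eta> \<le> c * x + C"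
proof
  \<comment> \<open>\<open>X\<close> is the point where theta x^eta and c x meet; beyond it the
    linear term wins.\<close>
  define X where "X = (\<theta> / c) powr (1 / (1 - \<eta>))"
  show "\<theta> * X powr \<eta> \<ge> 0" using assms by simp
  fix x :: real assume x: "0 \<le> x"
  show "\<theta> * x powr \<eta> \<le> c * x + \<theta> * X powr \<eta>"
  proof (cases "x \<le> X")
    case True
    then have "x powr \<eta> \<le> X powr \<eta>" using x assms by (intro powr_mono2) auto
    then have "\<theta> * x powr \<eta> \<le> \<theta> * X powr \<eta>" using assms by (intro mult_left_mono) auto
    then show ?thesis using assms x by (simp add: add_increasing)
  next
    case False
    have "X \<ge> 0" by (simp add: X_def)
    with False have x0: "x > 0" by simp
    have "\<theta> / c = X powr (1 - \<eta>)"
      using assms by (simp add: X_def powr_powr)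
    also have "\<dots> \<le> x powr (1 - \<eta>)" using False \<open>X \<ge> 0\<close> assms by (intro powr_mono2) auto
    finally have "\<theta> \<le> c * x powr (1 - \<eta>)" using assms by (simp add: field_simps)
    then have "\<theta> * x powr \<eta> \<le> c * x powr (1 - \<eta>) * x powr \<eta>" by (intro mult_right_mono) auto
    also have "\<dots> = c * x" using x0 by (simp add: mult.assoc flip: powr_add)
    finally show ?thesis using assms by (simp add: add_increasing2)
  qed
qed

text \<open>Writing each Gamma value as Euler's integral of x^((n + 1) eta) exp (-x) and summing
  under the integral sign turns the series of the density into an exponential series. The resulting
  f is minus the imaginary part of exp (s - theta s^eta) at s = -x, approached from the upper half
  plane.\<close>

lemma xi_density_integral:
  fixes \<eta> \<theta> :: real
  assumes \<eta>: "0 < \<eta>" "\<eta> < 1" and \<theta>: "0 < \<theta>"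
  defines "f \<equiv> \<lambda>x. - Im (exp (of_real (- (\<theta> * x powr \<eta>)) * cis (pi * \<eta>))) / exp x"
  shows "f integrable_on {0..}" "\<theta> * xi_density \<eta> \<theta> = 1 / (pi * \<eta>) * integral {0..} f"
proof -
  define g where "g n x = (-1) ^ n * \<theta> ^ Suc n * sin (real (Suc n) * pi * \<eta>) / fact (Suc n) *
      (x powr (real (Suc n) * \<eta>) / exp x)" for n x
  define a where "a n = (-1) ^ n * \<theta> ^ Suc n * (Gamma (real (Suc n) * \<eta> + 1) / fact (Suc n)) *
      sin (real (Suc n) * pi * \<eta>)" for n
  have g_int: "(g n has_integral a n) {0..}" for n
  proof -
    have "((\<lambda>t. t powr (real (Suc n) * \<eta> + 1 - 1) / exp t) has_integral Gamma (real (Suc n) * \<eta> + 1)) {0..}"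
      by (rule Gamma_integral_real) (use \<eta> in \<open>simp add: add_pos_nonneg\<close>)
    then have "((\<lambda>t. t powr (real (Suc n) * \<eta>) / exp t) has_integral Gamma (real (Suc n) * \<eta> + 1)) {0..}"
      by simp
    from has_integral_mult_right[OF this, of "(-1) ^ n * \<theta> ^ Suc n * sin (real (Suc n) * pi * \<eta>) / fact (Suc n)"]
    show ?thesis unfolding g_def a_def by (simp add: mult_ac del: fact_Suc of_nat_Suc power_Suc)
  qed
  have ypow: "x powr (real (Suc n) * \<eta>) = (x powr \<eta>) ^ Suc n" for n and x :: real
    by (cases "x = 0") (simp_all add: powr_power mult.commute del: of_nat_Suc power_Suc)
  have lim: "(\<lambda>N. \<Sum>n<N. g n x) \<longlonglongrightarrow> f x" if "x \<in> {0..}" for x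
  proof -
    define y where "y = x powr \<eta>"
    define z where "z = of_real (- (\<theta> * y)) * cis (pi * \<eta>)"
    have "(\<lambda>n. z ^ n /\<^sub>R fact n) sums exp z" by (rule exp_converges)
    then have "(\<lambda>n. Im (z ^ n /\<^sub>R fact n)) sums Im (exp z)" by (rule sums_Im)
    \<comment> \<open>The term of index 0 is real, so dropping it leaves the imaginary part
      unchanged.\<close>
    then have "(\<lambda>n. Im (z ^ Suc n /\<^sub>R fact (Suc n))) sums Im (exp z)"
      using sums_Suc_iff[of "\<lambda>n. Im (z ^ n /\<^sub>R fact n)" "Im (exp z)"] by simp
    then have "(\<lambda>n. - Im (z ^ Suc n /\<^sub>R fact (Suc n)) / exp x) sums (- Im (exp z) / exp x)"
      by (intro sums_divide sums_minus)
    moreover have "- Im (z ^ Suc n /\<^sub>R fact (Suc n)) / exp x = g n x" for n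
    proof -
      have "z ^ Suc n = of_real ((- (\<theta> * y)) ^ Suc n) * cis (real (Suc n) * (pi * \<eta>))"
        unfolding z_def power_mult_distrib by (simp add: Complex.DeMoivre del: power_Suc of_nat_Suc)
      then have "Im (z ^ Suc n) = (- (\<theta> * y)) ^ Suc n * sin (real (Suc n) * (pi * \<eta>))"
        by (simp del: power_Suc of_nat_Suc)
      also have "(- (\<theta> * y)) ^ Suc n = - ((-1) ^ n * \<theta> ^ Suc n * y ^ Suc n)"
        by (simp add: power_minus[of "\<theta> * y"] power_mult_distrib)
      finally show ?thesis
        unfolding g_def ypow y_def[symmetric]
        by (simp add: field_simps del: fact_Suc of_nat_Suc power_Suc)
    qed
    ultimately show ?thesis
      unfolding sums_def f_def z_def y_def by simp
  qed
  \<comment> \<open>The slope 1/2 leaves exp (-x / 2) as integrable majorant of all partial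
    sums.\<close>
  obtain C where C: "\<And>x. 0 \<le> x \<Longrightarrow> \<theta> * x powr \<eta> \<le> 1/2 * x + C"
    using powr_le_affine[of \<eta> \<theta> "1/2"] \<eta> \<theta> by (metis less_eq_real_def zero_less_divide_1_iff zero_less_numeral)
  have bound: "norm (\<Sum>n<N. g n x) \<le> exp C * exp (- (1/2) * x)" if x: "x \<in> {0..}" for N x
  proof -
    define t where "t = \<theta> * x powr \<eta>"
    have t: "t \<ge> 0" using \<theta> by (simp add: t_def)
    have "norm (g n x) \<le> t ^ Suc n / fact (Suc n) / exp x" for n
    proof -
      have "norm (g n x) = \<theta> ^ Suc n * \<bar>sin (real (Suc n) * pi * \<eta>)\<bar> / fact (Suc n) * ((x powr \<eta>) ^ Suc n / exp x)"
        unfolding g_def ypow using \<theta> by (simp add: abs_mult power_abs del: fact_Suc of_nat_Suc power_Suc)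
      also have "\<dots> \<le> \<theta> ^ Suc n * 1 / fact (Suc n) * ((x powr \<eta>) ^ Suc n / exp x)"
        using \<theta> by (intro mult_right_mono divide_right_mono mult_left_mono) auto
      finally show ?thesis unfolding t_def by (simp add: power_mult_distrib del: fact_Suc of_nat_Suc power_Suc)
    qed
    then have "norm (\<Sum>n<N. g n x) \<le> (\<Sum>n<N. t ^ Suc n / fact (Suc n) / exp x)"
      by (rule sum_norm_le)
    also have "\<dots> = (\<Sum>n<N. t ^ Suc n / fact (Suc n)) / exp x"
      by (simp add: sum_divide_distrib del: fact_Suc power_Suc)
    also have "(\<Sum>n<N. t ^ Suc n / fact (Suc n)) \<le> (\<Sum>n<Suc N. t ^ n / fact n)"
      unfolding sum.lessThan_Suc_shift by (simp del: fact_Suc power_Suc)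
    also have "\<dots> \<le> exp t"
      using exp_converges[of t] t by (intro sum_le_suminf[THEN order_trans])
        (auto simp: sums_iff divide_inverse mult.commute)
    finally have "norm (\<Sum>n<N. g n x) \<le> exp t / exp x"
      by (simp add: divide_right_mono)
    also have "\<dots> \<le> exp (1/2 * x + C) / exp x"
      using C[of x] x unfolding t_def by (intro divide_right_mono) auto
    also have "\<dots> = exp C * exp (- (1/2) * x)"
      by (simp flip: exp_diff exp_add)
    finally show ?thesis .
  qed
  have dom: "(\<lambda>x. exp C * exp (- (1/2) * x)) integrable_on {0..}"
    using has_integral_exp_minus_to_infinity[of "1/2" 0] by (intro integrable_on_mult_right) auto
  have int: "((\<lambda>x. \<Sum>n<N. g n x) has_integral (\<Sum>n<N. a n)) {0..}" for N
    using g_int by (intro has_integral_sum) auto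
  have "(\<lambda>x. \<Sum>n<N. g n x) integrable_on {0..}" for N
    using int by blast
  note dc = dominated_convergence[OF this dom bound lim]
  show "f integrable_on {0..}" by (rule dc(1))
  have "a sums integral {0..} f"
    unfolding sums_def using dc(2) int[THEN integral_unique] by simp
  \<comment> \<open>The split into theta^(1/eta + 1) and 1 / theta matches
    \<open>xi_density\<close>: the first factor cancels its power of theta, the second cancels the
    factor theta in the claim.\<close>
  then have S: "(\<lambda>n. \<theta> powr (1 / \<eta> + 1) * (a n / \<theta>)) sums (\<theta> powr (1 / \<eta> + 1) * (integral {0..} f / \<theta>))"
    by (intro sums_mult sums_divide)
  have "(- 1) ^ n * (\<theta> powr (- 1 / \<eta>)) powr (- real (Suc n) * \<eta> - 1) *
           (Gamma (real (Suc n) * \<eta> + 1) / fact (Suc n)) * sin (real (Suc n) * pi * \<eta>) =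
       \<theta> powr (1 / \<eta> + 1) * (a n / \<theta>)" for n
  proof -
    have "(\<theta> powr (- 1 / \<eta>)) powr (- real (Suc n) * \<eta> - 1) = \<theta> powr (real (Suc n) + 1 / \<eta>)"
    proof -
      have "- 1 / \<eta> * (- k * \<eta> - 1) = k + 1 / \<eta>" for k
        using \<eta> by (simp add: divide_simps algebra_simps)
      then show ?thesis by (simp only: powr_powr)
    qed
    also have "\<dots> = \<theta> ^ Suc n * \<theta> powr (1 / \<eta>)"
      using \<theta> by (simp add: powr_add powr_realpow del: of_nat_Suc power_Suc)
    also have "\<dots> = \<theta> powr (1 / \<eta> + 1) * (\<theta> ^ Suc n / \<theta>)"
      using \<theta> by (simp add: powr_add)
    finally show ?thesis unfolding a_def by (simp add: mult_ac del: fact_Suc of_nat_Suc power_Suc)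
  qed
  with S have "stable_density \<eta> (\<theta> powr (- 1 / \<eta>)) = 1 / pi * (\<theta> powr (1 / \<eta> + 1) * (integral {0..} f / \<theta>))"
    unfolding stable_density_def by (simp add: sums_iff del: fact_Suc of_nat_Suc power_Suc)
  then have "\<theta> * xi_density \<eta> \<theta> = 1 / (pi * \<eta>) * (\<theta> powr (- 1 - 1 / \<eta>) * \<theta> powr (1 / \<eta> + 1)) * integral {0..} f"
    unfolding xi_density_def using \<theta> by (simp add: mult_ac)
  also have "\<theta> powr (- 1 - 1 / \<eta>) * \<theta> powr (1 / \<eta> + 1) = 1"
    using \<theta> by (simp flip: powr_add)
  finally show "\<theta> * xi_density \<eta> \<theta> = 1 / (pi * \<eta>) * integral {0..} f" by simp
qed

text \<open>The rotation by \<open>- \<i>\<close> moves the branch cut out of the closed upper half plane.\<close>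

definition upper_powr :: "real \<Rightarrow> complex \<Rightarrow> complex" where
  "upper_powr \<eta> s = cis (pi * \<eta> / 2) * (- \<i> * s) powr of_real \<eta>"

lemma upper_powr_0 [simp]: "upper_powr \<eta> 0 = 0"
  by (simp add: upper_powr_def)

text \<open>The angle pi / 2 + Im (Ln (-i s)) is the argument of s in (-pi / 2, 3 pi / 2], that is,
  for the branch cut along the negative imaginary axis.\<close>

lemma upper_powr_polar:
  assumes "s \<noteq> 0"
  shows "upper_powr \<eta> s = of_real (norm s powr \<eta>) * cis (\<eta> * (pi / 2 + Im (Ln (- \<i> * s))))"
proof -
  have "(- \<i> * s) powr of_real \<eta> = exp (of_real \<eta> * Ln (- \<i> * s))"
    using assms by (simp add: powr_def)
  also have "of_real \<eta> * Ln (- \<i> * s) = of_real (\<eta> * ln (norm s)) + \<i> * of_real (\<eta> * Im (Ln (- \<i> * s)))"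
    using assms by (intro complex_eqI) (simp_all add: norm_mult)
  also have "exp \<dots> = of_real (norm s powr \<eta>) * cis (\<eta> * Im (Ln (- \<i> * s)))"
    using assms unfolding exp_add cis_conv_exp by (simp add: powr_def flip: exp_of_real)
  finally show ?thesis
    unfolding upper_powr_def by (simp add: cis_mult distrib_left mult.commute)
qed

lemma norm_upper_powr: "norm (upper_powr \<eta> s) = norm s powr \<eta>"
  by (cases "s = 0") (simp_all add: upper_powr_polar norm_mult)

lemma upper_powr_of_real:
  assumes "x \<ge> 0"
  shows "upper_powr \<eta> (of_real x) = of_real (x powr \<eta>)"
    "upper_powr \<eta> (- of_real x) = of_real (x powr \<eta>) * cis (pi * \<eta>)"
proof -
  have Ln1: "Im (Ln (- \<i> * of_real x)) = - pi / 2" if "x > 0"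
    using Ln_times_of_real[OF that, of "- \<i>"] that by (simp add: mult.commute)
  have Ln2: "Im (Ln (- \<i> * - of_real x)) = pi / 2" if "x > 0"
    using Ln_times_of_real[OF that, of "\<i>"] that by (simp add: mult.commute)
  show "upper_powr \<eta> (of_real x) = of_real (x powr \<eta>)"
  proof (cases "x = 0")
    case False
    then have "x > 0" using assms by simp
    from upper_powr_polar[of "of_real x" \<eta>, unfolded Ln1[OF this]] False assms show ?thesis by simp
  qed simp
  show "upper_powr \<eta> (- of_real x) = of_real (x powr \<eta>) * cis (pi * \<eta>)"
  proof (cases "x = 0")
    case False
    then have "x > 0" using assms by simp
    from upper_powr_polar[of "- of_real x" \<eta>, unfolded Ln2[OF this]] False assms show ?thesis
      by (simp add: mult.commute)
  qed simp
qed

text \<open>On the ray \<open>K + x e\<^sup>i\<^sup>\<alpha>\<close> the argument of \<open>s\<close> stays in \<open>[0, \<alpha>]\<close>.\<close>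

lemma Re_upper_powr_ray:
  assumes \<eta>: "0 < \<eta>" "\<eta> < 1" and \<alpha>: "pi / 2 < \<alpha>" "\<alpha> < pi" "\<eta> * \<alpha> < pi / 2"
    and K: "K > 0" and x: "x \<ge> 0"
  shows "(K * sin \<alpha>) powr \<eta> * cos (\<eta> * \<alpha>) \<le> Re (upper_powr \<eta> (of_real K + of_real x * cis \<alpha>))"
proof -
  define s where "s = of_real K + of_real x * cis \<alpha>"
  define u where "u = - \<i> * s"
  define \<beta> where "\<beta> = Im (Ln u)"
  have sin_pos: "sin \<alpha> > 0" using \<alpha> by (intro sin_gt_zero) (use pi_gt_zero in linarith)+
  \<comment> \<open>The product is s e^(-i alpha) = K e^(-i alpha) + x, so only K contributes to its
    imaginary part. The value yields both the lower bound K sin alpha for the norm of s and, through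
    its sign, the upper bound alpha for the argument.\<close>
  have "Im (u * cis (pi / 2 - \<alpha>)) = - K * sin \<alpha>"
  proof -
    have "Im (u * cis (pi / 2 - \<alpha>)) = - K * sin \<alpha> + x * (sin \<alpha> * cos \<alpha> - cos \<alpha> * sin \<alpha>)"
      unfolding u_def s_def by (simp add: cos_diff sin_diff algebra_simps)
    then show ?thesis by simp
  qed
  note Im_u = this
  then have "K * sin \<alpha> \<le> norm (u * cis (pi / 2 - \<alpha>))"
    using abs_Im_le_cmod[of "u * cis (pi / 2 - \<alpha>)"] K sin_pos by (simp add: abs_mult)
  then have norm_s: "K * sin \<alpha> \<le> norm s"
    unfolding u_def by (simp add: norm_mult)
  have Ks: "K * sin \<alpha> > 0" using K sin_pos by simp
  with norm_s have s0: "s \<noteq> 0" by auto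
  then have u0: "u \<noteq> 0" by (simp add: u_def)
  have "Re u \<ge> 0" unfolding u_def s_def using x sin_pos by simp
  then have \<beta>: "\<bar>\<beta>\<bar> \<le> pi / 2" unfolding \<beta>_def using Re_Ln_pos_le u0 by blast
  have "u = of_real (norm u) * cis \<beta>"
    unfolding \<beta>_def using u0 by (metis Arg_def cis_Arg mult.commute nonzero_eq_divide_eq norm_eq_zero of_real_eq_0_iff rcis_cmod_Arg rcis_def)
  then have "u * cis (pi / 2 - \<alpha>) = of_real (norm u) * cis (\<beta> + pi / 2 - \<alpha>)"
    by (metis ab_semigroup_mult_class.mult_ac(1) add_diff_eq cis_mult)
  then have "Im (u * cis (pi / 2 - \<alpha>)) = norm u * sin (\<beta> + pi / 2 - \<alpha>)" by simp
  with Im_u Ks have "sin (\<beta> + pi / 2 - \<alpha>) < 0"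
    by (metis less_eq_real_def linorder_not_le mult_minus_left neg_less_0_iff_less norm_ge_zero zero_le_mult_iff)
  \<comment> \<open>The angle \<open>\<beta> + pi / 2 - \<alpha>\<close> is less than pi, so its
    sine can be negative only if the angle is.\<close>
  then have "\<beta> + pi / 2 \<le> \<alpha>"
    using sin_ge_zero[of "\<beta> + pi / 2 - \<alpha>"] \<beta> \<alpha> by (cases "\<beta> + pi / 2 \<le> \<alpha>") auto
  then have "\<eta> * (pi / 2 + \<beta>) \<le> \<eta> * \<alpha>" using \<eta> by (intro mult_left_mono) auto
  moreover have "0 \<le> \<eta> * (pi / 2 + \<beta>)" using \<beta> \<eta> by (intro mult_nonneg_nonneg) auto
  ultimately have cos: "cos (\<eta> * \<alpha>) \<le> cos (\<eta> * (pi / 2 + \<beta>))"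
    using \<alpha> by (intro cos_monotone_0_pi_le) auto
  have cos0: "0 \<le> cos (\<eta> * \<alpha>)"
    using \<alpha> \<eta> by (intro cos_ge_zero) (auto intro: order_trans[of _ 0])
  have "Re (upper_powr \<eta> s) = norm s powr \<eta> * cos (\<eta> * (pi / 2 + \<beta>))"
    using s0 by (simp add: upper_powr_polar \<beta>_def u_def)
  moreover have "(K * sin \<alpha>) powr \<eta> * cos (\<eta> * \<alpha>) \<le> norm s powr \<eta> * cos (\<eta> * (pi / 2 + \<beta>))"
    using norm_s Ks cos cos0 \<eta> by (intro mult_mono powr_mono2) auto
  ultimately show ?thesis by (simp add: s_def)
qed

text \<open>Cauchy's theorem moves the ray of integration from the negative real axis to \<open>K + x e\<^sup>i\<^sup>\<alpha>\<close>; the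
  segment from \<open>0\<close> to \<open>K\<close> contributes a real number.\<close>

lemma xi_density_decay_ray:
  assumes \<eta>: "0 < \<eta>" "\<eta> < 1" and \<theta>: "0 < \<theta>"
    and \<alpha>: "pi / 2 < \<alpha>" "\<alpha> < pi" "\<eta> * \<alpha> < pi / 2" and K: "K > 0"
  shows "\<bar>\<theta> * xi_density \<eta> \<theta>\<bar> \<le> 1 / (pi * \<eta>) * (exp K / \<bar>cos \<alpha>\<bar> * exp (- \<theta> * ((K * sin \<alpha>) powr \<eta> * cos (\<eta> * \<alpha>))))"
proof -
  define H where "H s = exp (s - of_real \<theta> * upper_powr \<eta> s)" for s
  define S where "S = {s. 0 \<le> Im s}"
  have convS: "convex S" unfolding S_def by (rule convex_halfspace_Im_ge)
  have cont: "continuous_on S H"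
    unfolding H_def upper_powr_def S_def using \<eta> by (intro continuous_intros) auto
  have "H field_differentiable at s" if "s \<in> interior S - {}" for s
  proof -
    have "interior {s. \<i> \<bullet> s \<ge> 0} = {s. \<i> \<bullet> s > 0}"
      by (rule interior_halfspace_ge) simp
    then have "interior S = {s. Im s > 0}"
      unfolding S_def inner_complex_def by (simp only: imaginary_unit.sel mult_zero_left mult_1_left add_0_left)
    then have "Im s > 0" using that by simp
    then have "- \<i> * s \<notin> \<real>\<^sub>\<le>\<^sub>0" by (simp add: complex_nonpos_Reals_iff)
    then have "H analytic_on {s}"
      unfolding H_def upper_powr_def by (intro analytic_intros) auto
    then show ?thesis by (simp add: analytic_on_imp_differentiable_at)
  qed
  \<comment> \<open>The primitive extends to the real axis, where \<open>H\<close> is merely known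
    to be continuous. Cauchy's theorem then takes the form that contour integrals are differences of
    \<open>F\<close>.\<close>
  then obtain F where F: "\<And>s. s \<in> S \<Longrightarrow> (F has_field_derivative H s) (at s within S)"
    using holomorphic_convex_primitive[OF convS finite.emptyI cont] by blast
  have FTC: "((\<lambda>x. H (p + of_real x * w) * w) has_integral F (p + of_real R * w) - F p) {0..R}"
    if "\<And>x. 0 \<le> x \<Longrightarrow> x \<le> R \<Longrightarrow> p + of_real x * w \<in> S" "R \<ge> 0" for p w R
  proof -
    have "((\<lambda>x. F (p + of_real x * w)) has_vector_derivative H (p + of_real x * w) * w) (at x within {0..R})"
      if x: "x \<in> {0..R}" for x
    proof -
      have 1: "((\<lambda>x. p + of_real x * w) has_vector_derivative w) (at x within {0..R})"
        by (auto intro!: derivative_eq_intros simp: has_vector_derivative_def fun_eq_iff scaleR_conv_of_real)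
      have 2: "(F has_field_derivative H (p + of_real x * w)) (at (p + of_real x * w) within (\<lambda>x. p + of_real x * w) ` {0..R})"
        using x that(1) by (intro DERIV_subset[OF F]) (use \<open>\<And>x. 0 \<le> x \<Longrightarrow> x \<le> R \<Longrightarrow> p + of_real x * w \<in> S\<close> in auto)
      show ?thesis
        using field_vector_diff_chain_within[OF 1 2] by (simp add: o_def mult.commute[of w])
    qed
    from fundamental_theorem_of_calculus[OF \<open>R \<ge> 0\<close> this] show ?thesis by simp
  qed
  define w where "w = cis \<alpha>"
  have sin_pos: "sin \<alpha> > 0" using \<alpha> by (intro sin_gt_zero) (use pi_gt_zero in linarith)+
  have cos_neg: "cos \<alpha> < 0" using \<alpha> by (intro cos_lt_zero_pi) auto
  define c where "c = - cos \<alpha>"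
  have c: "c > 0" "c \<le> 1" using cos_neg by (auto simp: c_def minus_le_iff)
  define E where "E = exp (- \<theta> * ((K * sin \<alpha>) powr \<eta> * cos (\<eta> * \<alpha>)))"
  have ray: "norm (F (of_real K + of_real R * w) - F (of_real K)) \<le> exp K / c * E" if R: "R \<ge> 0" for R
  proof -
    have i1: "((\<lambda>x. H (of_real K + of_real x * w) * w) has_integral F (of_real K + of_real R * w) - F (of_real K)) {0..R}"
      using R sin_pos by (intro FTC) (auto simp: S_def w_def)
    have i2: "((\<lambda>x. exp K * E * exp (- c * x)) has_integral exp K * E * (- exp (- c * R) / c - - exp (- c * 0) / c)) {0..R}"
      using R c by (intro has_integral_mult_right fundamental_theorem_of_calculus)
        (auto intro!: derivative_eq_intros simp flip: has_real_derivative_iff_has_vector_derivative)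
    have bd: "norm (H (of_real K + of_real x * w) * w) \<le> exp K * E * exp (- c * x)" if "x \<in> {0..R}" for x
    proof -
      have "norm (H (of_real K + of_real x * w) * w)
          = exp (K + x * cos \<alpha> - \<theta> * Re (upper_powr \<eta> (of_real K + of_real x * w)))"
        unfolding H_def w_def by (simp add: norm_mult)
      also have "\<dots> \<le> exp (K + x * cos \<alpha> - \<theta> * ((K * sin \<alpha>) powr \<eta> * cos (\<eta> * \<alpha>)))"
        using Re_upper_powr_ray[OF \<eta> \<alpha> K, of x] that \<theta> unfolding w_def by (simp add: mult_left_mono)
      also have "\<dots> = exp K * E * exp (- c * x)"
        unfolding E_def c_def by (simp add: mult.commute flip: exp_add)
      finally show ?thesis .
    qed
    have "norm (F (of_real K + of_real R * w) - F (of_real K))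
        \<le> exp K * E * (- exp (- c * R) / c - - exp (- c * 0) / c)"
      using integral_norm_bound_integral[OF has_integral_integrable[OF i1] has_integral_integrable[OF i2] bd]
      unfolding integral_unique[OF i1] integral_unique[OF i2] .
    also have "\<dots> \<le> exp K * E * (1 / c)"
      using c unfolding E_def by (intro mult_left_mono) (auto simp: divide_simps)
    finally show ?thesis by simp
  qed
  have real_seg: "Im (F (of_real K) - F 0) = 0"
  proof -
    have "((\<lambda>x. H (0 + of_real x * 1) * 1) has_integral F (0 + of_real K * 1) - F 0) {0..K}"
      using K by (intro FTC) (auto simp: S_def)
    then have "((\<lambda>x. Im (H (0 + of_real x * 1) * 1)) has_integral Im (F (0 + of_real K * 1) - F 0)) {0..K}"
      by (rule has_integral_linear[OF _ bounded_linear_Im, unfolded o_def])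
    then have "((\<lambda>x. 0) has_integral Im (F (0 + of_real K * 1) - F 0)) {0..K}"
    proof (rule has_integral_eq[rotated])
      show "Im (H (0 + of_real x * 1) * 1) = 0" if "x \<in> {0..K}" for x
        using that unfolding H_def by (simp add: upper_powr_of_real Im_exp)
    qed
    then show ?thesis using has_integral_0_eq by auto
  qed
  \<comment> \<open>On the closing segment exp (Re s) decays at rate c in R. Slope c / 2 spends half
    of it on exp (theta |s|^eta) and keeps exp (-(c / 2) R), which still beats the length of the
    segment.\<close>
  obtain C where C: "\<And>x. 0 \<le> x \<Longrightarrow> \<theta> * x powr \<eta> \<le> c / 2 * x + C"
    using powr_le_affine[of \<eta> \<theta> "c / 2"] \<eta> \<theta> c by (metis half_gt_zero less_eq_real_def)
  \<comment> \<open>A chord replaces the usual circular arc: the bounds on Re s and on the norm of s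
    describe convex sets, so they need checking only at its end points.\<close>
  have seg: "norm (F (of_real K + of_real R * w) - F (- of_real R)) \<le> exp (K + c / 2 * K + C) * exp (- (c / 2) * R) * (K + 2 * R)"
    if R: "R \<ge> 0" for R
  proof -
    let ?P = "of_real K + of_real R * w" and ?Q = "- of_real R :: complex"
    have PQ: "?P \<in> S" "?Q \<in> S" using R sin_pos by (auto simp: S_def w_def)
    have sub: "closed_segment ?P ?Q \<subseteq> S" using PQ convS by (simp add: closed_segment_subset)
    have "norm (F ?P - F ?Q) \<le> (exp (K + c / 2 * K + C) * exp (- (c / 2) * R)) * norm (?P - ?Q)"
    proof (rule field_differentiable_bound)
      show "convex (closed_segment ?P ?Q)" by simp
      show "(F has_field_derivative H s) (at s within closed_segment ?P ?Q)" if "s \<in> closed_segment ?P ?Q" for s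
        using F sub that by (meson DERIV_subset subset_iff)
      show "norm (H s) \<le> exp (K + c / 2 * K + C) * exp (- (c / 2) * R)" if s: "s \<in> closed_segment ?P ?Q" for s
      proof -
        have "s \<in> {s. Re s \<le> K - c * R}"
        proof (rule subsetD[OF closed_segment_subset s])
          show "?P \<in> {s. Re s \<le> K - c * R}" by (simp add: w_def c_def mult.commute)
          have "c * R \<le> 1 * R" using c R by (intro mult_right_mono) auto
          then show "?Q \<in> {s. Re s \<le> K - c * R}" using K by simp
        qed (rule convex_halfspace_Re_le)
        moreover have "s \<in> cball 0 (K + R)"
        proof (rule subsetD[OF closed_segment_subset s])
          have "norm ?P \<le> K + R" using norm_triangle_ineq[of "of_real K" "of_real R * w"] K R
            by (simp add: norm_mult w_def)
          then show "?P \<in> cball 0 (K + R)" by simp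
        qed (use R K in auto)
        ultimately have Re: "Re s \<le> K - c * R" and norm: "norm s \<le> K + R" by auto
        have "- (\<theta> * Re (upper_powr \<eta> s)) \<le> \<theta> * norm s powr \<eta>"
          using mult_left_mono[OF complex_Re_le_cmod[of "- upper_powr \<eta> s"], of \<theta>] \<theta>
          by (simp add: norm_upper_powr)
        moreover have "norm (H s) = exp (Re s - \<theta> * Re (upper_powr \<eta> s))"
          unfolding H_def by simp
        ultimately have "norm (H s) \<le> exp (Re s + \<theta> * norm s powr \<eta>)" by simp
        also have "\<dots> \<le> exp (K - c * R + (c / 2 * (K + R) + C))"
        proof -
          have "norm s powr \<eta> \<le> (K + R) powr \<eta>" using norm \<eta> by (intro powr_mono2) auto
          then have "\<theta> * norm s powr \<eta> \<le> \<theta> * (K + R) powr \<eta>" using \<theta> by (intro mult_left_mono) auto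
          also have "\<dots> \<le> c / 2 * (K + R) + C" using K R by (intro C) auto
          finally show ?thesis using Re by simp
        qed
        also have "\<dots> = exp (K + c / 2 * K + C) * exp (- (c / 2) * R)"
          by (simp add: algebra_simps flip: exp_add)
        finally show ?thesis .
      qed
    qed auto
    also have "norm (?P - ?Q) \<le> K + 2 * R"
    proof -
      have "norm (?P - ?Q) \<le> norm (of_real K + of_real R * w) + norm (of_real R :: complex)"
        using norm_triangle_ineq[of ?P "of_real R"] by simp
      also have "norm (of_real K + of_real R * w) \<le> K + R"
        using norm_triangle_ineq[of "of_real K" "of_real R * w"] K R by (simp add: norm_mult w_def)
      finally show ?thesis using R by simp
    qed
    finally show ?thesis by (simp add: mult_left_mono)
  qed
  define f where "f x = - Im (exp (of_real (- (\<theta> * x powr \<eta>)) * cis (pi * \<eta>))) / exp x" for x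
  have Im_H: "f x = Im (H (0 + of_real x * -1) * -1)" if "x \<ge> 0" for x
  proof -
    define Q where "Q = exp (of_real (- (\<theta> * x powr \<eta>)) * cis (pi * \<eta>))"
    have "H (- of_real x) = Q * of_real (exp (- x))"
      unfolding H_def Q_def upper_powr_of_real(2)[OF that] exp_of_real[symmetric] exp_add[symmetric]
      by (simp add: algebra_simps)
    moreover have "f x = - (Im Q * exp (- x))"
      unfolding f_def Q_def[symmetric] exp_minus divide_inverse by simp
    ultimately show ?thesis by simp
  qed
  have f_R: "(f has_integral Im (F (- of_real R) - F 0)) {0..R}" if R: "R \<ge> 0" for R
  proof -
    have "((\<lambda>x. H (0 + of_real x * -1) * -1) has_integral F (0 + of_real R * -1) - F 0) {0..R}"
      using R by (intro FTC) (auto simp: S_def)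
    then have "((\<lambda>x. Im (H (0 + of_real x * -1) * -1)) has_integral Im (F (0 + of_real R * -1) - F 0)) {0..R}"
      by (rule has_integral_linear[OF _ bounded_linear_Im, unfolded o_def])
    then have "(f has_integral Im (F (0 + of_real R * -1) - F 0)) {0..R}"
      by (rule has_integral_eq[rotated]) (use Im_H in auto)
    then show ?thesis by simp
  qed
  have fi: "f integrable_on {0..}" and xi: "\<theta> * xi_density \<eta> \<theta> = 1 / (pi * \<eta>) * integral {0..} f"
    using xi_density_integral[OF \<eta> \<theta>] unfolding f_def by auto
  have lim: "((\<lambda>R. integral {0..R} f) \<longlongrightarrow> integral {0..} f) at_top"
  proof (rule tendstoI)
    fix e :: real assume "e > 0"
    then obtain B where B: "B > 0" "\<And>a b. ball 0 B \<subseteq> cbox a b \<Longrightarrow>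
        norm (integral (cbox a b) (\<lambda>x. if x \<in> {0..} then f x else 0) - integral {0..} f) < e"
      using fi integrable_integral[of f "{0..}"] unfolding has_integral_alt'[of f] by blast
    have "dist (integral {0..R} f) (integral {0..} f) < e" if "R \<ge> B" for R
    proof -
      have "integral (cbox (- B) R) (\<lambda>x. if x \<in> {0..} then f x else 0) = integral ({0..} \<inter> cbox (- B) R) f"
        by (rule integral_restrict_Int)
      also have "{0..} \<inter> cbox (- B) R = {0..R}" using B by auto
      finally have eq: "integral (cbox (- B) R) (\<lambda>x. if x \<in> {0..} then f x else 0) = integral {0..R} f" .
      have "ball 0 B \<subseteq> cbox (- B) R" using that by (auto simp: dist_real_def)
      from B(2)[OF this] show ?thesis unfolding eq dist_norm .
    qed
    then show "\<forall>\<^sub>F R in at_top. dist (integral {0..R} f) (integral {0..} f) < e"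
      unfolding eventually_at_top_linorder by blast
  qed
  have bound: "\<bar>integral {0..R} f\<bar> \<le> exp (K + c / 2 * K + C) * exp (- (c / 2) * R) * (K + 2 * R) + exp K / c * E"
    if R: "R \<ge> 0" for R
  proof -
    \<comment> \<open>The path from 0 to -R runs through K and K + R e^(i alpha); its first leg
      drops out by \<open>real_seg\<close>.\<close>
    have "integral {0..R} f = Im (F (- of_real R) - F (of_real K + of_real R * w)) + Im (F (of_real K + of_real R * w) - F (of_real K))"
      using f_R[OF R, THEN integral_unique] real_seg by simp
    also have "\<bar>\<dots>\<bar> \<le> norm (F (of_real K + of_real R * w) - F (- of_real R)) + norm (F (of_real K + of_real R * w) - F (of_real K))"
      using abs_Im_le_cmod[of "F (- of_real R) - F (of_real K + of_real R * w)"]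
        abs_Im_le_cmod[of "F (of_real K + of_real R * w) - F (of_real K)"] 
      unfolding norm_minus_commute[of "F (- of_real R)"] by linarith
    finally show ?thesis using seg[OF R] ray[OF R] by linarith
  qed
  have "((\<lambda>R. exp (K + c / 2 * K + C) * exp (- (c / 2) * R) * (K + 2 * R) + exp K / c * E) \<longlongrightarrow> 0 + exp K / c * E) at_top"
    using c by real_asymp
  then have "((\<lambda>R. exp (K + c / 2 * K + C) * exp (- (c / 2) * R) * (K + 2 * R) + exp K / c * E) \<longlongrightarrow> exp K / c * E) at_top"
    by simp
  then have "\<bar>integral {0..} f\<bar> \<le> exp K / c * E"
  proof (rule tendsto_le[OF trivial_limit_at_top_linorder _ tendsto_rabs[OF lim]])
    show "\<forall>\<^sub>F R in at_top. \<bar>integral {0..R} f\<bar>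
        \<le> exp (K + c / 2 * K + C) * exp (- (c / 2) * R) * (K + 2 * R) + exp K / c * E"
      using eventually_ge_at_top[of 0] by eventually_elim (rule bound)
  qed
  moreover have "exp K / c * E = exp K / \<bar>cos \<alpha>\<bar> * exp (- \<theta> * ((K * sin \<alpha>) powr \<eta> * cos (\<eta> * \<alpha>)))"
    using cos_neg by (simp add: E_def c_def)
  moreover have "\<bar>\<theta> * xi_density \<eta> \<theta>\<bar> = 1 / (pi * \<eta>) * \<bar>integral {0..} f\<bar>"
    unfolding xi using \<eta> by (simp add: abs_mult)
  moreover have "0 \<le> 1 / (pi * \<eta>)" using \<eta> by simp
  ultimately show ?thesis by (metis mult_left_mono)
qed

text \<open>The decay rate (K sin alpha)^eta cos (eta alpha) of the contour estimate grows without
  bound with K, at the price of the constant exp K.\<close>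

lemma xi_density_decay:
  fixes \<eta> l :: real
  assumes \<eta>: "0 < \<eta>" "\<eta> < 1"
  obtains C where "C \<ge> 0" "\<And>\<theta>. 0 < \<theta> \<Longrightarrow> \<bar>\<theta> * xi_density \<eta> \<theta>\<bar> \<le> C * exp (- l * \<theta>)"
proof -
  \<comment> \<open>The midpoint between pi / 2 and min (pi, pi / (2 eta)). The lower limit makes
    exp decay along the ray; the upper ones keep the ray in the upper half plane and cos (eta alpha)
    positive.\<close>
  define \<alpha> where "\<alpha> = pi / 2 * (min 2 (1 / \<eta>) + 1) / 2"
  have "1 < min 2 (1 / \<eta>)" using \<eta> by simp
  then have \<alpha>: "pi / 2 < \<alpha>" "\<alpha> < pi" "\<alpha> < pi / 2 * (1 / \<eta>)"
  proof -
    define t where "t = min 2 (1 / \<eta>)"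
    have t: "1 < t" "t \<le> 2" "t \<le> 1 / \<eta>" using \<open>1 < min 2 (1 / \<eta>)\<close> by (auto simp: t_def)
    have \<alpha>_t: "\<alpha> = pi / 2 * ((t + 1) / 2)" by (simp add: \<alpha>_def t_def)
    have "pi / 2 * 1 < pi / 2 * ((t + 1) / 2)" "pi / 2 * ((t + 1) / 2) < pi / 2 * t"
      using t by (intro mult_strict_left_mono; simp)+
    moreover have "pi / 2 * t \<le> pi / 2 * 2" "pi / 2 * t \<le> pi / 2 * (1 / \<eta>)"
      using t by (intro mult_left_mono; simp)+
    ultimately show "pi / 2 < \<alpha>" "\<alpha> < pi" "\<alpha> < pi / 2 * (1 / \<eta>)"
      unfolding \<alpha>_t by linarith+
  qed
  then have \<alpha>': "\<eta> * \<alpha> < pi / 2" using \<eta> by (simp add: field_simps)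
  have sin_pos: "sin \<alpha> > 0" using \<alpha> by (intro sin_gt_zero) (use pi_gt_zero in linarith)+
  have cos_pos: "cos (\<eta> * \<alpha>) > 0"
    using \<alpha> \<alpha>' \<eta> by (intro cos_gt_zero_pi) (auto intro: less_trans[of _ 0])
  \<comment> \<open>Solves (K sin alpha)^eta cos (eta alpha) = max l 1; the maximum covers rates l
    that are not positive.\<close>
  define K where "K = (max l 1 / cos (\<eta> * \<alpha>)) powr (1 / \<eta>) / sin \<alpha>"
  have K: "K > 0" unfolding K_def using sin_pos cos_pos by simp
  have "(K * sin \<alpha>) powr \<eta> * cos (\<eta> * \<alpha>) = max l 1"
    unfolding K_def using sin_pos cos_pos \<eta> by (simp add: powr_powr)
  then have KK: "l \<le> (K * sin \<alpha>) powr \<eta> * cos (\<eta> * \<alpha>)" by simp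
  show ?thesis
  proof
    show "0 \<le> 1 / (pi * \<eta>) * (exp K / \<bar>cos \<alpha>\<bar>)" using \<eta> by simp
    fix \<theta> :: real assume \<theta>: "0 < \<theta>"
    have "\<bar>\<theta> * xi_density \<eta> \<theta>\<bar> \<le> 1 / (pi * \<eta>) * (exp K / \<bar>cos \<alpha>\<bar> * exp (- \<theta> * ((K * sin \<alpha>) powr \<eta> * cos (\<eta> * \<alpha>))))"
      using xi_density_decay_ray[OF \<eta> \<theta> \<alpha>(1,2) \<alpha>' K] .
    also have "\<dots> \<le> 1 / (pi * \<eta>) * (exp K / \<bar>cos \<alpha>\<bar> * exp (- l * \<theta>))"
      using \<eta> \<theta> KK by (intro mult_left_mono) (auto simp: mult.commute)
    finally show "\<bar>\<theta> * xi_density \<eta> \<theta>\<bar> \<le> 1 / (pi * \<eta>) * (exp K / \<bar>cos \<alpha>\<bar>) * exp (- l * \<theta>)"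
      by simp
  qed
qed

lemma borel_measurable_xi_density [measurable]: "xi_density \<eta> \<in> borel_measurable borel"
  unfolding xi_density_def[abs_def] stable_density_def by measurable

section \<open>The operator family\<close>

lemma C0_semigroup_exp_bound:
  fixes T :: "real \<Rightarrow> 'z::real_normed_vector \<Rightarrow>\<^sub>L 'z"
  assumes T: "C0_semigroup T" and a: "a > 0" and bdd: "bdd_above ((\<lambda>t. norm (T t)) ` {0..a})"
  obtains M \<omega> where "M \<ge> 0" "\<omega> \<ge> 0" "\<And>t. t \<ge> 0 \<Longrightarrow> norm (T t) \<le> M * exp (\<omega> * t)"
proof -
  \<comment> \<open>The maximum with 1 makes the growth rate ln M / a nonnegative.\<close>
  define M where "M = max 1 (SUP t\<in>{0..a}. norm (T t))"
  have M: "M \<ge> 1" "\<And>t. t \<in> {0..a} \<Longrightarrow> norm (T t) \<le> M"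
    using cSUP_upper[OF _ bdd] by (auto simp: M_def le_max_iff_disj)
  have add: "T (s + t) = T s o\<^sub>L T t" if "s \<ge> 0" "t \<ge> 0" for s t
    using T that unfolding C0_semigroup_def by blast
  have pow: "norm (T (real n * a + s)) \<le> M ^ Suc n" if "s \<in> {0..a}" for n s
  proof (induction n)
    case 0
    then show ?case using M that by simp
  next
    case (Suc n)
    have "T (real (Suc n) * a + s) = T a o\<^sub>L T (real n * a + s)"
      using add[of a "real n * a + s"] a that by (simp add: algebra_simps)
    then have "norm (T (real (Suc n) * a + s)) \<le> norm (T a) * norm (T (real n * a + s))"
      by (simp add: norm_blinfun_compose)
    also have "\<dots> \<le> M * M ^ Suc n"
      using Suc M a by (intro mult_mono) auto
    finally show ?case by simp
  qed
  show ?thesis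
  proof
    show "M \<ge> 0" "ln M / a \<ge> 0" using M(1) a by auto
    fix t :: real assume t: "t \<ge> 0"
    define n where "n = nat \<lfloor>t / a\<rfloor>"
    have n: "real n \<le> t / a" "t / a < real n + 1" using t a by (auto simp: n_def)
    then have "t - real n * a \<in> {0..a}" using a by (auto simp: field_simps)
    from pow[OF this, of n] have "norm (T t) \<le> M ^ Suc n" by simp
    also have "M ^ n = exp (ln M * real n)"
      using M(1) by (simp add: exp_of_nat_mult mult.commute)
    then have "M ^ Suc n = M * exp (ln M * real n)" by simp
    also have "\<dots> \<le> M * exp (ln M / a * t)"
      using mult_left_mono[OF n(1), of "ln M"] M(1) by simp
    finally show "norm (T t) \<le> M * exp (ln M / a * t)" .
  qed
qed

text \<open>Since T (s + h) x - T s x = T s (T h x - x), right continuity at 0 and boundedness on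
  [0, t + 1] suffice. The same estimate covers points to the left of t, with s as the base point and
  t - s as the increment.\<close>

lemma C0_semigroup_strongly_continuous:
  fixes T :: "real \<Rightarrow> 'z::real_normed_vector \<Rightarrow>\<^sub>L 'z"
  assumes T: "C0_semigroup T" and M: "\<And>t. t \<ge> 0 \<Longrightarrow> norm (T t) \<le> M * exp (\<omega> * t)" "M \<ge> 0" "\<omega> \<ge> 0"
  shows "continuous_on {0..} (\<lambda>t. blinfun_apply (T t) x)"
  unfolding continuous_on_iff
proof (intro ballI allI impI)
  fix t e :: real assume t: "t \<in> {0..}" and e: "e > 0"
  have add: "T (s + t) = T s o\<^sub>L T t" if "s \<ge> 0" "t \<ge> 0" for s t
    using T that unfolding C0_semigroup_def by blast
  define K where "K = M * exp (\<omega> * (t + 1)) + 1"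
  have K: "K > 0" using M by (simp add: K_def add_nonneg_pos)
  have TK: "norm (T s) \<le> K" if "s \<ge> 0" "s \<le> t + 1" for s
  proof -
    have "norm (T s) \<le> M * exp (\<omega> * s)" using M that by simp
    also have "\<dots> \<le> M * exp (\<omega> * (t + 1))"
      using that M by (intro mult_left_mono) (auto intro: mult_left_mono)
    finally show ?thesis by (simp add: K_def)
  qed
  have "((\<lambda>t. blinfun_apply (T t) x) \<longlongrightarrow> x) (at_right 0)"
    using T unfolding C0_semigroup_def by blast
  then have "\<forall>\<^sub>F h in at_right 0. dist (blinfun_apply (T h) x) x < e / K"
    using e K by (intro tendstoD) auto
  then obtain d where d: "d > 0" "\<And>h. 0 < h \<Longrightarrow> h < d \<Longrightarrow> norm (blinfun_apply (T h) x - x) < e / K"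
    unfolding eventually_at_right_field dist_norm by auto
  have T0: "T 0 = id_blinfun" using T unfolding C0_semigroup_def by blast
  have d': "norm (blinfun_apply (T h) x - x) < e / K" if "0 \<le> h" "h < d" for h
    using d(2)[of h] that e K T0 by (cases "h = 0") auto
  have le: "norm (blinfun_apply (T (s + h)) x - blinfun_apply (T s) x) < e"
    if "0 \<le> s" "s \<le> t + 1" "0 \<le> h" "h < d" for s h
  proof -
    have "norm (blinfun_apply (T (s + h)) x - blinfun_apply (T s) x) = norm (blinfun_apply (T s) (blinfun_apply (T h) x - x))"
      using that by (simp add: add blinfun.diff_right)
    also have "\<dots> \<le> norm (T s) * norm (blinfun_apply (T h) x - x)"
      by (rule norm_blinfun)
    also have "\<dots> \<le> K * norm (blinfun_apply (T h) x - x)"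
      using TK that by (intro mult_right_mono) auto
    also have "\<dots> < K * (e / K)"
      using K d' that by (intro mult_strict_left_mono) auto
    finally show ?thesis using K by simp
  qed
  show "\<exists>\<delta>>0. \<forall>s\<in>{0..}. dist s t < \<delta> \<longrightarrow> dist (blinfun_apply (T s) x) (blinfun_apply (T t) x) < e"
  proof (intro exI[of _ "min d 1"] conjI ballI impI)
    fix s assume s: "s \<in> {0..}" "dist s t < min d 1"
    show "dist (blinfun_apply (T s) x) (blinfun_apply (T t) x) < e"
    proof (cases "s \<le> t")
      case True
      then show ?thesis
        using le[of s "t - s"] s by (simp add: dist_norm norm_minus_commute dist_real_def)
    next
      case False
      then show ?thesis
        using le[of t "s - t"] s t by (simp add: dist_norm dist_real_def)
    qed
  qed (use d in auto)
qed

lemma integrable_exp_minus_lebesgue_on: "integrable (lebesgue_on {0<..}) (\<lambda>x::real. exp (- x))"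
proof -
  have "(\<lambda>x::real. exp (- 1 * x)) absolutely_integrable_on {0..}"
    using has_integral_exp_minus_to_infinity[of 1 0]
    by (intro nonnegative_absolutely_integrable_1) auto
  then have "(\<lambda>x::real. exp (- 1 * x)) absolutely_integrable_on {0<..}"
    by (rule set_integrable_subset) auto
  then show ?thesis
    by (simp add: set_integrable_def integrable_restrict_space)
qed

lemma T_eta_properties:
  fixes T :: "real \<Rightarrow> 'z::banach \<Rightarrow>\<^sub>L 'z"
  assumes \<eta>: "0 < \<eta>" "\<eta> < 1" and T: "C0_semigroup T" and a: "a > 0"
    and bdd: "bdd_above ((\<lambda>t. norm (T t)) ` {0..a})"
  obtains K where "K \<ge> 0" "\<And>t x. t \<in> {0..a} \<Longrightarrow> norm (T_eta \<eta> T t x) \<le> K * norm x"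
    "\<And>t. t \<in> {0..a} \<Longrightarrow> linear (T_eta \<eta> T t)"
    "\<And>x. continuous_on {0..a} (\<lambda>t. T_eta \<eta> T t x)"
proof -
  obtain M \<omega> where M: "M \<ge> 0" "\<omega> \<ge> 0" "\<And>t. t \<ge> 0 \<Longrightarrow> norm (T t) \<le> M * exp (\<omega> * t)"
    using C0_semigroup_exp_bound[OF T a bdd] by blast
  have cont: "continuous_on {0..} (\<lambda>t. blinfun_apply (T t) x)" for x
    using C0_semigroup_strongly_continuous[OF T M(3,1,2)] .
  \<comment> \<open>The rate absorbs the growth exp (omega t^eta theta) for every t in [0, a] and
    leaves exp (-theta) as a dominator common to all these t.\<close>
  obtain C where C: "C \<ge> 0" "\<And>\<theta>. 0 < \<theta> \<Longrightarrow> \<bar>\<theta> * xi_density \<eta> \<theta>\<bar> \<le> C * exp (- (\<omega> * a powr \<eta> + 1) * \<theta>)"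
    using xi_density_decay[OF \<eta>] by blast
  define L where "L = lebesgue_on {0::real<..}"
  define G where "G t x \<theta> = (\<theta> * xi_density \<eta> \<theta>) *\<^sub>R blinfun_apply (T (t powr \<eta> * \<theta>)) x" for t x \<theta>
  have T_eta: "T_eta \<eta> T t x = \<eta> *\<^sub>R banach_integral L (G t x)" for t x
    unfolding T_eta_def L_def G_def ..
  have meas: "strongly_measurable L (G t x)" for t x
    unfolding G_def
  proof (rule strongly_measurable_scaleR)
    have "(\<lambda>\<theta>. \<theta> * xi_density \<eta> \<theta>) \<in> borel_measurable borel" by measurable
    then have "(\<lambda>\<theta>. \<theta> * xi_density \<eta> \<theta>) \<in> borel_measurable lebesgue"
      by (simp add: measurable_completion)
    then show "(\<lambda>\<theta>. \<theta> * xi_density \<eta> \<theta>) \<in> borel_measurable L"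
      unfolding L_def by (rule measurable_restrict_space1)
    show "strongly_measurable L (\<lambda>\<theta>. blinfun_apply (T (t powr \<eta> * \<theta>)) x)"
      unfolding L_def
      by (intro strongly_measurable_continuous_on continuous_on_compose2[OF cont] continuous_intros) auto
  qed
  have bound: "norm (G t x \<theta>) \<le> C * M * norm x * exp (- \<theta>)" if "t \<in> {0..a}" "\<theta> > 0" for t x \<theta>
  proof -
    have "norm (blinfun_apply (T (t powr \<eta> * \<theta>)) x) \<le> M * exp (\<omega> * (a powr \<eta> * \<theta>)) * norm x"
    proof -
      have "norm (T (t powr \<eta> * \<theta>)) \<le> M * exp (\<omega> * (t powr \<eta> * \<theta>))"
        using that by (intro M) auto
      also have "t powr \<eta> \<le> a powr \<eta>" using that \<eta> by (intro powr_mono2) auto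
      then have "M * exp (\<omega> * (t powr \<eta> * \<theta>)) \<le> M * exp (\<omega> * (a powr \<eta> * \<theta>))"
        using M that by (intro mult_left_mono) (auto intro!: mult_left_mono mult_right_mono)
      finally show ?thesis
        using norm_blinfun[of "T (t powr \<eta> * \<theta>)" x] by (meson mult_right_mono norm_ge_zero order_trans)
    qed
    then have "norm (G t x \<theta>) \<le> (C * exp (- (\<omega> * a powr \<eta> + 1) * \<theta>)) * (M * exp (\<omega> * (a powr \<eta> * \<theta>)) * norm x)"
      unfolding G_def norm_scaleR using C that by (intro mult_mono) auto
    also have "\<dots> = C * M * norm x * (exp (- (\<omega> * a powr \<eta> + 1) * \<theta>) * exp (\<omega> * (a powr \<eta> * \<theta>)))"
      by (simp add: mult_ac)
    also have "exp (- (\<omega> * a powr \<eta> + 1) * \<theta>) * exp (\<omega> * (a powr \<eta> * \<theta>)) = exp (- \<theta>)"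
      by (simp add: algebra_simps flip: exp_add)
    finally show ?thesis .
  qed
  have AE_bound: "AE \<theta> in L. norm (G t x \<theta>) \<le> C * M * norm x * exp (- \<theta>)" if "t \<in> {0..a}" for t x
    using bound[OF that] by (intro AE_I2) (auto simp: L_def)
  have dom: "integrable L (\<lambda>\<theta>. C * M * norm x * exp (- \<theta>))" for x :: 'z
    using integrable_exp_minus_lebesgue_on unfolding L_def by simp
  have int: "banach_integrable L (G t x)" if "t \<in> {0..a}" for t x
    using meas dom AE_bound[OF that] by (rule banach_integrableI_bound)
  note has_int = has_banach_integral_banach_integral[OF int]
  define k where "k = integral\<^sup>L L (\<lambda>\<theta>. exp (- \<theta>))"
  have k: "k \<ge> 0" unfolding k_def by (intro integral_nonneg_AE) auto
  show ?thesis
  proof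
    show "0 \<le> \<eta> * (C * M * k)" using \<eta> C M k by simp
    show "norm (T_eta \<eta> T t x) \<le> \<eta> * (C * M * k) * norm x" if "t \<in> {0..a}" for t x
    proof -
      have "norm (banach_integral L (G t x)) \<le> integral\<^sup>L L (\<lambda>\<theta>. C * M * norm x * exp (- \<theta>))"
        by (rule norm_banach_integral_le[OF int[OF that] dom AE_bound[OF that]])
      also have "\<dots> = C * M * norm x * k" unfolding k_def by simp
      finally show ?thesis unfolding T_eta using \<eta> by (simp add: mult_ac mult_left_mono)
    qed
    show "linear (T_eta \<eta> T t)" if t: "t \<in> {0..a}" for t
    proof (rule linearI)
      fix x y
      have "has_banach_integral L (\<lambda>\<theta>. G t x \<theta> + G t y \<theta>) (banach_integral L (G t x) + banach_integral L (G t y))"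
        using has_banach_integral_add_scaleR[OF has_int[OF t] has_int[OF t], where c = 1] by simp
      also have "(\<lambda>\<theta>. G t x \<theta> + G t y \<theta>) = G t (x + y)"
        by (simp add: G_def fun_eq_iff blinfun.add_right scaleR_add_right)
      finally show "T_eta \<eta> T t (x + y) = T_eta \<eta> T t x + T_eta \<eta> T t y"
        unfolding T_eta by (simp add: banach_integral_eqI scaleR_add_right)
    next
      fix c :: real and x
      have "has_banach_integral L (\<lambda>\<theta>. c *\<^sub>R G t x \<theta>) (c *\<^sub>R banach_integral L (G t x))"
        using has_banach_integral_add_scaleR[OF has_int[OF t, of x] has_int[OF t, of x], where c = "c - 1"] by (simp add: scaleR_diff_left)
      also have "(\<lambda>\<theta>. c *\<^sub>R G t x \<theta>) = G t (c *\<^sub>R x)"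
        by (simp add: G_def fun_eq_iff blinfun.scaleR_right)
      finally show "T_eta \<eta> T t (c *\<^sub>R x) = c *\<^sub>R T_eta \<eta> T t x"
        unfolding T_eta by (simp add: banach_integral_eqI)
    qed
    show "continuous_on {0..a} (\<lambda>t. T_eta \<eta> T t x)" for x
      unfolding continuous_on_sequentially
    proof (intro allI ballI impI, elim conjE)
      fix X t assume t: "t \<in> {0..a}" and X: "\<forall>n. X n \<in> {0..a}" "X \<longlonglongrightarrow> t"
      have lim: "(\<lambda>n. G (X n) x \<theta>) \<longlonglongrightarrow> G t x \<theta>" if "\<theta> > 0" for \<theta>
      proof -
        have "continuous_on {0..a} (\<lambda>t. blinfun_apply (T (t powr \<eta> * \<theta>)) x)"
        proof (rule continuous_on_compose2[OF cont])
          show "continuous_on {0..a} (\<lambda>t. t powr \<eta> * \<theta>)"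
            using \<eta> by (intro continuous_intros continuous_on_powr') auto
        qed (use that in auto)
        then have "(\<lambda>n. blinfun_apply (T (X n powr \<eta> * \<theta>)) x) \<longlonglongrightarrow> blinfun_apply (T (t powr \<eta> * \<theta>)) x"
          using t X unfolding continuous_on_sequentially comp_def by blast
        then show ?thesis unfolding G_def by (rule tendsto_scaleR[OF tendsto_const])
      qed
      have "(\<lambda>n. banach_integral L (G (X n) x)) \<longlonglongrightarrow> banach_integral L (G t x)"
      proof (rule banach_integral_dominated_convergence[OF meas dom])
        show "AE \<theta> in L. norm (G (X n) x \<theta>) \<le> C * M * norm x * exp (- \<theta>)" for n
          using AE_bound X by blast
        show "AE \<theta> in L. (\<lambda>n. G (X n) x \<theta>) \<longlonglongrightarrow> G t x \<theta>"
          using lim by (intro AE_I2) (auto simp: L_def)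
      qed
      then show "((\<lambda>t. T_eta \<eta> T t x) \<circ> X) \<longlonglongrightarrow> T_eta \<eta> T t x"
        unfolding T_eta comp_def by (intro tendsto_intros)
    qed
  qed
qed

section \<open>Weakly singular convolutions\<close>

lemma has_integral_nonneg_lebesgue_on:
  fixes f :: "real \<Rightarrow> real"
  assumes "(f has_integral i) S" "\<And>x. x \<in> S \<Longrightarrow> 0 \<le> f x" "S \<in> sets lebesgue"
  shows "integrable (lebesgue_on S) f" "integral\<^sup>L (lebesgue_on S) f = i"
proof -
  have "f absolutely_integrable_on S"
    using assms by (intro nonnegative_absolutely_integrable_1) auto
  then show int: "integrable (lebesgue_on S) f"
    using assms(3) by (rule absolutely_integrable_imp_integrable)
  show "integral\<^sup>L (lebesgue_on S) f = i"
    using lebesgue_integral_eq_integral[OF int assms(3)] assms(1) by (simp add: integral_unique)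
qed

text \<open>The integrand of Euler's Beta integral transplanted to [c, t] and continued by 0, so
  that it can be integrated over a fixed interval [c, d] while t varies.\<close>

definition beta_kernel :: "real \<Rightarrow> real \<Rightarrow> real \<Rightarrow> real \<Rightarrow> real \<Rightarrow> real" where
  "beta_kernel \<alpha> \<beta> c t s = (if s < t then (t - s) powr (\<alpha> - 1) * (s - c) powr (\<beta> - 1) else 0)"

lemma beta_kernel_nonneg: "0 \<le> beta_kernel \<alpha> \<beta> c t s"
  by (simp add: beta_kernel_def)

lemma beta_kernel_has_integral:
  assumes ab: "\<alpha> > 0" "\<beta> > 0" and ct: "c < t" "t \<le> d"
  shows "(beta_kernel \<alpha> \<beta> c t has_integral Beta \<beta> \<alpha> * (t - c) powr (\<alpha> + \<beta> - 1)) {c..d}"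
proof -
  \<comment> \<open>The affine substitution u = m (s - c) maps [c, t] onto [0, 1]; homogeneity
    produces the power of t - c.\<close>
  define m where "m = 1 / (t - c)"
  have m: "m > 0" using ct by (simp add: m_def)
  have "((\<lambda>u. u powr (\<beta> - 1) * (1 - u) powr (\<alpha> - 1)) has_integral Beta \<beta> \<alpha>) (cbox 0 1)"
    using has_integral_Beta_real[OF ab(2,1)] by simp
  from has_integral_affinity[OF this, of m "- (m * c)"] m
  have "((\<lambda>s. (m * s - m * c) powr (\<beta> - 1) * (1 - (m * s - m * c)) powr (\<alpha> - 1)) has_integral (1 / m) * Beta \<beta> \<alpha>)
      ((\<lambda>x. x / m + c) ` {0..1})"
    by simp
  also have "(\<lambda>x. x / m + c) ` {0..1} = {c..t}"
  proof safe
    fix x assume x: "x \<in> {c..t}"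
    show "x \<in> (\<lambda>x. x / m + c) ` {0..1}"
      by (rule image_eqI[of _ _ "(x - c) * m"]) (use x ct in \<open>auto simp: m_def field_simps\<close>)
  next
    fix x :: real assume x: "x \<in> {0..1}"
    have "x * (t - c) \<le> 1 * (t - c)"
      using x ct by (intro mult_right_mono) auto
    then have "x * (t - c) \<le> t - c" by (simp only: mult_1)
    then have "x * (t - c) + c \<le> t" by (simp only: le_diff_eq)
    then show "x / m + c \<in> {c..t}"
      using x ct by (simp add: m_def)
  qed
  finally have "((\<lambda>s. (t - c) powr (\<alpha> + \<beta> - 2) * ((m * s - m * c) powr (\<beta> - 1) * (1 - (m * s - m * c)) powr (\<alpha> - 1)))
      has_integral (t - c) powr (\<alpha> + \<beta> - 2) * ((1 / m) * Beta \<beta> \<alpha>)) {c..t}"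
    by (rule has_integral_mult_right)
  moreover have "(t - c) powr (\<alpha> + \<beta> - 2) * ((1 / m) * Beta \<beta> \<alpha>) = Beta \<beta> \<alpha> * (t - c) powr (\<alpha> + \<beta> - 1)"
  proof -
    have "(t - c) powr (\<alpha> + \<beta> - 1) = (t - c) powr (\<alpha> + \<beta> - 2) * (t - c) powr 1"
      by (subst powr_add[symmetric]) simp
    then show ?thesis using ct by (simp add: m_def)
  qed
  moreover have "(t - c) powr (\<alpha> + \<beta> - 2) * ((m * s - m * c) powr (\<beta> - 1) * (1 - (m * s - m * c)) powr (\<alpha> - 1))
      = beta_kernel \<alpha> \<beta> c t s" if s: "s \<in> {c..t} - {t}" for s
  proof -
    have "m * s - m * c = (s - c) / (t - c)"
      by (simp add: m_def diff_divide_distrib)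
    moreover have "1 - (s - c) / (t - c) = (t - s) / (t - c)"
      using ct by (simp add: divide_simps)
    ultimately have "(m * s - m * c) powr (\<beta> - 1) * (1 - (m * s - m * c)) powr (\<alpha> - 1)
        = (s - c) powr (\<beta> - 1) * (t - s) powr (\<alpha> - 1) / ((t - c) powr (\<beta> - 1) * (t - c) powr (\<alpha> - 1))"
      using s ct by (simp add: powr_divide)
    also have "(t - c) powr (\<beta> - 1) * (t - c) powr (\<alpha> - 1) = (t - c) powr (\<alpha> + \<beta> - 2)"
      by (simp add: add_ac flip: powr_add)
    finally show ?thesis using s ct by (simp add: beta_kernel_def)
  qed
  ultimately have "(beta_kernel \<alpha> \<beta> c t has_integral Beta \<beta> \<alpha> * (t - c) powr (\<alpha> + \<beta> - 1)) {c..t}"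
    by (subst has_integral_spike_eq[of "{t}"]) auto
  then have "((\<lambda>s. if s \<in> {c..t} then beta_kernel \<alpha> \<beta> c t s else 0) has_integral Beta \<beta> \<alpha> * (t - c) powr (\<alpha> + \<beta> - 1)) {c..d}"
    using ct by (subst has_integral_restrict) auto
  then show ?thesis
    by (rule has_integral_eq[rotated]) (auto simp: beta_kernel_def)
qed

lemma beta_kernel_integral:
  assumes "\<alpha> > 0" "\<beta> > 0" "c < t" "t \<le> d"
  shows "integrable (lebesgue_on {c..d}) (beta_kernel \<alpha> \<beta> c t)"
    "integral\<^sup>L (lebesgue_on {c..d}) (beta_kernel \<alpha> \<beta> c t) = Beta \<beta> \<alpha> * (t - c) powr (\<alpha> + \<beta> - 1)"
  using has_integral_nonneg_lebesgue_on[OF beta_kernel_has_integral[OF assms] beta_kernel_nonneg] by auto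

lemma beta_kernel_tendsto:
  assumes X: "X \<longlonglongrightarrow> t" and s: "s \<noteq> t"
  shows "(\<lambda>n. beta_kernel x y c (X n) s) \<longlonglongrightarrow> beta_kernel x y c t s"
proof (cases "s < t")
  case True
  have "(\<lambda>n. (X n - s) powr (x - 1) * (s - c) powr (y - 1)) \<longlonglongrightarrow> (t - s) powr (x - 1) * (s - c) powr (y - 1)"
    using X True by (intro tendsto_intros) auto
  moreover have "\<forall>\<^sub>F n in sequentially. s < X n"
    using X True by (rule order_tendstoD)
  then have "\<forall>\<^sub>F n in sequentially. (X n - s) powr (x - 1) * (s - c) powr (y - 1) = beta_kernel x y c (X n) s"
    by eventually_elim (simp add: beta_kernel_def)
  ultimately have "(\<lambda>n. beta_kernel x y c (X n) s) \<longlonglongrightarrow> (t - s) powr (x - 1) * (s - c) powr (y - 1)"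
    by (rule Lim_transform_eventually)
  then show ?thesis using True by (simp add: beta_kernel_def)
next
  case False
  then have "\<forall>\<^sub>F n in sequentially. X n < s"
    using X s by (intro order_tendstoD(2)) auto
  then have "\<forall>\<^sub>F n in sequentially. beta_kernel x y c (X n) s = beta_kernel x y c t s"
    by eventually_elim (use False in \<open>simp add: beta_kernel_def\<close>)
  then show ?thesis by (rule tendsto_eventually)
qed

lemma AE_lebesgue_on_neq: "AE s in lebesgue_on S. s \<noteq> (x::real)" if "S \<in> sets lebesgue"
proof -
  have "AE s in lebesgue. s \<noteq> x" by (rule AE_completion[OF AE_lborel_singleton])
  then show ?thesis using that by (subst AE_restrict_space_iff) (auto elim: eventually_mono)
qed

text \<open>Takes the place of Hoelder's inequality: kernel times forcing is bounded by two summands that are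
  integrable separately.\<close>

lemma mult_le_powr_add_powr:
  fixes x y q :: real
  assumes "x \<ge> 0" "y \<ge> 0" "q > 1"
  shows "x * y \<le> x powr (q / (q - 1)) + y powr q"
proof (cases "x = 0 \<or> y = 0")
  case False
  then have xy: "x > 0" "y > 0" using assms by auto
  show ?thesis
  proof (cases "x \<le> y powr (q - 1)")
    case True
    then have "x * y \<le> y powr (q - 1) * y powr 1" using xy by (simp add: mult_right_mono)
    also have "\<dots> = y powr q" by (subst powr_add[symmetric]) simp
    finally show ?thesis by (simp add: add_increasing)
  next
    case False
    then have "(y powr (q - 1)) powr (1 / (q - 1)) \<le> x powr (1 / (q - 1))"
      using assms by (intro powr_mono2) auto
    then have "y \<le> x powr (1 / (q - 1))" using assms xy by (simp add: powr_powr)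
    then have "x * y \<le> x powr 1 * x powr (1 / (q - 1))" using xy by (simp add: mult_left_mono)
    also have "\<dots> = x powr (q / (q - 1))"
      by (subst powr_add[symmetric]) (use assms in \<open>simp add: field_simps\<close>)
    finally show ?thesis by (simp add: add_increasing2)
  qed
qed auto

text \<open>One interval (c, d] of the problem. S stands for \<open>T_eta\<close>, of which only
  linearity, a uniform bound and strong continuity are kept.\<close>

locale weakly_singular =
  fixes S :: "real \<Rightarrow> 'z::banach \<Rightarrow> 'z" and \<eta> K c d q :: real
  assumes \<eta>: "0 < \<eta>" "\<eta> < 1" and cd: "c < d" and q: "1 / \<eta> < q" and K: "0 \<le> K"
    and lin: "\<And>t. t \<in> {0..d - c} \<Longrightarrow> linear (S t)"
    and bd: "\<And>t x. t \<in> {0..d - c} \<Longrightarrow> norm (S t x) \<le> K * norm x"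
    and cont: "\<And>x. continuous_on {0..d - c} (\<lambda>t. S t x)"
begin

abbreviation leb :: "real measure" where
  "leb \<equiv> lebesgue_on {c..d}"

definition integrand :: "(real \<Rightarrow> 'z) \<Rightarrow> real \<Rightarrow> real \<Rightarrow> 'z" where
  "integrand f t s = (t - s) powr (\<eta> - 1) *\<^sub>R S (t - s) (f s)"

definition conv :: "(real \<Rightarrow> 'z) \<Rightarrow> real \<Rightarrow> 'z" where
  "conv f t = banach_integral (lebesgue_on {c..t}) (integrand f t)"

text \<open>In the bound, g accounts for the control and the nonlinearity, and the power of s - c
  for the memory term.\<close>

definition admissible :: "(real \<Rightarrow> 'z) \<Rightarrow> bool" where
  "admissible f \<longleftrightarrow> strongly_measurable leb f \<and>
     (\<exists>g C. (\<forall>s. 0 \<le> g s) \<and> 0 \<le> C \<and> g \<in> borel_measurable leb \<and>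
        integrable leb (\<lambda>s. g s powr q) \<and>
        (AE s in leb. norm (f s) \<le> g s + C * (s - c) powr (- \<eta>)))"

text \<open>Here the domain of integration no longer depends on \<open>t\<close>, so that convergence theorems apply.\<close>

definition cut_integrand :: "(real \<Rightarrow> 'z) \<Rightarrow> real \<Rightarrow> real \<Rightarrow> 'z" where
  "cut_integrand f t s = (if s < t then (t - s) powr (\<eta> - 1) else 0) *\<^sub>R S (max 0 (t - s)) (f s)"

lemma q_gt_1: "q > 1"
proof -
  have "1 < 1 / \<eta>" using \<eta> by simp
  with q show ?thesis by linarith
qed

text \<open>Chosen so that the kernel (t - s)^(eta - 1), raised to the conjugate exponent q / (q -
  1), is (t - s)^(alpha - 1). Its integrability, alpha > 0, is where q > 1 / eta enters.\<close>

definition \<alpha> :: real where "\<alpha> = (\<eta> - 1) * (q / (q - 1)) + 1"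

lemma \<alpha>_pos: "\<alpha> > 0"
proof -
  have "1 < \<eta> * q" using q \<eta> by (simp add: field_simps)
  then show ?thesis unfolding \<alpha>_def using q_gt_1 by (simp add: field_simps)
qed

text \<open>The first two terms come from \<open>mult_le_powr_add_powr\<close> applied to the kernel
  and g. The third is the singular part; its exponents add up to 1, so its integral does not depend
  on t.\<close>

definition dominator :: "(real \<Rightarrow> real) \<Rightarrow> real \<Rightarrow> real \<Rightarrow> real \<Rightarrow> real" where
  "dominator g C t s = K * (beta_kernel \<alpha> 1 c t s + g s powr q + C * beta_kernel \<eta> (1 - \<eta>) c t s)"

text \<open>The maximum with 0 in \<open>cut_integrand\<close> keeps the argument of S in {0..d - c}
  for all s in {c..d}, as \<open>strongly_measurable_operator\<close> requires.\<close>

lemma cut_integrand_measurable: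
  assumes f: "strongly_measurable leb f" and t: "t \<in> {c..d}"
  shows "strongly_measurable leb (cut_integrand f t)"
  unfolding cut_integrand_def
proof (rule strongly_measurable_scaleR)
  have "(\<lambda>s. if s < t then (t - s) powr (\<eta> - 1) else 0) \<in> borel_measurable borel" by measurable
  then have "(\<lambda>s. if s < t then (t - s) powr (\<eta> - 1) else 0) \<in> borel_measurable lebesgue"
    by (simp add: measurable_completion)
  then show "(\<lambda>s. if s < t then (t - s) powr (\<eta> - 1) else 0) \<in> borel_measurable leb"
    by (rule measurable_restrict_space1)
  show "strongly_measurable leb (\<lambda>s. S (max 0 (t - s)) (f s))"
  proof (rule strongly_measurable_operator[OF f])
    show "strongly_measurable leb (\<lambda>s. S (max 0 (t - s)) y)" for y
      by (intro strongly_measurable_continuous_on continuous_on_compose2[OF cont] continuous_intros)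
         (use t cd in auto)
  qed (use t in \<open>auto intro!: lin bd\<close>)
qed

lemma cut_integrand_bound:
  assumes t: "t \<in> {c..d}" and s: "s \<in> {c..d}" "s \<noteq> c"
    and g: "0 \<le> g s" and C: "0 \<le> C" and f: "norm (f s) \<le> g s + C * (s - c) powr (- \<eta>)"
  shows "norm (cut_integrand f t s) \<le> dominator g C t s"
proof (cases "s < t")
  case True
  let ?k = "(t - s) powr (\<eta> - 1)"
  have "norm (cut_integrand f t s) = ?k * norm (S (t - s) (f s))"
    using True by (simp add: cut_integrand_def)
  also have "\<dots> \<le> ?k * (K * norm (f s))"
    using bd[of "t - s" "f s"] t s True by (intro mult_left_mono) auto
  also have "\<dots> \<le> ?k * (K * (g s + C * (s - c) powr (- \<eta>)))"
    using f K by (intro mult_left_mono) auto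
  also have "\<dots> = K * (?k * g s + C * (?k * (s - c) powr (- \<eta>)))"
    by (simp add: algebra_simps)
  also have "\<dots> \<le> K * ((?k powr (q / (q - 1)) + g s powr q) + C * (?k * (s - c) powr (- \<eta>)))"
    using mult_le_powr_add_powr[of ?k "g s" q] g q_gt_1 K by (intro mult_left_mono add_right_mono) auto
  also have "?k powr (q / (q - 1)) = beta_kernel \<alpha> 1 c t s"
    using s True by (simp add: beta_kernel_def \<alpha>_def powr_powr)
  also have "?k * (s - c) powr (- \<eta>) = beta_kernel \<eta> (1 - \<eta>) c t s"
    using s True by (simp add: beta_kernel_def)
  finally show ?thesis by (simp add: dominator_def)
next
  case False
  then show ?thesis using K by (simp add: cut_integrand_def dominator_def beta_kernel_def)
qed

lemma dominator_integral:
  assumes t: "t \<in> {c<..d}" and g: "integrable leb (\<lambda>s. g s powr q)"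
  shows "integrable leb (dominator g C t)"
    "integral\<^sup>L leb (dominator g C t) =
       K * (Beta 1 \<alpha> * (t - c) powr \<alpha> + integral\<^sup>L leb (\<lambda>s. g s powr q) + C * Beta (1 - \<eta>) \<eta>)"
proof -
  note k1 = beta_kernel_integral[of \<alpha> 1 c t d, OF \<alpha>_pos]
  note k2 = beta_kernel_integral[of \<eta> "1 - \<eta>" c t d]
  show "integrable leb (dominator g C t)"
    "integral\<^sup>L leb (dominator g C t) =
       K * (Beta 1 \<alpha> * (t - c) powr \<alpha> + integral\<^sup>L leb (\<lambda>s. g s powr q) + C * Beta (1 - \<eta>) \<eta>)"
    unfolding dominator_def[abs_def] using k1 k2 t g \<eta> by auto
qed

lemma admissible_dominated:
  assumes "admissible f"
  obtains g C where "integrable leb (\<lambda>s. g s powr q)" "0 \<le> C"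
    "\<And>t. t \<in> {c..d} \<Longrightarrow> AE s in leb. norm (cut_integrand f t s) \<le> dominator g C t s"
proof -
  from assms obtain g C where g: "\<And>s. 0 \<le> g s" "0 \<le> C"
    "integrable leb (\<lambda>s. g s powr q)"
    "AE s in leb. norm (f s) \<le> g s + C * (s - c) powr (- \<eta>)"
    unfolding admissible_def by blast
  have "AE s in leb. norm (cut_integrand f t s) \<le> dominator g C t s" if "t \<in> {c..d}" for t
    using g(4) AE_lebesgue_on_neq[of "{c..d}" c, simplified] AE_space
    by eventually_elim (use g(1,2) that in \<open>auto intro!: cut_integrand_bound\<close>)
  with g(2,3) show ?thesis using that by blast
qed

lemma conv_eq:
  assumes f: "admissible f" and t: "t \<in> {c<..d}"
  shows "banach_integrable (lebesgue_on {c..t}) (integrand f t)"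
    "banach_integrable leb (cut_integrand f t)"
    "conv f t = banach_integral leb (cut_integrand f t)"
proof -
  obtain g C where g: "integrable leb (\<lambda>s. g s powr q)" "0 \<le> C"
    "\<And>t. t \<in> {c..d} \<Longrightarrow> AE s in leb. norm (cut_integrand f t s) \<le> dominator g C t s"
    by (rule admissible_dominated[OF f]) blast
  have t': "t \<in> {c..d}" using t by auto
  have sf: "strongly_measurable leb f" using f unfolding admissible_def by blast
  note dom = cut_integrand_measurable[OF sf t'] dominator_integral(1)[OF t g(1)] g(3)[OF t']
  show "banach_integrable leb (cut_integrand f t)"
    by (rule banach_integrableI_bound[OF dom])
  have sub: "lebesgue_on {c..t} = restrict_space leb {c..t}"
    using t by (subst restrict_restrict_space) (auto simp: Int_absorb1)
  have meas: "{c..t} \<in> sets leb"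
    using t by (auto simp: sets_restrict_space_iff)
  have int_r: "banach_integrable (lebesgue_on {c..t}) (cut_integrand f t)"
    unfolding sub by (rule banach_integrable_restrict[OF dom meas])
  \<comment> \<open>At s = t both sides vanish, because \<open>0 powr x\<close> is 0.\<close>
  have eq: "integrand f t s = cut_integrand f t s" if "s \<in> space (lebesgue_on {c..t})" for s
    using that by (cases "s = t") (auto simp: integrand_def cut_integrand_def)
  show "banach_integrable (lebesgue_on {c..t}) (integrand f t)"
    using int_r banach_integral_cong(2)[of "lebesgue_on {c..t}", OF eq] by simp
  have "conv f t = banach_integral (lebesgue_on {c..t}) (cut_integrand f t)"
    unfolding conv_def by (rule banach_integral_cong(1)[OF eq])
  also have "\<dots> = banach_integral leb (\<lambda>s. indicator {c..t} s *\<^sub>R cut_integrand f t s)"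
    unfolding sub by (rule banach_integral_restrict(2)[OF sets.Int[OF meas sets.top] int_r[unfolded sub]])
  also have "\<dots> = banach_integral leb (cut_integrand f t)"
    by (rule banach_integral_cong(1)) (auto simp: indicator_def cut_integrand_def)
  finally show "conv f t = banach_integral leb (cut_integrand f t)" .
qed

text \<open>Multiplied by the weight (t - c)^(1 - eta), a bounded convolution tends to 0 at c. This
  is what puts solutions into \<open>C_weighted\<close>.\<close>

lemma conv_bounded:
  assumes f: "admissible f"
  obtains W where "\<And>t. t \<in> {c<..d} \<Longrightarrow> norm (conv f t) \<le> W"
proof -
  obtain g C where g: "integrable leb (\<lambda>s. g s powr q)" "0 \<le> C"
    "\<And>t. t \<in> {c..d} \<Longrightarrow> AE s in leb. norm (cut_integrand f t s) \<le> dominator g C t s"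
    by (rule admissible_dominated[OF f]) blast
  show ?thesis
  proof
    fix t assume t: "t \<in> {c<..d}"
    have "norm (conv f t) \<le> integral\<^sup>L leb (dominator g C t)"
      unfolding conv_eq(3)[OF f t]
      using t by (intro norm_banach_integral_le conv_eq[OF f t] dominator_integral g) auto
    also have "\<dots> \<le> K * (Beta 1 \<alpha> * (d - c) powr \<alpha> + integral\<^sup>L leb (\<lambda>s. g s powr q) + C * Beta (1 - \<eta>) \<eta>)"
      unfolding dominator_integral(2)[OF t g(1)]
      using K t \<alpha>_pos by (intro mult_left_mono add_right_mono powr_mono2) (auto simp: Beta_def Gamma_real_pos less_imp_le)
    finally show "norm (conv f t) \<le> \<dots>" .
  qed
qed

lemma cut_integrand_tendsto:
  assumes X: "\<And>n. X n \<in> {c..d}" "X \<longlonglongrightarrow> t" and t: "t \<in> {c..d}" and s: "s \<in> {c..d}" "s \<noteq> t"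
  shows "(\<lambda>n. cut_integrand f (X n) s) \<longlonglongrightarrow> cut_integrand f t s"
proof (cases "s < t")
  case True
  have "(\<lambda>n. (X n - s) powr (\<eta> - 1)) \<longlonglongrightarrow> (t - s) powr (\<eta> - 1)"
    using X True by (intro tendsto_intros) auto
  moreover have "\<forall>\<^sub>F n in sequentially. s < X n"
    using X(2) True by (rule order_tendstoD)
  then have "\<forall>\<^sub>F n in sequentially. (X n - s) powr (\<eta> - 1) = (if s < X n then (X n - s) powr (\<eta> - 1) else 0)"
    by eventually_elim simp
  ultimately have 1: "(\<lambda>n. if s < X n then (X n - s) powr (\<eta> - 1) else 0) \<longlonglongrightarrow> (t - s) powr (\<eta> - 1)"
    by (rule Lim_transform_eventually)
  have "continuous_on {c..d} (\<lambda>t. S (max 0 (t - s)) (f s))"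
    by (intro continuous_on_compose2[OF cont] continuous_intros) (use s cd in auto)
  then have "(\<lambda>n. S (max 0 (X n - s)) (f s)) \<longlonglongrightarrow> S (max 0 (t - s)) (f s)"
    using X t unfolding continuous_on_sequentially comp_def by blast
  from tendsto_scaleR[OF 1 this] show ?thesis
    using True by (simp add: cut_integrand_def)
next
  case False
  then have "\<forall>\<^sub>F n in sequentially. X n < s"
    using X(2) s by (intro order_tendstoD(2)) auto
  then have "\<forall>\<^sub>F n in sequentially. cut_integrand f (X n) s = cut_integrand f t s"
    by eventually_elim (use False in \<open>simp add: cut_integrand_def\<close>)
  then show ?thesis by (rule tendsto_eventually)
qed

text \<open>The integrals of the dominators are known explicitly and depend continuously on t, which
  is the extra condition for dominated convergence with a moving bound.\<close>

lemma conv_continuous: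
  assumes f: "admissible f"
  shows "continuous_on {c<..d} (conv f)"
  unfolding continuous_on_sequentially
proof (intro allI ballI impI, elim conjE)
  fix X t assume t: "t \<in> {c<..d}" and X: "\<forall>n. X n \<in> {c<..d}" "X \<longlonglongrightarrow> t"
  obtain g C where g: "integrable leb (\<lambda>s. g s powr q)" "0 \<le> C"
    "\<And>t. t \<in> {c..d} \<Longrightarrow> AE s in leb. norm (cut_integrand f t s) \<le> dominator g C t s"
    by (rule admissible_dominated[OF f]) blast
  have sf: "strongly_measurable leb f" using f unfolding admissible_def by blast
  have X': "X n \<in> {c..d}" "X n \<in> {c<..d}" for n using X(1) by (auto simp: less_imp_le)
  have t': "t \<in> {c..d}" using t by auto
  have "(\<lambda>n. banach_integral leb (cut_integrand f (X n)))
      \<longlonglongrightarrow> banach_integral leb (cut_integrand f t)"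
  proof (rule banach_integral_tendsto_varying_bound)
    show "strongly_measurable leb (cut_integrand f (X n))" for n
      by (rule cut_integrand_measurable[OF sf X'(1)])
    show "integrable leb (dominator g C (X n))" for n
      by (rule dominator_integral(1)[OF X'(2) g(1)])
    show "integrable leb (dominator g C t)"
      by (rule dominator_integral(1)[OF t g(1)])
    show "AE s in leb. norm (cut_integrand f (X n) s) \<le> dominator g C (X n) s" for n
      by (rule g(3)[OF X'(1)])
    show "AE s in leb. (\<lambda>n. cut_integrand f (X n) s) \<longlonglongrightarrow> cut_integrand f t s"
      using AE_lebesgue_on_neq[of "{c..d}" t, simplified] AE_space
      by eventually_elim (rule cut_integrand_tendsto[OF X'(1) X(2) t'], auto)
    show "AE s in leb. (\<lambda>n. dominator g C (X n) s) \<longlonglongrightarrow> dominator g C t s"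
      using AE_lebesgue_on_neq[of "{c..d}" t, simplified]
      unfolding dominator_def
      by eventually_elim (intro tendsto_mult tendsto_add tendsto_const beta_kernel_tendsto[OF X(2)])
    show "(\<lambda>n. integral\<^sup>L leb (dominator g C (X n)))
        \<longlonglongrightarrow> integral\<^sup>L leb (dominator g C t)"
      unfolding dominator_integral(2)[OF X'(2) g(1)] dominator_integral(2)[OF t g(1)]
      using X(2) t by (intro tendsto_intros) auto
  qed
  then show "(conv f \<circ> X) \<longlonglongrightarrow> conv f t"
    unfolding comp_def conv_eq(3)[OF f X'(2)] conv_eq(3)[OF f t] .
qed

section \<open>The class of admissible forcings\<close>

lemma admissible_Lq:
  assumes "f \<in> Lq_space q {c..d}"
  shows "admissible f"
proof -
  have sf: "strongly_measurable leb f"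
    and fin: "(\<integral>\<^sup>+x. ennreal (norm (f x) powr q) \<partial>leb) < \<infinity>"
    using assms unfolding Lq_space_def by auto
  obtain g where g[measurable]: "g \<in> borel_measurable leb"
    and fg: "AE x in leb. norm (f x) = g x" and g0: "\<And>x. 0 \<le> g x"
    by (rule strongly_measurable_norm[OF sf]) blast
  have "(\<integral>\<^sup>+x. ennreal (g x powr q) \<partial>leb) = (\<integral>\<^sup>+x. ennreal (norm (f x) powr q) \<partial>leb)"
    by (rule nn_integral_cong_AE) (use fg in \<open>eventually_elim, simp\<close>)
  with fin have "integrable leb (\<lambda>x. g x powr q)"
    by (intro integrableI_nonneg) auto
  moreover have "AE s in leb. norm (f s) \<le> g s + 0 * (s - c) powr (- \<eta>)"
    using fg by eventually_elim simp
  ultimately show ?thesis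
    unfolding admissible_def using sf g g0 by (intro conjI exI[of _ g] exI[of _ "0::real"]) auto
qed

lemma admissible_singular:
  assumes "continuous_on {c<..d} f" and "\<And>s. s \<in> {c<..d} \<Longrightarrow> norm (f s) \<le> C * (s - c) powr (- \<eta>)" "0 \<le> C"
  shows "admissible f"
proof -
  have "strongly_measurable leb f"
    by (rule strongly_measurable_Ioc[OF assms(1)])
  moreover have "AE s in leb. norm (f s) \<le> 0 + C * (s - c) powr (- \<eta>)"
    using AE_lebesgue_on_neq[of "{c..d}" c, simplified] AE_space
    by eventually_elim (use assms(2) in auto)
  ultimately show ?thesis
    unfolding admissible_def using assms(3) q_gt_1 by (intro conjI exI[of _ "\<lambda>_. 0"] exI[of _ C]) auto
qed

lemma admissible_add:
  assumes "admissible f1" "admissible f2"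
  shows "admissible (\<lambda>s. f1 s + f2 s)"
proof -
  let ?M = "leb"
  from assms(1) obtain g1 C1 where 1: "strongly_measurable ?M f1" "\<And>s. 0 \<le> g1 s" "0 \<le> C1" "g1 \<in> borel_measurable ?M"
    "integrable ?M (\<lambda>s. g1 s powr q)" "AE s in ?M. norm (f1 s) \<le> g1 s + C1 * (s - c) powr (- \<eta>)"
    unfolding admissible_def by blast
  from assms(2) obtain g2 C2 where 2: "strongly_measurable ?M f2" "\<And>s. 0 \<le> g2 s" "0 \<le> C2" "g2 \<in> borel_measurable ?M"
    "integrable ?M (\<lambda>s. g2 s powr q)" "AE s in ?M. norm (f2 s) \<le> g2 s + C2 * (s - c) powr (- \<eta>)"
    unfolding admissible_def by blast
  note [measurable] = 1(4) 2(4)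
  have "integrable ?M (\<lambda>s. (g1 s + g2 s) powr q)"
  proof (rule Bochner_Integration.integrable_bound)
    show "integrable ?M (\<lambda>s. 2 powr q * (g1 s powr q + g2 s powr q))"
      using 1(5) 2(5) by simp
    show "(\<lambda>s. (g1 s + g2 s) powr q) \<in> borel_measurable ?M" by measurable
    have "norm ((g1 s + g2 s) powr q) \<le> norm (2 powr q * (g1 s powr q + g2 s powr q))" for s
    proof -
      have "(g1 s + g2 s) powr q \<le> (2 * max (g1 s) (g2 s)) powr q"
        using 1(2)[of s] 2(2)[of s] q_gt_1 by (intro powr_mono2) auto
      also have "\<dots> = 2 powr q * max (g1 s) (g2 s) powr q"
        using 1(2)[of s] 2(2)[of s] by (subst powr_mult) auto
      also have "\<dots> \<le> 2 powr q * (g1 s powr q + g2 s powr q)"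
        by (intro mult_left_mono) (auto simp: max_def)
      finally show ?thesis by simp
    qed
    then show "AE s in ?M. norm ((g1 s + g2 s) powr q) \<le> norm (2 powr q * (g1 s powr q + g2 s powr q))"
      by simp
  qed
  moreover have "AE s in ?M. norm (f1 s + f2 s) \<le> (g1 s + g2 s) + (C1 + C2) * (s - c) powr (- \<eta>)"
    using 1(6) 2(6)
  proof eventually_elim
    case (elim s)
    then show ?case using norm_triangle_ineq[of "f1 s" "f2 s"] by (simp add: algebra_simps)
  qed
  ultimately show ?thesis
    unfolding admissible_def using 1 2 strongly_measurable_add[OF 1(1) 2(1)]
    by (intro conjI exI[of _ "\<lambda>s. g1 s + g2 s"] exI[of _ "C1 + C2"]) auto
qed

end

section \<open>Volterra equations with weakly singular kernel\<close>

lemma exp_minus_le_powr: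
  fixes x e :: real
  assumes "0 < x" "0 < e" "e < 1"
  shows "exp (- x) \<le> x powr (- e)"
proof -
  have "e * ln x \<le> x"
  proof (cases "ln x \<le> 0")
    case True
    then show ?thesis using assms by (smt (verit) mult_nonneg_nonpos)
  next
    case False
    then have "e * ln x \<le> 1 * ln x" using assms by (intro mult_right_mono) auto
    also have "\<dots> \<le> x" using ln_le_minus_one[OF assms(1)] by simp
    finally show ?thesis .
  qed
  then show ?thesis using assms by (simp add: powr_def)
qed

context weakly_singular
begin

abbreviation weighted_kernel :: "real \<Rightarrow> real \<Rightarrow> real \<Rightarrow> real" where
  "weighted_kernel l t s \<equiv> beta_kernel \<eta> \<eta> c t s * exp (l * (s - c))"

text \<open>Weighting with \<open>exp (- l (t - c))\<close> (Bielecki's trick) makes the Volterra operator a contraction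
  on the whole interval; \<open>exp (- x) \<le> x powr (- \<eta> / 2)\<close> trades half of the smoothing of the kernel for a
  negative power of \<open>l\<close>.\<close>

lemma bielecki_weight:
  assumes N: "0 \<le> N"
  obtains l where "l > 0"
    "\<And>t. t \<in> {c<..d} \<Longrightarrow> integrable (lebesgue_on {c..t}) (weighted_kernel l t)"
    "\<And>t. t \<in> {c<..d} \<Longrightarrow> N * integral\<^sup>L (lebesgue_on {c..t}) (weighted_kernel l t)
       \<le> 1 / 2 * ((t - c) powr (\<eta> - 1) * exp (l * (t - c)))"
proof -
  \<comment> \<open>Any exponent strictly between 0 and eta would do: (t - s)^(eta - e - 1) must
    stay integrable while \<open>l powr (- e)\<close> becomes small.\<close>
  define e where "e = \<eta> / 2"
  have e: "0 < e" "e < 1" "e < \<eta>" using \<eta> by (auto simp: e_def)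
  define B where "B = Beta \<eta> (\<eta> - e)"
  have B: "B \<ge> 0" unfolding B_def Beta_def using \<eta> e by (simp add: Gamma_real_pos less_imp_le)
  define Q where "Q = N * (B * (d - c) powr (\<eta> - e))"
  have Q: "Q \<ge> 0" using N B by (simp add: Q_def)
  \<comment> \<open>Makes \<open>l powr (- e)\<close> equal to 1 / (2 Q + 1), hence Q times it at
    most 1 / 2; the summand 1 covers Q = 0.\<close>
  define l where "l = (2 * Q + 1) powr (1 / e)"
  have l: "l > 0" using Q by (simp add: l_def)
  have le: "l powr (- e) = 1 / (2 * Q + 1)"
    using Q e by (simp add: l_def powr_powr powr_minus divide_inverse)
  have bound: "weighted_kernel l t s
      \<le> exp (l * (t - c)) * l powr (- e) * beta_kernel (\<eta> - e) \<eta> c t s" for t s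
  proof (cases "s < t")
    case True
    have "exp (l * (s - c)) = exp (l * (t - c)) * exp (- (l * (t - s)))"
      by (simp add: algebra_simps flip: exp_add)
    also have "\<dots> \<le> exp (l * (t - c)) * (l * (t - s)) powr (- e)"
      using l True e by (intro mult_left_mono exp_minus_le_powr) auto
    also have "(l * (t - s)) powr (- e) = l powr (- e) * (t - s) powr (- e)"
      using l True by (simp add: powr_mult)
    finally have "weighted_kernel l t s
        \<le> beta_kernel \<eta> \<eta> c t s * (exp (l * (t - c)) * (l powr (- e) * (t - s) powr (- e)))"
      by (intro mult_left_mono beta_kernel_nonneg)
    also have "\<dots> = exp (l * (t - c)) * l powr (- e) * (((t - s) powr (\<eta> - 1) * (t - s) powr (- e)) * (s - c) powr (\<eta> - 1))"
      using True by (simp add: beta_kernel_def mult_ac)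
    also have "(t - s) powr (\<eta> - 1) * (t - s) powr (- e) = (t - s) powr (\<eta> - e - 1)"
      by (simp add: algebra_simps flip: powr_add)
    finally show ?thesis using True by (simp add: beta_kernel_def)
  qed (simp add: beta_kernel_def)
  have int: "integrable (lebesgue_on {c..t}) (weighted_kernel l t)"
    and le_int: "integral\<^sup>L (lebesgue_on {c..t}) (weighted_kernel l t)
      \<le> exp (l * (t - c)) * l powr (- e) * (B * (t - c) powr (2 * \<eta> - e - 1))" if t: "t \<in> {c<..d}" for t
  proof -
    have k: "integrable (lebesgue_on {c..t}) (beta_kernel (\<eta> - e) \<eta> c t)"
      "integral\<^sup>L (lebesgue_on {c..t}) (beta_kernel (\<eta> - e) \<eta> c t) = B * (t - c) powr (2 * \<eta> - e - 1)"
      using beta_kernel_integral[of "\<eta> - e" \<eta> c t t] \<eta> e t unfolding B_def by (auto simp: algebra_simps)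
    then have k': "integrable (lebesgue_on {c..t}) (\<lambda>s. exp (l * (t - c)) * l powr (- e) * beta_kernel (\<eta> - e) \<eta> c t s)"
      by simp
    show int: "integrable (lebesgue_on {c..t}) (weighted_kernel l t)"
    proof (rule Bochner_Integration.integrable_bound[OF k'])
      have "(\<lambda>s. exp (l * (s - c))) \<in> borel_measurable lebesgue"
        by (simp add: measurable_completion)
      then have "(\<lambda>s. exp (l * (s - c))) \<in> borel_measurable (lebesgue_on {c..t})"
        by (rule measurable_restrict_space1)
      moreover have "beta_kernel \<eta> \<eta> c t \<in> borel_measurable (lebesgue_on {c..t})"
        using beta_kernel_integral[of \<eta> \<eta> c t t] \<eta> t by auto
      ultimately show "(weighted_kernel l t) \<in> borel_measurable (lebesgue_on {c..t})"
        by (rule borel_measurable_times[rotated])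
      show "AE s in lebesgue_on {c..t}. norm (weighted_kernel l t s)
          \<le> norm (exp (l * (t - c)) * l powr (- e) * beta_kernel (\<eta> - e) \<eta> c t s)"
        using bound[of t] by (simp add: abs_mult abs_of_nonneg beta_kernel_nonneg)
    qed
    have "integral\<^sup>L (lebesgue_on {c..t}) (weighted_kernel l t)
        \<le> integral\<^sup>L (lebesgue_on {c..t}) (\<lambda>s. exp (l * (t - c)) * l powr (- e) * beta_kernel (\<eta> - e) \<eta> c t s)"
      using int k' bound by (intro integral_mono)
    then show "integral\<^sup>L (lebesgue_on {c..t}) (weighted_kernel l t)
      \<le> exp (l * (t - c)) * l powr (- e) * (B * (t - c) powr (2 * \<eta> - e - 1))"
      using k by simp
  qed
  have "N * integral\<^sup>L (lebesgue_on {c..t}) (weighted_kernel l t)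
      \<le> 1 / 2 * ((t - c) powr (\<eta> - 1) * exp (l * (t - c)))" if t: "t \<in> {c<..d}" for t
  proof -
    \<comment> \<open>The factor (t - c)^(eta - 1) reproduces the weight; the surplus power is
      bounded over the whole interval.\<close>
    have "(t - c) powr (2 * \<eta> - e - 1) = (t - c) powr (\<eta> - 1) * (t - c) powr (\<eta> - e)"
      by (simp add: algebra_simps flip: powr_add)
    also have "\<dots> \<le> (t - c) powr (\<eta> - 1) * (d - c) powr (\<eta> - e)"
      using t e by (intro mult_left_mono powr_mono2) auto
    finally have "exp (l * (t - c)) * l powr (- e) * (B * (t - c) powr (2 * \<eta> - e - 1))
        \<le> exp (l * (t - c)) * l powr (- e) * (B * ((t - c) powr (\<eta> - 1) * (d - c) powr (\<eta> - e)))"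
      using B by (intro mult_left_mono) auto
    then have "N * integral\<^sup>L (lebesgue_on {c..t}) (weighted_kernel l t)
        \<le> N * (exp (l * (t - c)) * l powr (- e) * (B * ((t - c) powr (\<eta> - 1) * (d - c) powr (\<eta> - e))))"
      by (rule mult_left_mono[OF order_trans[OF le_int[OF t]] N])
    also have "\<dots> = (Q * l powr (- e)) * ((t - c) powr (\<eta> - 1) * exp (l * (t - c)))"
      by (simp add: Q_def mult_ac)
    also have "\<dots> \<le> 1 / 2 * ((t - c) powr (\<eta> - 1) * exp (l * (t - c)))"
      unfolding le using Q by (intro mult_right_mono) (auto simp: divide_simps)
    finally show ?thesis .
  qed
  with l int show ?thesis using that by blast
qed

text \<open>The comparison function (s - c)^(eta - 1) exp (l (s - c)) is the reciprocal of the
  weight, so C bounds the weighted distance of f1 and f2. The estimate serves both uniqueness and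
  the contraction.\<close>

lemma norm_conv_diff_le:
  assumes t: "t \<in> {c<..d}"
    and int: "banach_integrable (lebesgue_on {c..t}) (integrand f1 t)" "banach_integrable (lebesgue_on {c..t}) (integrand f2 t)"
    and k: "integrable (lebesgue_on {c..t}) (weighted_kernel l t)"
    and f: "\<And>s. s \<in> {c<..t} \<Longrightarrow> norm (f1 s - f2 s) \<le> C * ((s - c) powr (\<eta> - 1) * exp (l * (s - c)))"
    and C: "0 \<le> C"
  shows "norm (conv f1 t - conv f2 t) \<le> C * (K * integral\<^sup>L (lebesgue_on {c..t}) (weighted_kernel l t))"
proof -
  have "norm (conv f1 t - conv f2 t) \<le> integral\<^sup>L (lebesgue_on {c..t}) (\<lambda>s. C * (K * (weighted_kernel l t s)))"
    unfolding conv_def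
  proof (rule norm_banach_integral_diff_le[OF int])
    show "integrable (lebesgue_on {c..t}) (\<lambda>s. C * (K * (weighted_kernel l t s)))"
      using k by simp
    have bound: "norm (integrand f1 t s - integrand f2 t s) \<le> C * (K * (weighted_kernel l t s))"
      if s: "s \<in> {c..t}" "s \<noteq> c" "s \<noteq> t" for s
    proof -
      have ts: "t - s \<in> {0..d - c}" using s t by auto
      have "integrand f1 t s - integrand f2 t s = (t - s) powr (\<eta> - 1) *\<^sub>R S (t - s) (f1 s - f2 s)"
        unfolding integrand_def by (simp add: linear_diff[OF lin[OF ts]] scaleR_diff_right)
      then have "norm (integrand f1 t s - integrand f2 t s) = (t - s) powr (\<eta> - 1) * norm (S (t - s) (f1 s - f2 s))"
        by simp
      also have "\<dots> \<le> (t - s) powr (\<eta> - 1) * (K * norm (f1 s - f2 s))"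
        by (intro mult_left_mono bd[OF ts]) auto
      also have "\<dots> \<le> (t - s) powr (\<eta> - 1) * (K * (C * ((s - c) powr (\<eta> - 1) * exp (l * (s - c)))))"
        using f[of s] s K by (intro mult_left_mono) auto
      also have "\<dots> = C * (K * (weighted_kernel l t s))"
        using s by (simp add: beta_kernel_def mult_ac)
      finally show ?thesis .
    qed
    show "AE s in lebesgue_on {c..t}. norm (integrand f1 t s - integrand f2 t s) \<le> C * (K * (weighted_kernel l t s))"
      using AE_lebesgue_on_neq[of "{c..t}" c, simplified] AE_lebesgue_on_neq[of "{c..t}" t, simplified] AE_space
      by eventually_elim (simp add: bound)
  qed
  also have "\<dots> = C * (K * integral\<^sup>L (lebesgue_on {c..t}) (weighted_kernel l t))"
    by simp
  finally show ?thesis .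
qed

text \<open>Weighted boundedness is all that \<open>PC_weighted\<close> provides, so continuity of
  the weighted functions at c is not assumed.\<close>

lemma volterra_unique:
  assumes lip: "\<And>s x y. s \<in> {c<..d} \<Longrightarrow> norm (h s x - h s y) \<le> \<kappa> * norm (x - y)" "0 \<le> \<kappa>"
    and y: "\<And>t. t \<in> {c<..d} \<Longrightarrow> banach_integrable (lebesgue_on {c..t}) (integrand (\<lambda>s. f s + h s (y s)) t)"
      "\<And>t. t \<in> {c<..d} \<Longrightarrow> y t = X t + conv (\<lambda>s. f s + h s (y s)) t"
      "\<And>t. t \<in> {c<..d} \<Longrightarrow> (t - c) powr (1 - \<eta>) * norm (y t) \<le> Cy"
    and z: "\<And>t. t \<in> {c<..d} \<Longrightarrow> banach_integrable (lebesgue_on {c..t}) (integrand (\<lambda>s. f s + h s (z s)) t)"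
      "\<And>t. t \<in> {c<..d} \<Longrightarrow> z t = X t + conv (\<lambda>s. f s + h s (z s)) t"
      "\<And>t. t \<in> {c<..d} \<Longrightarrow> (t - c) powr (1 - \<eta>) * norm (z t) \<le> Cz"
    and t: "t \<in> {c<..d}"
  shows "y t = z t"
proof -
  obtain l where l: "l > 0"
    "\<And>t. t \<in> {c<..d} \<Longrightarrow> integrable (lebesgue_on {c..t}) (weighted_kernel l t)"
    "\<And>t. t \<in> {c<..d} \<Longrightarrow> \<kappa> * K * integral\<^sup>L (lebesgue_on {c..t}) (weighted_kernel l t)
       \<le> 1 / 2 * ((t - c) powr (\<eta> - 1) * exp (l * (t - c)))"
    by (rule bielecki_weight[of "\<kappa> * K"]) (use lip K in auto)
  define w where "w t = (t - c) powr (\<eta> - 1) * exp (l * (t - c))" for t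
  have w: "w t > 0" if "t \<in> {c<..d}" for t using that by (simp add: w_def)
  define E where "E t = norm (y t - z t) / w t" for t
  have E0: "E t \<ge> 0" if "t \<in> {c<..d}" for t using w[OF that] by (simp add: E_def)
  have bdd: "bdd_above (E ` {c<..d})"
  proof (rule bdd_aboveI2)
    fix t assume t: "t \<in> {c<..d}"
    have "inverse (w t) = exp (- (l * (t - c))) * (t - c) powr (1 - \<eta>)"
      unfolding w_def inverse_mult_distrib by (simp add: mult.commute flip: powr_minus exp_minus)
    then have "E t = exp (- (l * (t - c))) * ((t - c) powr (1 - \<eta>) * norm (y t - z t))"
      unfolding E_def by (simp add: divide_inverse mult_ac)
    also have "\<dots> \<le> 1 * ((t - c) powr (1 - \<eta>) * norm (y t - z t))"
      using l t by (intro mult_right_mono) auto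
    also have "\<dots> \<le> (t - c) powr (1 - \<eta>) * norm (y t) + (t - c) powr (1 - \<eta>) * norm (z t)"
      using mult_left_mono[OF norm_triangle_ineq4[of "y t" "z t"], of "(t - c) powr (1 - \<eta>)"]
      by (simp add: distrib_left)
    also have "\<dots> \<le> Cy + Cz" using y(3)[OF t] z(3)[OF t] by simp
    finally show "E t \<le> Cy + Cz" .
  qed
  \<comment> \<open>The weighted supremum of the difference is finite by \<open>bdd\<close>; the
    Volterra estimate then gives D \<le> D / 2.\<close>
  define D where "D = (SUP t\<in>{c<..d}. E t)"
  have ED: "E t \<le> D" if "t \<in> {c<..d}" for t
    unfolding D_def by (rule cSUP_upper[OF that bdd])
  have D0: "D \<ge> 0" using ED[OF t] E0[OF t] by linarith
  have diff: "norm (y s - z s) \<le> D * w s" if "s \<in> {c<..d}" for s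
    using ED[OF that] w[OF that] by (simp add: E_def field_simps)
  have "E t \<le> D / 2" if t: "t \<in> {c<..d}" for t
  proof -
    have "norm (y t - z t) = norm (conv (\<lambda>s. f s + h s (y s)) t - conv (\<lambda>s. f s + h s (z s)) t)"
      by (subst y(2)[OF t], subst z(2)[OF t]) simp
    also have "\<dots> \<le> (\<kappa> * D) * (K * integral\<^sup>L (lebesgue_on {c..t}) (weighted_kernel l t))"
    proof (rule norm_conv_diff_le[OF t y(1)[OF t] z(1)[OF t] l(2)[OF t]])
      fix s assume "s \<in> {c<..t}"
      then have s: "s \<in> {c<..d}" using t by auto
      have "norm (f s + h s (y s) - (f s + h s (z s))) \<le> \<kappa> * norm (y s - z s)"
        using lip(1)[OF s] by simp
      also have "\<dots> \<le> \<kappa> * (D * w s)" using diff[OF s] lip(2) by (rule mult_left_mono)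
      finally show "norm (f s + h s (y s) - (f s + h s (z s))) \<le> \<kappa> * D * ((s - c) powr (\<eta> - 1) * exp (l * (s - c)))"
        by (simp add: w_def)
    qed (use lip D0 in auto)
    also have "\<dots> = D * (\<kappa> * K * integral\<^sup>L (lebesgue_on {c..t}) (weighted_kernel l t))"
      by (simp add: mult_ac)
    also have "\<dots> \<le> D * (1 / 2 * w t)"
      using l(3)[OF t] D0 unfolding w_def by (rule mult_left_mono)
    finally show ?thesis using w[OF t] by (simp add: E_def field_simps)
  qed
  then have "D \<le> D / 2"
    unfolding D_def using t by (intro cSUP_least) auto
  then have "E t \<le> 0" using ED[OF t] by linarith
  then show ?thesis using w[OF t] by (simp add: E_def field_simps)
qed

text \<open>The unknown is v = z / w with the reciprocal weight w. It extends continuously to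
  [c, d], so Banach's theorem applies in the complete space of bounded continuous functions, and
  every \<open>Z v\<close> lies in \<open>C_weighted\<close>, where the hypothesis on h is
  available.\<close>

lemma volterra_exists:
  assumes lip: "\<And>s x y. s \<in> {c<..d} \<Longrightarrow> norm (h s x - h s y) \<le> \<kappa> * norm (x - y)" "0 \<le> \<kappa>"
    and h: "\<And>z. z \<in> C_weighted \<eta> c d \<Longrightarrow> (\<lambda>t. h t (z t)) \<in> Lq_space q {c..d}"
    and f: "admissible f"
  obtains z where "z \<in> C_weighted \<eta> c d"
    "\<And>t. t \<in> {c<..d} \<Longrightarrow> banach_integrable (lebesgue_on {c..t}) (integrand (\<lambda>s. f s + h s (z s)) t)"
    "\<And>t. t \<in> {c<..d} \<Longrightarrow> z t = (t - c) powr (\<eta> - 1) *\<^sub>R S (t - c) x0 + conv (\<lambda>s. f s + h s (z s)) t"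
proof -
  obtain l where l: "l > 0"
    "\<And>t. t \<in> {c<..d} \<Longrightarrow> integrable (lebesgue_on {c..t}) (weighted_kernel l t)"
    "\<And>t. t \<in> {c<..d} \<Longrightarrow> \<kappa> * K * integral\<^sup>L (lebesgue_on {c..t}) (weighted_kernel l t)
       \<le> 1 / 2 * ((t - c) powr (\<eta> - 1) * exp (l * (t - c)))"
    by (rule bielecki_weight[of "\<kappa> * K"]) (use lip K in auto)
  define w where "w t = (t - c) powr (\<eta> - 1) * exp (l * (t - c))" for t
  have w: "w t > 0" if "t \<in> {c<..d}" for t using that by (simp add: w_def)
  have w_inv: "inverse (w t) = exp (- (l * (t - c))) * (t - c) powr (1 - \<eta>)" for t
    unfolding w_def inverse_mult_distrib by (simp add: mult.commute flip: powr_minus exp_minus)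
  define Z :: "(real \<Rightarrow>\<^sub>C 'z) \<Rightarrow> real \<Rightarrow> 'z" where "Z v t = w t *\<^sub>R v t" for v t
  have Z: "Z v \<in> C_weighted \<eta> c d" for v
    unfolding C_weighted_def
  proof (intro CollectI exI conjI ballI)
    show "continuous_on {c..d} (\<lambda>t. exp (l * (t - c)) *\<^sub>R v t)"
      by (intro continuous_intros) auto
    fix t assume t: "t \<in> {c<..d}"
    have "(t - c) powr (1 - \<eta>) * (t - c) powr (\<eta> - 1) = 1"
      using t by (simp flip: powr_add)
    then have "(t - c) powr (1 - \<eta>) * w t = exp (l * (t - c))"
      by (simp add: w_def mult.assoc[symmetric])
    then show "exp (l * (t - c)) *\<^sub>R v t = (t - c) powr (1 - \<eta>) *\<^sub>R Z v t"
      by (simp add: Z_def)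
  qed
  define F where "F v s = f s + h s (Z v s)" for v s
  have adm: "admissible (F v)" for v
    unfolding F_def by (intro admissible_add f admissible_Lq h Z)
  \<comment> \<open>The value 0 at c is the continuous extension, because the convolution is bounded
    and the weight vanishes there.\<close>
  define G where "G v t = (if t = c then 0 else (t - c) powr (1 - \<eta>) *\<^sub>R conv (F v) t)" for v t
  have G: "continuous_on {c..d} (G v)" for v
    unfolding continuous_on_def
  proof
    fix t assume t: "t \<in> {c..d}"
    show "(G v \<longlongrightarrow> G v t) (at t within {c..d})"
    proof (cases "t = c")
      case True
      obtain W where W: "\<And>t. t \<in> {c<..d} \<Longrightarrow> norm (conv (F v) t) \<le> W"
        by (rule conv_bounded[OF adm]) blast
      have cW: "continuous_on {c..d} (\<lambda>t. (t - c) powr (1 - \<eta>) * W)"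
        using \<eta> by (intro continuous_intros continuous_on_powr') auto
      have "((\<lambda>t. (t - c) powr (1 - \<eta>) * W) \<longlongrightarrow> (c - c) powr (1 - \<eta>) * W) (at c within {c..d})"
        using bspec[OF cW[unfolded continuous_on_def], of c] cd by simp
      then have lim: "((\<lambda>t. (t - c) powr (1 - \<eta>) * W) \<longlongrightarrow> 0) (at c within {c..d})" by simp
      have "(G v \<longlongrightarrow> 0) (at c within {c..d})"
      proof (rule Lim_null_comparison[OF _ lim])
        show "\<forall>\<^sub>F t in at c within {c..d}. norm (G v t) \<le> (t - c) powr (1 - \<eta>) * W"
          unfolding eventually_at_filter
          by (rule always_eventually) (auto simp: G_def intro!: mult_left_mono W)
      qed
      then show ?thesis using True by (simp add: G_def)
    next
      case False
      have "continuous_on {c<..d} (\<lambda>t. (t - c) powr (1 - \<eta>) *\<^sub>R conv (F v) t)"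
        by (intro continuous_intros conv_continuous adm) auto
      then have "continuous_on {c<..d} (G v)"
        by (rule continuous_on_eq) (simp add: G_def)
      then have "(G v \<longlongrightarrow> G v t) (at t within {c<..d})"
        using t False unfolding continuous_on_def by auto
      also have "at t within {c<..d} = at t within {c..d}"
        by (rule at_within_nhd[of t "{c<..}"]) (use t False in auto)
      finally show ?thesis .
    qed
  qed
  \<comment> \<open>The right-hand side of the equation divided by w; the power of t - c in front of
    the initial value cancels.\<close>
  define P where "P v t = exp (- (l * (t - c))) *\<^sub>R (S (t - c) x0 + G v t)" for v t
  have P: "continuous_on (cbox c d) (P v)" for v
  proof -
    have "continuous_on {c..d} (\<lambda>t. S (t - c) x0)"
      by (intro continuous_on_compose2[OF cont] continuous_intros) auto
    then show ?thesis unfolding P_def using G by (auto intro!: continuous_intros)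
  qed
  \<comment> \<open>Constant continuation by \<open>clamp\<close> makes \<open>P v\<close> a bounded
    continuous function on the whole line without changing it on [c, d].\<close>
  have "\<exists>g :: real \<Rightarrow>\<^sub>C 'z. \<forall>x. g x = P v (clamp c d x)" for v
    by (rule continuous_on_cbox_bcontfunE[OF P]) blast
  then obtain \<Psi> :: "(real \<Rightarrow>\<^sub>C 'z) \<Rightarrow> real \<Rightarrow>\<^sub>C 'z" where \<Psi>: "\<And>v x. \<Psi> v x = P v (clamp c d x)"
    by metis
  have "dist (\<Psi> v1) (\<Psi> v2) \<le> 1 / 2 * dist v1 v2" for v1 v2
  proof (rule dist_bound)
    fix x
    define t where "t = clamp c d x"
    have t: "t \<in> {c..d}" using clamp_in_interval[of c d x] cd by (simp add: t_def)
    let ?D = "dist v1 v2"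
    have "norm (P v1 t - P v2 t) \<le> 1 / 2 * ?D"
    proof (cases "t = c")
      case False
      then have t': "t \<in> {c<..d}" using t by auto
      have "norm (conv (F v1) t - conv (F v2) t)
          \<le> (\<kappa> * ?D) * (K * integral\<^sup>L (lebesgue_on {c..t}) (weighted_kernel l t))"
      proof (rule norm_conv_diff_le[OF t' conv_eq(1)[OF adm t'] conv_eq(1)[OF adm t'] l(2)[OF t']])
        fix s assume "s \<in> {c<..t}"
        then have s: "s \<in> {c<..d}" using t by auto
        have "norm (F v1 s - F v2 s) \<le> \<kappa> * norm (Z v1 s - Z v2 s)"
          using lip(1)[OF s] by (simp add: F_def)
        also have "norm (Z v1 s - Z v2 s) = w s * norm (v1 s - v2 s)"
          using w[OF s] by (simp add: Z_def flip: scaleR_diff_right)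
        also have "\<kappa> * (w s * norm (v1 s - v2 s)) \<le> \<kappa> * (w s * ?D)"
          using dist_bounded[of v1 s v2] w[OF s] lip(2) by (intro mult_left_mono) (auto simp: dist_norm)
        finally show "norm (F v1 s - F v2 s) \<le> \<kappa> * ?D * ((s - c) powr (\<eta> - 1) * exp (l * (s - c)))"
          by (simp add: w_def mult_ac)
      qed (use lip in auto)
      also have "\<dots> = ?D * (\<kappa> * K * integral\<^sup>L (lebesgue_on {c..t}) (weighted_kernel l t))"
        by (simp add: mult_ac)
      also have "\<dots> \<le> ?D * (1 / 2 * w t)"
        using l(3)[OF t'] unfolding w_def by (rule mult_left_mono) simp
      finally have le: "norm (conv (F v1) t - conv (F v2) t) \<le> ?D * (1 / 2 * w t)" .
      have "P v1 t - P v2 t = inverse (w t) *\<^sub>R (conv (F v1) t - conv (F v2) t)"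
        using False by (simp add: P_def G_def w_inv scaleR_diff_right scaleR_add_right)
      then have "norm (P v1 t - P v2 t) = inverse (w t) * norm (conv (F v1) t - conv (F v2) t)"
        using w[OF t'] by simp
      also have "\<dots> \<le> inverse (w t) * (?D * (1 / 2 * w t))"
        using le w[OF t'] by (intro mult_left_mono) auto
      also have "\<dots> = 1 / 2 * ?D" using w[OF t'] by (simp add: field_simps)
      finally show ?thesis .
    qed (simp add: P_def G_def)
    then show "dist (\<Psi> v1 x) (\<Psi> v2 x) \<le> 1 / 2 * dist v1 v2"
      by (simp add: \<Psi> t_def dist_norm)
  qed
  then obtain v where v: "\<Psi> v = v"
    using banach_fix_type[of "1 / 2" \<Psi>] by auto
  show ?thesis
  proof (rule that[of "Z v"])
    show "Z v \<in> C_weighted \<eta> c d" by (rule Z)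
    fix t assume t: "t \<in> {c<..d}"
    show "banach_integrable (lebesgue_on {c..t}) (integrand (\<lambda>s. f s + h s (Z v s)) t)"
      using conv_eq(1)[OF adm[of v] t] by (simp add: F_def[abs_def])
    have "v t = P v t"
      using \<Psi>[of v t] t unfolding v by simp
    then have "Z v t = w t *\<^sub>R exp (- (l * (t - c))) *\<^sub>R (S (t - c) x0 + (t - c) powr (1 - \<eta>) *\<^sub>R conv (F v) t)"
      using t by (simp add: Z_def P_def G_def)
    also have "\<dots> = (t - c) powr (\<eta> - 1) *\<^sub>R S (t - c) x0 + (w t * inverse (w t)) *\<^sub>R conv (F v) t"
      by (simp add: w_inv scaleR_add_right mult_ac) (simp add: w_def mult.assoc flip: exp_add)
    finally show "Z v t = (t - c) powr (\<eta> - 1) *\<^sub>R S (t - c) x0 + conv (\<lambda>s. f s + h s (Z v s)) t"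
      using w[OF t] by (simp add: F_def[abs_def])
  qed
qed

end

section \<open>The memory term\<close>

lemma left_lim_cong:
  assumes "\<And>s. s \<in> {0<..<x} \<Longrightarrow> y s = z s" "0 < (x::real)"
  shows "left_lim y x = left_lim z x"
proof -
  have "\<forall>\<^sub>F s in at_left x. y s = z s"
    unfolding eventually_at_left_field using assms by (intro exI[of _ 0]) auto
  \<comment> \<open>The two functions have the same limits, so \<open>Lim\<close> returns the same
    value even when no limit exists.\<close>
  then have "(y \<longlongrightarrow> l) (at_left x) \<longleftrightarrow> (z \<longlongrightarrow> l) (at_left x)" for l
    by (rule tendsto_cong)
  then show ?thesis unfolding left_lim_def t2_space_class.Lim_def by simp
qed

lemma left_lim_eq:
  fixes z :: "real \<Rightarrow> 'z::t2_space"
  assumes "(z \<longlongrightarrow> l) (at_left x)"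
  shows "left_lim z x = l"
  unfolding left_lim_def using assms by (intro tendsto_Lim) (simp_all add: trivial_limit_at_left_real)

lemma continuous_on_Ioc_tendsto_left:
  fixes f :: "real \<Rightarrow> 'b::topological_space"
  assumes "continuous_on {c<..d} f" "c < d"
  shows "(f \<longlongrightarrow> f d) (at_left d)"
proof -
  have "(f \<longlongrightarrow> f d) (at d within {c<..d})"
    using assms unfolding continuous_on_def by auto
  also have "at d within {c<..d} = at d within {..<d}"
    by (rule at_within_nhd[of d "{c<..}"]) (use assms in auto)
  finally show ?thesis .
qed

lemma C_weighted_continuous_on:
  fixes z :: "real \<Rightarrow> 'z::real_normed_vector"
  assumes "z \<in> C_weighted \<eta> c d"
  shows "continuous_on {c<..d} z"
proof -
  from assms obtain g where g: "continuous_on {c..d} g" "\<And>t. t \<in> {c<..d} \<Longrightarrow> g t = (t - c) powr (1 - \<eta>) *\<^sub>R z t"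
    unfolding C_weighted_def by auto
  have "continuous_on {c<..d} (\<lambda>t. inverse ((t - c) powr (1 - \<eta>)) *\<^sub>R g t)"
    by (intro continuous_intros continuous_on_subset[OF g(1)]) auto
  then show ?thesis
    by (rule continuous_on_eq) (simp add: g(2))
qed

lemma C_weighted_bounded:
  fixes z :: "real \<Rightarrow> 'z::real_normed_vector"
  assumes "z \<in> C_weighted \<eta> c d"
  obtains C where "0 \<le> C" "\<And>t. t \<in> {c<..d} \<Longrightarrow> (t - c) powr (1 - \<eta>) * norm (z t) \<le> C"
proof -
  from assms obtain g where g: "continuous_on {c..d} g" "\<And>t. t \<in> {c<..d} \<Longrightarrow> g t = (t - c) powr (1 - \<eta>) *\<^sub>R z t"
    unfolding C_weighted_def by auto
  have "bounded (g ` {c..d})"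
    by (intro compact_imp_bounded compact_continuous_image g) auto
  then obtain C where C: "C > 0" "\<And>t. t \<in> {c..d} \<Longrightarrow> norm (g t) \<le> C"
    unfolding bounded_pos by auto
  have "(t - c) powr (1 - \<eta>) * norm (z t) \<le> C" if "t \<in> {c<..d}" for t
    using C(2)[of t] that by (simp add: g(2))
  then show ?thesis using that C(1) by (meson less_imp_le)
qed

lemma C_weighted_cong:
  assumes "\<And>t. t \<in> {c<..d} \<Longrightarrow> y t = z t"
  shows "y \<in> C_weighted \<eta> c d \<longleftrightarrow> z \<in> C_weighted \<eta> c d"
  using assms unfolding C_weighted_def by simp

text \<open>The majorant is a multiple of (s - c)^(eta - 1), obtained from
  \<open>beta_kernel\<close> with first exponent 1, whose factor (d - s)^0 is trivial.\<close>

lemma C_weighted_dominated: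
  fixes z :: "real \<Rightarrow> 'z::real_normed_vector"
  assumes z: "z \<in> C_weighted \<eta> c d" and \<eta>: "0 < \<eta>" and cd: "c < d"
  obtains g where "integrable (lebesgue_on {c..d}) g" "AE s in lebesgue_on {c..d}. norm (z s) \<le> g s"
proof -
  obtain C where C: "0 \<le> C" "\<And>t. t \<in> {c<..d} \<Longrightarrow> (t - c) powr (1 - \<eta>) * norm (z t) \<le> C"
    by (rule C_weighted_bounded[OF z]) blast
  have "integrable (lebesgue_on {c..d}) (\<lambda>s. C * beta_kernel 1 \<eta> c d s)"
    using beta_kernel_integral[of 1 \<eta> c d d] \<eta> cd by simp
  moreover have bound: "norm (z s) \<le> C * beta_kernel 1 \<eta> c d s" if "s \<in> {c..d}" "s \<noteq> c" "s \<noteq> d" for s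
  proof -
    have s: "c < s" "s < d" using that by auto
    have "(s - c) powr (\<eta> - 1) * ((s - c) powr (1 - \<eta>) * norm (z s)) \<le> (s - c) powr (\<eta> - 1) * C"
      using C(2)[of s] s by (intro mult_left_mono) auto
    moreover have "(s - c) powr (\<eta> - 1) * ((s - c) powr (1 - \<eta>) * norm (z s)) = norm (z s)"
      using s by (simp flip: mult.assoc powr_add)
    moreover have "beta_kernel 1 \<eta> c d s = (s - c) powr (\<eta> - 1)"
      using s by (simp add: beta_kernel_def)
    ultimately show ?thesis by (simp only: mult.commute)
  qed
  have "AE s in lebesgue_on {c..d}. norm (z s) \<le> C * beta_kernel 1 \<eta> c d s"
    using AE_lebesgue_on_neq[of "{c..d}" c, simplified] AE_lebesgue_on_neq[of "{c..d}" d, simplified] AE_space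
    by eventually_elim (simp add: bound)
  ultimately show ?thesis using that by blast
qed

text \<open>The contribution of the past interval [b, e] to a Riemann-Liouville derivative at a
  later time t, up to a constant factor.\<close>

definition memory :: "real \<Rightarrow> real \<Rightarrow> real \<Rightarrow> (real \<Rightarrow> 'z::banach) \<Rightarrow> real \<Rightarrow> 'z" where
  "memory \<eta> b e f t = banach_integral (lebesgue_on {b..e}) (\<lambda>s. (1 / (t - s) powr (1 + \<eta>)) *\<^sub>R f s)"

text \<open>The point 0 is excluded because solutions are compared only on (0, a], while the first
  interval of integration starts at \<open>p 0 = 0\<close>.\<close>

lemma memory_cong:
  assumes "\<And>s. s \<in> {b..e} \<Longrightarrow> s \<noteq> 0 \<Longrightarrow> f s = g s"
  shows "memory \<eta> b e f t = memory \<eta> b e g t"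
  unfolding memory_def
proof (rule banach_integral_cong_AE(1))
  show "AE s in lebesgue_on {b..e}. (1 / (t - s) powr (1 + \<eta>)) *\<^sub>R f s = (1 / (t - s) powr (1 + \<eta>)) *\<^sub>R g s"
    using AE_lebesgue_on_neq[of "{b..e}" 0, simplified] AE_space
    by eventually_elim (simp add: assms)
qed

lemma memory_measurable:
  fixes f :: "real \<Rightarrow> 'z::real_normed_vector"
  assumes "strongly_measurable (lebesgue_on {b..e}) f"
  shows "strongly_measurable (lebesgue_on {b..e}) (\<lambda>s. (1 / (t - s) powr (1 + \<eta>)) *\<^sub>R f s)"
proof (rule strongly_measurable_scaleR[OF _ assms])
  have "(\<lambda>s. 1 / (t - s) powr (1 + \<eta>)) \<in> borel_measurable borel" by measurable
  then have "(\<lambda>s. 1 / (t - s) powr (1 + \<eta>)) \<in> borel_measurable lebesgue"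
    by (simp add: measurable_completion)
  then show "(\<lambda>s. 1 / (t - s) powr (1 + \<eta>)) \<in> borel_measurable (lebesgue_on {b..e})"
    by (rule measurable_restrict_space1)
qed

lemma memory_kernel_le:
  fixes \<eta> c e s t :: real
  assumes "0 < \<eta>" "e < c" "s \<le> e" "c \<le> t"
  shows "1 / (t - s) powr (1 + \<eta>) \<le> 1 / (c - e) powr (1 + \<eta>)"
  using assms by (intro divide_left_mono powr_mono2) auto

lemma memory_dominated:
  fixes f :: "real \<Rightarrow> 'z::banach"
  assumes \<eta>: "0 < \<eta>" and e: "e < c" and g: "AE s in lebesgue_on {b..e}. norm (f s) \<le> g s" and t: "c \<le> t"
  shows "AE s in lebesgue_on {b..e}. norm ((1 / (t - s) powr (1 + \<eta>)) *\<^sub>R f s) \<le> 1 / (c - e) powr (1 + \<eta>) * g s"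
  using g AE_space
proof eventually_elim
  case (elim s)
  then have "norm ((1 / (t - s) powr (1 + \<eta>)) *\<^sub>R f s) = 1 / (t - s) powr (1 + \<eta>) * norm (f s)"
    by simp
  also have "\<dots> \<le> 1 / (c - e) powr (1 + \<eta>) * g s"
    using elim memory_kernel_le[OF \<eta> e _ t, of s] by (intro mult_mono) auto
  finally show ?case .
qed

lemma memory_continuous:
  fixes f :: "real \<Rightarrow> 'z::banach"
  assumes \<eta>: "0 < \<eta>" and f: "strongly_measurable (lebesgue_on {b..e}) f"
    and g: "integrable (lebesgue_on {b..e}) g" "AE s in lebesgue_on {b..e}. norm (f s) \<le> g s"
  shows "continuous_on {e<..} (memory \<eta> b e f)"
  unfolding continuous_on_def
proof
  fix t assume t: "t \<in> {e<..}"
  \<comment> \<open>To the right of the midpoint c the kernel is bounded on [b, e] by (c - e)^(-1 -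
    eta), so a single dominator serves near t.\<close>
  define c where "c = (e + t) / 2"
  have c: "e < c" "c < t" using t by (auto simp: c_def)
  have "continuous_on {c..} (memory \<eta> b e f)"
    unfolding continuous_on_sequentially
  proof (intro allI ballI impI, elim conjE)
    fix X t assume t: "t \<in> {c..}" and X: "\<forall>n. X n \<in> {c..}" "X \<longlonglongrightarrow> t"
    show "(memory \<eta> b e f \<circ> X) \<longlonglongrightarrow> memory \<eta> b e f t"
      unfolding comp_def memory_def
    proof (rule banach_integral_dominated_convergence[OF memory_measurable[OF f]])
      show "integrable (lebesgue_on {b..e}) (\<lambda>s. 1 / (c - e) powr (1 + \<eta>) * g s)"
        using g by simp
      show "AE s in lebesgue_on {b..e}. norm ((1 / (X n - s) powr (1 + \<eta>)) *\<^sub>R f s) \<le> 1 / (c - e) powr (1 + \<eta>) * g s" for n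
        by (rule memory_dominated[OF \<eta> c(1) g(2)]) (use X in auto)
      show "AE s in lebesgue_on {b..e}. (\<lambda>n. (1 / (X n - s) powr (1 + \<eta>)) *\<^sub>R f s) \<longlonglongrightarrow> (1 / (t - s) powr (1 + \<eta>)) *\<^sub>R f s"
        by (rule AE_I2) (use t c X in \<open>auto intro!: tendsto_intros\<close>)
    qed
  qed
  then have "(memory \<eta> b e f \<longlongrightarrow> memory \<eta> b e f t) (at t within {c..})"
    using c unfolding continuous_on_def by auto
  also have "at t within {c..} = at t within {e<..}"
    by (rule at_within_nhd[of t "{c<..}"]) (use c in auto)
  finally show "(memory \<eta> b e f \<longlongrightarrow> memory \<eta> b e f t) (at t within {e<..})" .
qed

text \<open>For the pieces carrying z, which may be unbounded near b: the gap between e and c keeps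
  the kernel bounded, so an integrable majorant of f is enough.\<close>

lemma memory_bound_gap:
  fixes f :: "real \<Rightarrow> 'z::banach"
  assumes \<eta>: "0 < \<eta>" and e: "e < c" and f: "strongly_measurable (lebesgue_on {b..e}) f"
    and g: "integrable (lebesgue_on {b..e}) g" "AE s in lebesgue_on {b..e}. norm (f s) \<le> g s" and t: "c \<le> t"
  shows "norm (memory \<eta> b e f t) \<le> 1 / (c - e) powr (1 + \<eta>) * integral\<^sup>L (lebesgue_on {b..e}) g"
proof -
  note dom = memory_dominated[OF \<eta> e g(2) t]
  have int: "integrable (lebesgue_on {b..e}) (\<lambda>s. 1 / (c - e) powr (1 + \<eta>) * g s)" using g by simp
  have "norm (memory \<eta> b e f t) \<le> integral\<^sup>L (lebesgue_on {b..e}) (\<lambda>s. 1 / (c - e) powr (1 + \<eta>) * g s)"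
    unfolding memory_def
    by (rule norm_banach_integral_le[OF banach_integrableI_bound[OF memory_measurable[OF f] int dom] int dom])
  then show ?thesis by simp
qed

text \<open>For the jump pieces, where e may equal c. There f is bounded and the kernel is
  integrated exactly; the antiderivative (t - s)^(-eta) / eta is the source of the singularity of
  the forcing.\<close>

lemma memory_bound_adjacent:
  fixes f :: "real \<Rightarrow> 'z::banach"
  assumes \<eta>: "0 < \<eta>" and b: "b \<le> e" and f: "strongly_measurable (lebesgue_on {b..e}) f"
    and C: "\<And>s. s \<in> {b..e} \<Longrightarrow> norm (f s) \<le> C" "0 \<le> C" and c: "e \<le> c" and t: "c < t"
  shows "norm (memory \<eta> b e f t) \<le> C / \<eta> * (t - c) powr (- \<eta>)"
proof -
  have "((\<lambda>s. (t - s) powr (- (1 + \<eta>))) has_integral (1 / \<eta> * (t - e) powr (- \<eta>) - 1 / \<eta> * (t - b) powr (- \<eta>))) {b..e}"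
  proof (rule fundamental_theorem_of_calculus[OF b])
    fix s assume s: "s \<in> {b..e}"
    have "((\<lambda>s. 1 / \<eta> * (t - s) powr (- \<eta>)) has_real_derivative (t - s) powr (- \<eta> - 1)) (at s within {b..e})"
      using s c t \<eta> by (auto intro!: derivative_eq_intros)
    moreover have "- \<eta> - 1 = - (1 + \<eta>)" by simp
    ultimately have "((\<lambda>s. 1 / \<eta> * (t - s) powr (- \<eta>)) has_real_derivative (t - s) powr (- (1 + \<eta>))) (at s within {b..e})"
      by (simp only:)
    then show "((\<lambda>s. 1 / \<eta> * (t - s) powr (- \<eta>)) has_vector_derivative (t - s) powr (- (1 + \<eta>))) (at s within {b..e})"
      by (simp add: has_real_derivative_iff_has_vector_derivative)
  qed
  note k = has_integral_nonneg_lebesgue_on[OF this]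
  have int: "integrable (lebesgue_on {b..e}) (\<lambda>s. C * (t - s) powr (- (1 + \<eta>)))"
    using k(1) by simp
  have dom: "AE s in lebesgue_on {b..e}. norm ((1 / (t - s) powr (1 + \<eta>)) *\<^sub>R f s) \<le> C * (t - s) powr (- (1 + \<eta>))"
  proof (rule AE_I2)
    fix s assume "s \<in> space (lebesgue_on {b..e})"
    then have "1 / (t - s) powr (1 + \<eta>) * norm (f s) \<le> 1 / (t - s) powr (1 + \<eta>) * C"
      by (intro mult_left_mono C) auto
    moreover have "(t - s) powr (- (1 + \<eta>)) = 1 / (t - s) powr (1 + \<eta>)"
      by (simp only: powr_minus_divide)
    ultimately show "norm ((1 / (t - s) powr (1 + \<eta>)) *\<^sub>R f s) \<le> C * (t - s) powr (- (1 + \<eta>))"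
      by (simp add: mult.commute)
  qed
  have "norm (memory \<eta> b e f t) \<le> integral\<^sup>L (lebesgue_on {b..e}) (\<lambda>s. C * (t - s) powr (- (1 + \<eta>)))"
    unfolding memory_def
    by (rule norm_banach_integral_le[OF banach_integrableI_bound[OF memory_measurable[OF f] int dom] int dom])
  also have "\<dots> = C * (1 / \<eta> * (t - e) powr (- \<eta>) - 1 / \<eta> * (t - b) powr (- \<eta>))"
    using k(2) by simp
  also have "\<dots> \<le> C * (1 / \<eta> * (t - c) powr (- \<eta>))"
  proof (intro mult_left_mono C)
    have "(t - e) powr (- \<eta>) \<le> (t - c) powr (- \<eta>)" using c t \<eta> by (intro powr_mono2') auto
    then have "1 / \<eta> * (t - e) powr (- \<eta>) \<le> 1 / \<eta> * (t - c) powr (- \<eta>)" using \<eta> by (intro mult_left_mono) auto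
    moreover have "0 \<le> 1 / \<eta> * (t - b) powr (- \<eta>)" using \<eta> by simp
    ultimately show "1 / \<eta> * (t - e) powr (- \<eta>) - 1 / \<eta> * (t - b) powr (- \<eta>) \<le> 1 / \<eta> * (t - c) powr (- \<eta>)"
      by linarith
  qed
  finally show ?thesis by simp
qed

lemma phi_memory:
  "phi \<eta> p \<tau> \<psi> z r t = (\<eta> / Gamma (1 - \<eta>)) *\<^sub>R (\<Sum>k<r. memory \<eta> (p k) (\<tau> (k + 1)) z t +
     memory \<eta> (\<tau> (k + 1)) (p (k + 1)) (\<lambda>s. \<psi> (k + 1) s (left_lim z (\<tau> (k + 1)))) t)"
  by (simp add: phi_def memory_def)

context weakly_singular
begin

lemma admissible_0: "admissible (\<lambda>s. 0)"
  by (rule admissible_singular[of _ 0]) auto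

lemma admissible_sum:
  assumes "finite I" "\<And>i. i \<in> I \<Longrightarrow> admissible (f i)"
  shows "admissible (\<lambda>s. \<Sum>i\<in>I. f i s)"
  using assms by (induction I rule: finite_induct) (auto intro: admissible_0 admissible_add)

lemma admissible_memory_gap:
  assumes "e < c" "strongly_measurable (lebesgue_on {b..e}) f"
    "integrable (lebesgue_on {b..e}) g" "AE s in lebesgue_on {b..e}. norm (f s) \<le> g s"
  shows "admissible (\<lambda>t. x *\<^sub>R memory \<eta> b e f t)"
proof (rule admissible_singular)
  define C where "C = \<bar>1 / (c - e) powr (1 + \<eta>) * integral\<^sup>L (lebesgue_on {b..e}) g\<bar>"
  show "continuous_on {c<..d} (\<lambda>t. x *\<^sub>R memory \<eta> b e f t)"
    using assms(1) by (intro continuous_intros continuous_on_subset[OF memory_continuous[OF \<eta>(1) assms(2-4)]]) auto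
  show "0 \<le> \<bar>x\<bar> * C * (d - c) powr \<eta>" by (simp add: C_def)
  fix t assume t: "t \<in> {c<..d}"
  have "norm (memory \<eta> b e f t) \<le> C"
    using memory_bound_gap[OF \<eta>(1) assms, of t] t unfolding C_def
    by (intro order_trans[OF _ abs_ge_self]) auto
  then have "norm (x *\<^sub>R memory \<eta> b e f t) \<le> \<bar>x\<bar> * C * 1"
    by (simp add: mult_left_mono)
  \<comment> \<open>A constant is cast into the singular form, as (t - c)^(-eta) is bounded below on
    (c, d].\<close>
  also have "\<dots> \<le> \<bar>x\<bar> * C * ((d - c) powr \<eta> * (t - c) powr (- \<eta>))"
  proof (intro mult_left_mono)
    have "1 = (t - c) powr \<eta> * (t - c) powr (- \<eta>)" using t by (simp flip: powr_add)
    also have "\<dots> \<le> (d - c) powr \<eta> * (t - c) powr (- \<eta>)"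
      using t \<eta> by (intro mult_right_mono powr_mono2) auto
    finally show "1 \<le> (d - c) powr \<eta> * (t - c) powr (- \<eta>)" .
  qed (simp add: C_def)
  finally show "norm (x *\<^sub>R memory \<eta> b e f t) \<le> \<bar>x\<bar> * C * (d - c) powr \<eta> * (t - c) powr (- \<eta>)"
    by (simp add: mult_ac)
qed

lemma admissible_memory_adjacent:
  assumes "e \<le> c" "b \<le> e" and f: "continuous_on {b..e} f"
  shows "admissible (\<lambda>t. x *\<^sub>R memory \<eta> b e f t)"
proof -
  have "bounded (f ` {b..e})"
    by (intro compact_imp_bounded compact_continuous_image f) auto
  then obtain C where C: "C > 0" "\<And>s. s \<in> {b..e} \<Longrightarrow> norm (f s) \<le> C"
    unfolding bounded_pos by auto
  have sf: "strongly_measurable (lebesgue_on {b..e}) f"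
    by (rule strongly_measurable_continuous_on[OF f]) auto
  have g: "integrable (lebesgue_on {b..e}) (\<lambda>s. C)"
    by (simp add: finite_measure.integrable_const finite_measure_lebesgue_on)
  have g': "AE s in lebesgue_on {b..e}. norm (f s) \<le> C"
    using C by (intro AE_I2) auto
  show ?thesis
  proof (rule admissible_singular)
    show "continuous_on {c<..d} (\<lambda>t. x *\<^sub>R memory \<eta> b e f t)"
      using assms(1) by (intro continuous_intros continuous_on_subset[OF memory_continuous[OF \<eta>(1) sf g g']]) auto
    show "0 \<le> \<bar>x\<bar> * (C / \<eta>)" using C \<eta> by simp
    fix t assume t: "t \<in> {c<..d}"
    have "norm (memory \<eta> b e f t) \<le> C / \<eta> * (t - c) powr (- \<eta>)"
      using C t by (intro memory_bound_adjacent[OF \<eta>(1) assms(2) sf _ _ assms(1)]) auto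
    from mult_left_mono[OF this abs_ge_zero[of x]]
    show "norm (x *\<^sub>R memory \<eta> b e f t) \<le> \<bar>x\<bar> * (C / \<eta>) * (t - c) powr (- \<eta>)"
      unfolding norm_scaleR mult.assoc .
  qed
qed

end

section \<open>Gluing the intervals\<close>

text \<open>S stands for \<open>T_eta \<eta> T\<close> and w for \<open>B u\<close>, so that one
  control is fixed.\<close>

locale impulsive_problem =
  fixes a \<eta> q \<kappa> K :: real and m :: nat and p \<tau> :: "nat \<Rightarrow> real"
    and S :: "real \<Rightarrow> 'z::banach \<Rightarrow> 'z" and w :: "real \<Rightarrow> 'z" and h :: "real \<Rightarrow> 'z \<Rightarrow> 'z"
    and \<psi> :: "nat \<Rightarrow> real \<Rightarrow> 'z \<Rightarrow> 'z" and z0 :: 'z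
  assumes \<eta>: "0 < \<eta>" "\<eta> < 1" and pp: "partition_points a m p \<tau>" and q: "1 / \<eta> < q" and K: "0 \<le> K"
    and lin: "\<And>t. t \<in> {0..a} \<Longrightarrow> linear (S t)"
    and bd: "\<And>t x. t \<in> {0..a} \<Longrightarrow> norm (S t x) \<le> K * norm x"
    and cont: "\<And>x. continuous_on {0..a} (\<lambda>t. S t x)"
    and w: "w \<in> Lq_space q {0..a}"
    and h: "\<And>r z. r \<le> m \<Longrightarrow> z \<in> C_weighted \<eta> (p r) (\<tau> (r + 1)) \<Longrightarrow> (\<lambda>t. h t (z t)) \<in> Lq_space q {p r..\<tau> (r + 1)}"
    and \<kappa>: "0 \<le> \<kappa>" and lip: "\<And>t x y. t \<in> {0..a} \<Longrightarrow> norm (h t x - h t y) \<le> \<kappa> * norm (x - y)"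
    and \<psi>: "\<And>r. r \<in> {1..m} \<Longrightarrow> continuous_on ({\<tau> r..p r} \<times> UNIV) (\<lambda>(t, z). \<psi> r t z)"
begin

section \<open>Order of the break points\<close>

lemma p_0: "p 0 = 0"
  and p_less_\<tau>: "r \<le> m \<Longrightarrow> p r < \<tau> (r + 1)"
  and \<tau>_less_p: "r < m \<Longrightarrow> \<tau> (r + 1) < p (r + 1)"
  and \<tau>_p_end: "\<tau> (m + 1) = a" "p (m + 1) = a"
  using pp unfolding partition_points_def by auto

text \<open>For r = m the two points coincide with a, so the jump interval is empty; hence the weak
  inequality.\<close>

lemma \<tau>_le_p: "r \<le> m \<Longrightarrow> \<tau> (r + 1) \<le> p (r + 1)"
  using \<tau>_less_p[of r] \<tau>_p_end by (cases "r = m") auto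

lemma p_mono: "i \<le> j \<Longrightarrow> j \<le> m + 1 \<Longrightarrow> p i \<le> p j"
proof (induction j rule: dec_induct)
  case (step n)
  then show ?case using p_less_\<tau>[of n] \<tau>_le_p[of n] by simp
qed simp

lemma p_nonneg: "r \<le> m + 1 \<Longrightarrow> 0 \<le> p r"
  using p_mono[of 0 r] p_0 by simp

lemma p_le: "r \<le> m + 1 \<Longrightarrow> p r \<le> a"
  using p_mono[of r "m + 1"] \<tau>_p_end by simp

lemma \<tau>_le: "r \<le> m \<Longrightarrow> \<tau> (r + 1) \<le> a"
  using \<tau>_le_p[of r] p_le[of "r + 1"] by simp

lemma \<tau>_le_later_p: "k < r \<Longrightarrow> r \<le> m \<Longrightarrow> \<tau> (k + 1) < p r"
  using \<tau>_less_p[of k] p_mono[of "k + 1" r] by simp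

lemma weakly_singular: "r \<le> m \<Longrightarrow> weakly_singular S \<eta> K (p r) (\<tau> (r + 1)) q"
  using \<eta> q K p_less_\<tau>[of r] p_nonneg[of r] \<tau>_le[of r]
  by (intro weakly_singular.intro) (auto intro!: lin bd continuous_on_subset[OF cont])

lemma continuous_on_\<psi>:
  assumes "r < m"
  shows "continuous_on {\<tau> (r + 1)..p (r + 1)} (\<lambda>s. \<psi> (r + 1) s y)"
proof -
  have "continuous_on {\<tau> (r + 1)..p (r + 1)} (\<lambda>s. case (s, y) of (t, z) \<Rightarrow> \<psi> (r + 1) t z)"
    by (rule continuous_on_compose2[OF \<psi>[of "r + 1"]])
       (use assms in \<open>auto intro!: continuous_on_Pair continuous_on_id continuous_on_const\<close>)
  then show ?thesis by simp
qed

text \<open>Causality, on which the successive solution rests: all integrals and left limits in the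
  memory term use only times up to \<open>p r\<close>, the left limits at points strictly before
  it.\<close>

lemma phi_cong:
  assumes r: "r \<le> m" and yz: "\<And>s. s \<in> {0<..p r} \<Longrightarrow> y s = z s"
  shows "phi \<eta> p \<tau> \<psi> y r = phi \<eta> p \<tau> \<psi> z r"
proof
  fix t
  have "memory \<eta> (p k) (\<tau> (k + 1)) y t = memory \<eta> (p k) (\<tau> (k + 1)) z t"
    and "left_lim y (\<tau> (k + 1)) = left_lim z (\<tau> (k + 1))" if k: "k < r" for k
  proof -
    have bounds: "0 \<le> p k" "p k < \<tau> (k + 1)" "\<tau> (k + 1) < p r"
      using p_nonneg[of k] p_less_\<tau>[of k] \<tau>_le_later_p[of k r] k r by auto
    show "memory \<eta> (p k) (\<tau> (k + 1)) y t = memory \<eta> (p k) (\<tau> (k + 1)) z t"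
      using bounds by (intro memory_cong yz) auto
    show "left_lim y (\<tau> (k + 1)) = left_lim z (\<tau> (k + 1))"
      using bounds by (intro left_lim_cong yz) auto
  qed
  then show "phi \<eta> p \<tau> \<psi> y r t = phi \<eta> p \<tau> \<psi> z r t"
    unfolding phi_memory by simp
qed

lemma initial_value_cong:
  assumes r: "r \<le> m" and yz: "\<And>s. s \<in> {0<..p r} \<Longrightarrow> y s = z s"
  shows "initial_value p \<tau> \<psi> z0 y r = initial_value p \<tau> \<psi> z0 z r"
proof (cases r)
  case (Suc k)
  have "left_lim y (\<tau> (k + 1)) = left_lim z (\<tau> (k + 1))"
    using p_nonneg[of k] p_less_\<tau>[of k] \<tau>_le_later_p[of k r] r Suc by (intro left_lim_cong yz) auto
  then show ?thesis using Suc by (simp add: initial_value_def)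
qed (simp add: initial_value_def)

definition forcing :: "(real \<Rightarrow> 'z) \<Rightarrow> nat \<Rightarrow> real \<Rightarrow> 'z" where
  "forcing z r s = w s + phi \<eta> p \<tau> \<psi> z r s"

lemma forcing_cong:
  assumes "r \<le> m" "\<And>s. s \<in> {0<..p r} \<Longrightarrow> y s = z s"
  shows "forcing y r = forcing z r"
proof -
  have "phi \<eta> p \<tau> \<psi> y r = phi \<eta> p \<tau> \<psi> z r"
    by (rule phi_cong[OF assms])
  then show ?thesis by (simp add: forcing_def fun_eq_iff)
qed

text \<open>The mild equation at one time, regrouped as known forcing plus the nonlinearity, to
  match \<open>volterra_exists\<close> and \<open>volterra_unique\<close>.\<close>

definition interval_eq :: "(real \<Rightarrow> 'z) \<Rightarrow> nat \<Rightarrow> real \<Rightarrow> bool" where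
  "interval_eq z r t \<longleftrightarrow> (let F = (\<lambda>s. (t - s) powr (\<eta> - 1) *\<^sub>R S (t - s) (forcing z r s + h s (z s)))
     in banach_integrable (lebesgue_on {p r..t}) F \<and>
        z t = (t - p r) powr (\<eta> - 1) *\<^sub>R S (t - p r) (initial_value p \<tau> \<psi> z0 z r)
              + banach_integral (lebesgue_on {p r..t}) F)"

definition mild :: "(real \<Rightarrow> 'z) \<Rightarrow> bool" where
  "mild z \<longleftrightarrow> z \<in> PC_weighted \<eta> m p \<tau> \<and> (\<forall>r\<in>{0..m}. \<forall>t\<in>{p r<..\<tau> (r + 1)}. interval_eq z r t) \<and>
     (\<forall>r\<in>{1..m}. \<forall>t\<in>{\<tau> r<..p r}. z t = \<psi> r t (left_lim z (\<tau> r)))"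

lemma interval_eq_cong:
  assumes r: "r \<le> m" and yz: "\<And>s. s \<in> {0<..\<tau> (r + 1)} \<Longrightarrow> y s = z s" and t: "t \<in> {p r<..\<tau> (r + 1)}"
  shows "interval_eq y r t \<longleftrightarrow> interval_eq z r t"
proof -
  have pr: "0 \<le> p r" "p r < \<tau> (r + 1)" using p_nonneg[of r] p_less_\<tau>[of r] r by auto
  have yz': "y s = z s" if "s \<in> {0<..p r}" for s
    using that pr by (intro yz) auto
  have f: "forcing y r = forcing z r"
    by (rule forcing_cong[OF r yz'])
  have iv_eq: "initial_value p \<tau> \<psi> z0 y r = initial_value p \<tau> \<psi> z0 z r"
    by (rule initial_value_cong[OF r yz'])
  let ?F = "\<lambda>z s. (t - s) powr (\<eta> - 1) *\<^sub>R S (t - s) (forcing z r s + h s (z s))"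
  have "AE s in lebesgue_on {p r..t}. ?F y s = ?F z s"
    using AE_lebesgue_on_neq[of "{p r..t}" "p r", simplified] AE_space
  proof eventually_elim
    case (elim s)
    then have "y s = z s" using pr t by (intro yz) auto
    then show ?case unfolding f by simp
  qed
  from banach_integral_cong_AE[OF this] show ?thesis
    unfolding interval_eq_def Let_def iv_eq
    using yz[of t] t pr by simp
qed

text \<open>The pieces carrying z end at \<open>\<tau> (k + 1)\<close>, strictly before
  \<open>p r\<close>, so the estimate with a gap applies. The jump pieces end at
  \<open>p (k + 1)\<close>, which equals \<open>p r\<close> for k = r - 1, and need the adjacent
  one.\<close>

lemma forcing_admissible:
  assumes r: "r \<le> m" and z: "\<And>k. k < r \<Longrightarrow> z \<in> C_weighted \<eta> (p k) (\<tau> (k + 1))"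
  shows "weakly_singular.admissible \<eta> (p r) (\<tau> (r + 1)) q (forcing z r)"
proof -
  interpret W: weakly_singular S \<eta> K "p r" "\<tau> (r + 1)" q by (rule weakly_singular[OF r])
  define x where "x = \<eta> / Gamma (1 - \<eta>)"
  have "W.admissible (\<lambda>t. \<Sum>k<r. x *\<^sub>R memory \<eta> (p k) (\<tau> (k + 1)) z t +
      x *\<^sub>R memory \<eta> (\<tau> (k + 1)) (p (k + 1)) (\<lambda>s. \<psi> (k + 1) s (left_lim z (\<tau> (k + 1)))) t)"
  proof (intro W.admissible_sum W.admissible_add)
    fix k assume "k \<in> {..<r}"
    then have k: "k < r" by simp
    obtain g where g: "integrable (lebesgue_on {p k..\<tau> (k + 1)}) g" "AE s in lebesgue_on {p k..\<tau> (k + 1)}. norm (z s) \<le> g s"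
      using C_weighted_dominated[OF z[OF k] \<eta>(1) p_less_\<tau>] k r by (metis less_imp_le_nat order_trans)
    show "W.admissible (\<lambda>t. x *\<^sub>R memory \<eta> (p k) (\<tau> (k + 1)) z t)"
      by (rule W.admissible_memory_gap[OF \<tau>_le_later_p[OF k r] strongly_measurable_Ioc[OF C_weighted_continuous_on[OF z[OF k]]] g])
    show "W.admissible (\<lambda>t. x *\<^sub>R memory \<eta> (\<tau> (k + 1)) (p (k + 1)) (\<lambda>s. \<psi> (k + 1) s (left_lim z (\<tau> (k + 1)))) t)"
    proof (rule W.admissible_memory_adjacent)
      show "p (k + 1) \<le> p r" using k r by (intro p_mono) auto
      show "\<tau> (k + 1) \<le> p (k + 1)" using k r by (intro \<tau>_le_p) auto
      show "continuous_on {\<tau> (k + 1)..p (k + 1)} (\<lambda>s. \<psi> (k + 1) s (left_lim z (\<tau> (k + 1))))"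
        using k r by (intro continuous_on_\<psi>) auto
    qed
  qed simp
  then have "W.admissible (phi \<eta> p \<tau> \<psi> z r)"
    unfolding phi_memory[abs_def] x_def by (simp add: scaleR_sum_right scaleR_add_right)
  moreover have "W.admissible w"
    using r p_nonneg[of r] \<tau>_le[of r] by (intro W.admissible_Lq Lq_space_subset[OF w]) auto
  ultimately show ?thesis
    unfolding forcing_def[abs_def] by (intro W.admissible_add)
qed

text \<open>The invariant of the induction over r. A stage consists of an interval of the
  differential equation and the jump interval after it, if any; \<open>C_weighted\<close> is
  recorded because the memory term of later stages is estimated from it.\<close>

definition solved :: "(real \<Rightarrow> 'z) \<Rightarrow> nat \<Rightarrow> bool" where
  "solved z r \<longleftrightarrow> z \<in> C_weighted \<eta> (p r) (\<tau> (r + 1)) \<and> (\<forall>t\<in>{p r<..\<tau> (r + 1)}. interval_eq z r t) \<and>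
     (r < m \<longrightarrow> (\<forall>t\<in>{\<tau> (r + 1)<..p (r + 1)}. z t = \<psi> (r + 1) t (left_lim z (\<tau> (r + 1)))))"

lemma solved_cong:
  assumes r: "r \<le> m" and yz: "\<And>s. s \<in> {0<..p (r + 1)} \<Longrightarrow> y s = z s"
  shows "solved y r \<longleftrightarrow> solved z r"
proof -
  have b: "0 \<le> p r" "p r < \<tau> (r + 1)" "\<tau> (r + 1) \<le> p (r + 1)"
    using p_nonneg[of r] p_less_\<tau>[of r] \<tau>_le_p[of r] r by auto
  have "y \<in> C_weighted \<eta> (p r) (\<tau> (r + 1)) \<longleftrightarrow> z \<in> C_weighted \<eta> (p r) (\<tau> (r + 1))"
    using b by (intro C_weighted_cong yz) auto
  moreover have "interval_eq y r t \<longleftrightarrow> interval_eq z r t" if "t \<in> {p r<..\<tau> (r + 1)}" for t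
    using b by (intro interval_eq_cong[OF r _ that] yz) auto
  moreover have "left_lim y (\<tau> (r + 1)) = left_lim z (\<tau> (r + 1))"
    using b by (intro left_lim_cong yz) auto
  moreover have "y t = z t" if "t \<in> {\<tau> (r + 1)<..p (r + 1)}" for t
    using b that by (intro yz) auto
  ultimately show ?thesis unfolding solved_def by auto
qed

lemma left_lim_C_weighted:
  assumes "r \<le> m" "z \<in> C_weighted \<eta> (p r) (\<tau> (r + 1))"
  shows "(z \<longlongrightarrow> z (\<tau> (r + 1))) (at_left (\<tau> (r + 1)))" "left_lim z (\<tau> (r + 1)) = z (\<tau> (r + 1))"
proof -
  show "(z \<longlongrightarrow> z (\<tau> (r + 1))) (at_left (\<tau> (r + 1)))"
    by (rule continuous_on_Ioc_tendsto_left[OF C_weighted_continuous_on[OF assms(2)] p_less_\<tau>[OF assms(1)]])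
  then show "left_lim z (\<tau> (r + 1)) = z (\<tau> (r + 1))" by (rule left_lim_eq)
qed

lemma solve_interval:
  assumes r: "r \<le> m" and z: "\<And>k. k < r \<Longrightarrow> solved z k"
  shows "\<exists>z'. \<forall>k\<le>r. solved z' k"
proof -
  interpret W: weakly_singular S \<eta> K "p r" "\<tau> (r + 1)" q by (rule weakly_singular[OF r])
  have b: "0 \<le> p r" "p r < \<tau> (r + 1)" "\<tau> (r + 1) \<le> p (r + 1)" "\<tau> (r + 1) \<le> a"
    using p_nonneg[of r] p_less_\<tau>[of r] \<tau>_le_p[of r] \<tau>_le[of r] r by auto
  have "W.admissible (forcing z r)"
    using z unfolding solved_def by (intro forcing_admissible[OF r]) auto
  moreover have "norm (h s x - h s y) \<le> \<kappa> * norm (x - y)" if "s \<in> {p r<..\<tau> (r + 1)}" for s x y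
    using that b by (intro lip) auto
  ultimately obtain y where y: "y \<in> C_weighted \<eta> (p r) (\<tau> (r + 1))"
    "\<And>t. t \<in> {p r<..\<tau> (r + 1)} \<Longrightarrow> banach_integrable (lebesgue_on {p r..t}) (W.integrand (\<lambda>s. forcing z r s + h s (y s)) t)"
    "\<And>t. t \<in> {p r<..\<tau> (r + 1)} \<Longrightarrow> y t = (t - p r) powr (\<eta> - 1) *\<^sub>R S (t - p r) (initial_value p \<tau> \<psi> z0 z r) +
        W.conv (\<lambda>s. forcing z r s + h s (y s)) t"
    using W.volterra_exists[of h \<kappa> "forcing z r" "initial_value p \<tau> \<psi> z0 z r"] \<kappa> h[OF r] by blast
  \<comment> \<open>The earlier stages are kept. Values beyond \<open>p (r + 1)\<close> are
    immaterial, and \<open>y (\<tau> (r + 1))\<close> is the left limit because y is continuous up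
    to that point.\<close>
  define z' where "z' t = (if t \<le> p r then z t else if t \<le> \<tau> (r + 1) then y t else \<psi> (r + 1) t (y (\<tau> (r + 1))))" for t
  have z'_z: "z' s = z s" if "s \<in> {0<..p r}" for s using that by (simp add: z'_def)
  have z'_y: "z' s = y s" if "s \<in> {p r<..\<tau> (r + 1)}" for s using that by (simp add: z'_def)
  have "solved z' k" if "k < r" for k
  proof -
    have "p (k + 1) \<le> p r" using that r by (intro p_mono) auto
    then show ?thesis
      using z[OF that] that r solved_cong[of k z' z] by (simp add: z'_def)
  qed
  moreover have "solved z' r"
    unfolding solved_def
  proof (intro conjI ballI impI)
    show C: "z' \<in> C_weighted \<eta> (p r) (\<tau> (r + 1))"
      using y(1) C_weighted_cong[where y = z' and z = y, OF z'_y] by simp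
    show "interval_eq z' r t" if t: "t \<in> {p r<..\<tau> (r + 1)}" for t
    proof -
      have iv: "initial_value p \<tau> \<psi> z0 z' r = initial_value p \<tau> \<psi> z0 z r"
        by (rule initial_value_cong[OF r z'_z])
      have f: "forcing z' r = forcing z r"
        by (rule forcing_cong[OF r z'_z])
      \<comment> \<open>At \<open>p r\<close> itself z' takes the old value, which may differ from
        that of y; a single point is null.\<close>
      have "AE s in lebesgue_on {p r..t}. W.integrand (\<lambda>s. forcing z r s + h s (y s)) t s
          = (t - s) powr (\<eta> - 1) *\<^sub>R S (t - s) (forcing z r s + h s (z' s))"
        using AE_lebesgue_on_neq[of "{p r..t}" "p r", simplified] AE_space
        by eventually_elim (use t in \<open>simp add: W.integrand_def z'_y\<close>)
      from banach_integral_cong_AE[OF this] show ?thesis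
        unfolding interval_eq_def Let_def f iv
        using y(2,3)[OF t] z'_y[OF t] by (simp add: W.conv_def)
    qed
    show "z' t = \<psi> (r + 1) t (left_lim z' (\<tau> (r + 1)))" if "t \<in> {\<tau> (r + 1)<..p (r + 1)}" for t
      unfolding left_lim_C_weighted(2)[OF r C] using that b by (simp add: z'_def)
  qed
  ultimately show ?thesis by (metis le_neq_implies_less)
qed

lemma PC_weighted_solved:
  assumes z: "\<And>r. r \<le> m \<Longrightarrow> solved z r"
  shows "z \<in> PC_weighted \<eta> m p \<tau>"
proof -
  have C: "z \<in> C_weighted \<eta> (p r) (\<tau> (r + 1))" if "r \<le> m" for r
    using z[OF that] unfolding solved_def by simp
  have jump: "z t = \<psi> (r + 1) t (left_lim z (\<tau> (r + 1)))" if "r < m" "t \<in> {\<tau> (r + 1)<..p (r + 1)}" for r t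
    using z[of r] that unfolding solved_def by simp
  have cont_jump: "continuous_on {\<tau> (r + 1)<..p (r + 1)} z" if r: "r < m" for r
  proof -
    have "continuous_on {\<tau> (r + 1)<..p (r + 1)} (\<lambda>t. \<psi> (r + 1) t (left_lim z (\<tau> (r + 1))))"
      by (rule continuous_on_subset[OF continuous_on_\<psi>[OF r]]) auto
    then show ?thesis by (rule continuous_on_eq) (simp add: jump[OF r])
  qed
  have "continuous_on (\<Union>r\<in>{0..m}. {p r<..<\<tau> (r + 1)}) z"
  proof (rule continuous_on_open_UN)
    show "continuous_on {p r<..<\<tau> (r + 1)} z" if "r \<in> {0..m}" for r
      using that by (intro continuous_on_subset[OF C_weighted_continuous_on[OF C]]) auto
  qed auto
  moreover have "continuous_on (\<Union>r\<in>{1..m}. {\<tau> r<..<p r}) z"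
  proof (rule continuous_on_open_UN)
    show "continuous_on {\<tau> r<..<p r} z" if r: "r \<in> {1..m}" for r
    proof -
      have k: "r = (r - 1) + 1" "r - 1 < m" using r by auto
      have "continuous_on {\<tau> r<..p r} z"
        using cont_jump[OF k(2)] k(1) by simp
      then show ?thesis by (rule continuous_on_subset) auto
    qed
  qed auto
  ultimately have cont: "continuous_on ((\<Union>r\<in>{0..m}. {p r<..<\<tau> (r + 1)}) \<union> (\<Union>r\<in>{1..m}. {\<tau> r<..<p r})) z"
    by (intro continuous_on_open_Un) auto
  have lims: "(z \<longlongrightarrow> z (p r)) (at_left (p r))" "(z \<longlongrightarrow> z (\<tau> r)) (at_left (\<tau> r))" if r: "r \<in> {1..m}" for r
  proof -
    have k: "r = (r - 1) + 1" "r - 1 < m" using r by auto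
    show "(z \<longlongrightarrow> z (p r)) (at_left (p r))"
      using continuous_on_Ioc_tendsto_left[OF cont_jump[OF k(2)] \<tau>_less_p[OF k(2)]] k(1) by simp
    show "(z \<longlongrightarrow> z (\<tau> r)) (at_left (\<tau> r))"
      using left_lim_C_weighted(1)[of "r - 1", OF _ C] k by simp
  qed
  have "\<exists>C. \<forall>t\<in>{p r<..p (r + 1)}. (t - p r) powr (1 - \<eta>) * norm (z t) \<le> C" if r: "r \<le> m" for r
  proof -
    obtain C1 where C1: "\<And>t. t \<in> {p r<..\<tau> (r + 1)} \<Longrightarrow> (t - p r) powr (1 - \<eta>) * norm (z t) \<le> C1"
      by (rule C_weighted_bounded[OF C[OF r]]) blast
    obtain C2 where C2: "\<And>t. t \<in> {\<tau> (r + 1)<..p (r + 1)} \<Longrightarrow> (t - p r) powr (1 - \<eta>) * norm (z t) \<le> C2"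
    proof (cases "r < m")
      case True
      have "bounded ((\<lambda>t. \<psi> (r + 1) t (left_lim z (\<tau> (r + 1)))) ` {\<tau> (r + 1)..p (r + 1)})"
        by (intro compact_imp_bounded compact_continuous_image continuous_on_\<psi> True) auto
      then obtain C where "C > 0" "\<And>t. t \<in> {\<tau> (r + 1)..p (r + 1)} \<Longrightarrow> norm (\<psi> (r + 1) t (left_lim z (\<tau> (r + 1)))) \<le> C"
        unfolding bounded_pos by auto
      then have "(t - p r) powr (1 - \<eta>) * norm (z t) \<le> (p (r + 1) - p r) powr (1 - \<eta>) * C"
        if "t \<in> {\<tau> (r + 1)<..p (r + 1)}" for t
        using that jump[OF True that] \<eta> p_less_\<tau>[OF r] by (intro mult_mono powr_mono2) auto
      then show ?thesis by (rule that)
    next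
      case False
      then have "{\<tau> (r + 1)<..p (r + 1)} = {}" using r \<tau>_p_end by auto
      then show ?thesis using that by blast
    qed
    show ?thesis
    proof (intro exI ballI)
      fix t assume t: "t \<in> {p r<..p (r + 1)}"
      show "(t - p r) powr (1 - \<eta>) * norm (z t) \<le> max C1 C2"
        using C1[of t] C2[of t] t by (cases "t \<le> \<tau> (r + 1)") (auto simp: le_max_iff_disj)
    qed
  qed
  with cont lims show ?thesis unfolding PC_weighted_def by auto
qed

lemma mild_exists: "\<exists>z. mild z"
proof -
  have "\<exists>z. \<forall>k<r. solved z k" if "r \<le> m + 1" for r
    using that
  proof (induction r)
    case (Suc r)
    then obtain z where "\<forall>k<r. solved z k" by auto
    then show ?case using solve_interval[of r z] Suc.prems by (auto simp: less_Suc_eq_le)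
  qed simp
  then obtain z where "\<forall>k<m + 1. solved z k" by blast
  then have z: "solved z r" if "r \<le> m" for r using that by simp
  have "mild z"
    unfolding mild_def
  proof (intro conjI ballI)
    show "z \<in> PC_weighted \<eta> m p \<tau>" by (rule PC_weighted_solved[OF z])
    show "interval_eq z r t" if "r \<in> {0..m}" "t \<in> {p r<..\<tau> (r + 1)}" for r t
      using z[of r] that unfolding solved_def by auto
    show "z t = \<psi> r t (left_lim z (\<tau> r))" if "r \<in> {1..m}" "t \<in> {\<tau> r<..p r}" for r t
      using z[of "r - 1"] that unfolding solved_def by auto
  qed
  then show ?thesis by blast
qed

text \<open>Agreement on (0, p r] makes forcing and initial value on the next interval coincide,
  which reduces the claim to uniqueness for one Volterra equation. The jump values then agree
  because the left limits do.\<close>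

lemma mild_unique:
  assumes y: "mild y" and z: "mild z" and t: "t \<in> {0<..a}"
  shows "y t = z t"
proof -
  have "\<forall>t\<in>{0<..p r}. y t = z t" if "r \<le> m + 1" for r
    using that
  proof (induction r)
    case 0
    then show ?case using p_0 by simp
  next
    case (Suc r)
    then have r: "r \<le> m" and yz: "\<And>s. s \<in> {0<..p r} \<Longrightarrow> y s = z s" by auto
    interpret W: weakly_singular S \<eta> K "p r" "\<tau> (r + 1)" q by (rule weakly_singular[OF r])
    have b: "0 \<le> p r" "p r < \<tau> (r + 1)" "\<tau> (r + 1) \<le> p (r + 1)" "\<tau> (r + 1) \<le> a"
      using p_nonneg[of r] p_less_\<tau>[of r] \<tau>_le_p[of r] \<tau>_le[of r] r by auto
    have f: "forcing y r = forcing z r"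
      by (rule forcing_cong[OF r yz])
    have iv: "initial_value p \<tau> \<psi> z0 y r = initial_value p \<tau> \<psi> z0 z r"
      by (rule initial_value_cong[OF r yz])
    have integrand: "W.integrand g t = (\<lambda>s. (t - s) powr (\<eta> - 1) *\<^sub>R S (t - s) (g s))" for g t
      by (simp add: W.integrand_def[abs_def])
    have eq: "banach_integrable (lebesgue_on {p r..t}) (W.integrand (\<lambda>s. forcing x r s + h s (x s)) t)"
      "x t = (t - p r) powr (\<eta> - 1) *\<^sub>R S (t - p r) (initial_value p \<tau> \<psi> z0 x r) + W.conv (\<lambda>s. forcing x r s + h s (x s)) t"
      if "mild x" "t \<in> {p r<..\<tau> (r + 1)}" for x t
      using that r unfolding mild_def interval_eq_def Let_def integrand W.conv_def by auto
    have bounded: "\<exists>C. \<forall>t\<in>{p r<..p (r + 1)}. (t - p r) powr (1 - \<eta>) * norm (x t) \<le> C" if "mild x" for x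
      using that r unfolding mild_def PC_weighted_def by auto
    obtain Cy Cz where C: "\<And>t. t \<in> {p r<..p (r + 1)} \<Longrightarrow> (t - p r) powr (1 - \<eta>) * norm (y t) \<le> Cy"
      "\<And>t. t \<in> {p r<..p (r + 1)} \<Longrightarrow> (t - p r) powr (1 - \<eta>) * norm (z t) \<le> Cz"
      using bounded[OF y] bounded[OF z] by blast
    have l: "norm (h s x - h s y) \<le> \<kappa> * norm (x - y)" if "s \<in> {p r<..\<tau> (r + 1)}" for s x y
      using that b by (intro lip) auto
    have yz1: "y t = z t" if t: "t \<in> {p r<..\<tau> (r + 1)}" for t
    proof (rule W.volterra_unique[OF l \<kappa> _ _ _ _ _ _ t])
      show "banach_integrable (lebesgue_on {p r..t}) (W.integrand (\<lambda>s. forcing z r s + h s (y s)) t)"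
        "y t = (t - p r) powr (\<eta> - 1) *\<^sub>R S (t - p r) (initial_value p \<tau> \<psi> z0 z r) + W.conv (\<lambda>s. forcing z r s + h s (y s)) t"
        if "t \<in> {p r<..\<tau> (r + 1)}" for t
        using eq[OF y that] unfolding f iv by auto
      show "banach_integrable (lebesgue_on {p r..t}) (W.integrand (\<lambda>s. forcing z r s + h s (z s)) t)"
        "z t = (t - p r) powr (\<eta> - 1) *\<^sub>R S (t - p r) (initial_value p \<tau> \<psi> z0 z r) + W.conv (\<lambda>s. forcing z r s + h s (z s)) t"
        if "t \<in> {p r<..\<tau> (r + 1)}" for t
        using eq[OF z that] by auto
      show "(t - p r) powr (1 - \<eta>) * norm (y t) \<le> Cy" "(t - p r) powr (1 - \<eta>) * norm (z t) \<le> Cz"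
        if "t \<in> {p r<..\<tau> (r + 1)}" for t
        using C[of t] that b by auto
    qed
    have yz2: "y t = z t" if t: "t \<in> {\<tau> (r + 1)<..p (r + 1)}" for t
    proof -
      have "r < m" using t r \<tau>_p_end by (cases "r = m") auto
      then have rm: "r + 1 \<in> {1..m}" by simp
      have "left_lim y (\<tau> (r + 1)) = left_lim z (\<tau> (r + 1))"
      proof (rule left_lim_cong)
        show "y s = z s" if "s \<in> {0<..<\<tau> (r + 1)}" for s
          using yz[of s] yz1[of s] that by (cases "s \<le> p r") auto
      qed (use b in simp)
      moreover have "y t = \<psi> (r + 1) t (left_lim y (\<tau> (r + 1)))" "z t = \<psi> (r + 1) t (left_lim z (\<tau> (r + 1)))"
        using y z rm t unfolding mild_def by blast+
      ultimately show ?thesis by simp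
    qed
    show ?case
    proof
      fix t assume "t \<in> {0<..p (Suc r)}"
      then show "y t = z t"
        using yz[of t] yz1[of t] yz2[of t] by (cases "t \<le> p r"; cases "t \<le> \<tau> (r + 1)") auto
    qed
  qed
  from this[of "m + 1"] t \<tau>_p_end show ?thesis by auto
qed

end

theorem theorem1:
  fixes a \<eta> q \<kappa> d M :: real and m :: nat and p \<tau> b :: "nat \<Rightarrow> real"
    and D :: "'z::banach set" and A :: "'z \<Rightarrow> 'z" and T :: "real \<Rightarrow> 'z \<Rightarrow>\<^sub>L 'z"
    and B :: "(real \<Rightarrow> 'u::banach) \<Rightarrow> real \<Rightarrow> 'z"
    and z0 :: 'z and h :: "real \<Rightarrow> 'z \<Rightarrow> 'z" and \<psi> :: "nat \<Rightarrow> real \<Rightarrow> 'z \<Rightarrow> 'z"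
    and \<sigma> :: "real \<Rightarrow> real"
  assumes "a > 0" and "0 < \<eta>" and "\<eta> < 1" and "m \<ge> 1"
    and "partition_points a m p \<tau>"
    and "closure D = UNIV" and "C0_semigroup T" and "generator_of D A T"
    and "bdd_above ((\<lambda>t. norm (T t)) ` {0..a})" and "M = (SUP t\<in>{0..a}. norm (T t))"
    and "linear_map_Lq q {0..a} B"
    and "\<forall>r\<in>{0..m}. \<forall>z\<in>C_weighted \<eta> (p r) (\<tau> (r + 1)).
           (\<lambda>t. h t (z t)) \<in> Lq_space q {p r..\<tau> (r + 1)}"
    and "1 / \<eta> < q" and "q < 1 / (1 - \<eta>)"
    and "\<kappa> > 0" and "\<forall>t\<in>{0..a}. \<forall>z y. norm (h t z - h t y) \<le> \<kappa> * norm (z - y)"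
    and "\<sigma> \<in> Lq_space q {0..a}" and "\<forall>t\<in>{0..a}. 0 \<le> \<sigma> t" and "d > 0"
    and "\<forall>r\<in>{0..m}. AE t in lebesgue_on {p r<..p (r + 1)}. \<forall>z.
           norm (h t z) \<le> \<sigma> t + d * (t - p r) powr (1 - \<eta>) * norm z"
    and "\<forall>r\<in>{1..m}. continuous_on ({\<tau> r..p r} \<times> UNIV) (\<lambda>(t, z). \<psi> r t z)"
    and "\<forall>r\<in>{1..m}. 0 < b r \<and> b r \<le> 1"
    and "\<forall>r\<in>{1..m}. \<forall>t\<in>{\<tau> r..p r}. \<forall>z y. norm (\<psi> r t z - \<psi> r t y) \<le> b r * norm (z - y)"
    and "contraction_const \<eta> M \<kappa> m p \<tau> b < 1"
  shows "\<forall>u\<in>Lq_space q {0..a}. \<exists>z. mild_solution \<eta> m p \<tau> T B h \<psi> z0 u z \<and>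
           (\<forall>y. mild_solution \<eta> m p \<tau> T B h \<psi> z0 u y \<longrightarrow> (\<forall>t\<in>{0<..a}. y t = z t))"
proof
  fix u :: "real \<Rightarrow> 'u" assume u: "u \<in> Lq_space q {0..a}"
  obtain K where K: "K \<ge> 0" "\<And>t x. t \<in> {0..a} \<Longrightarrow> norm (T_eta \<eta> T t x) \<le> K * norm x"
    "\<And>t. t \<in> {0..a} \<Longrightarrow> linear (T_eta \<eta> T t)" "\<And>x. continuous_on {0..a} (\<lambda>t. T_eta \<eta> T t x)"
    by (rule T_eta_properties[OF assms(2,3,7,1,9)]) blast
  have "B u \<in> Lq_space q {0..a}" using assms(11) u unfolding linear_map_Lq_def by blast
  then interpret impulsive_problem a \<eta> q \<kappa> K m p \<tau> "T_eta \<eta> T" "B u" h \<psi> z0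
    by (intro impulsive_problem.intro) (use assms K in auto)
  \<comment> \<open>The two notions differ only in the order of the three summands under the
    integral.\<close>
  have "mild_solution \<eta> m p \<tau> T B h \<psi> z0 u z \<longleftrightarrow> mild z" for z
  proof -
    have "B u s + h s (z s) + phi \<eta> p \<tau> \<psi> z r s = (B u s + phi \<eta> p \<tau> \<psi> z r s) + h s (z s)" for r s
      by (simp add: add_ac)
    then show ?thesis
      unfolding mild_solution_def mild_def interval_eq_def forcing_def by (simp only:)
  qed
  then show "\<exists>z. mild_solution \<eta> m p \<tau> T B h \<psi> z0 u z \<and>
           (\<forall>y. mild_solution \<eta> m p \<tau> T B h \<psi> z0 u y \<longrightarrow> (\<forall>t\<in>{0<..a}. y t = z t))"
    using mild_exists mild_unique by blast
qed

end
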